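(* Assume $1<p<D_w$ and let $0<\varepsilon<1$. Suppose $\mathcal A,\mathcal B$ satisfy (H1)–(H3) with $$b,e\in L^{\frac{D_w}{p-1},w}(\Omega),\qquad c\in L^{\frac{D_w}{1-\varepsilon},w}(\Omega),\qquad d,f,g\in L^{\frac{D_w}{p-\varepsilon},w}(\Omega).$$ Let $x_0\in\Omega$ and $R>0$ with $B_{2R}(x_0)\subset\Omega$, and let $u\in H^{1,p,w}_{loc}$ be a local weak solution of $\operatorname{div}\mathcal A(x,u,\nabla u)=\mathcal B(x,u,\nabla u)$ in $B_{2R}(x_0)$. Define $$b_R=R^{p-1}\Big(⨍_{B_{2R}(x_0)}|b|^{\frac{D_w}{p-1}}w\Big)^{\frac{p-1}{D_w}},\quad c_R=R\Big(⨍_{B_{2R}(x_0)}|c|^{\frac{D_w}{1-\varepsilon}}w\Big)^{\frac{1-\varepsilon}{D_w}},\quad d_R=R^{p}\Big(⨍_{B_{2R}(x_0)}|d|^{\frac{D_w}{p-\varepsilon}}w\Big)^{\frac{p-\varepsilon}{D_w}},$$ $$e_R=R^{p-1}\Big(⨍_{B_{2R}(x_0)}|e|^{\frac{D_w}{p-1}}w\Big)^{\frac{p-1}{D_w}},\quad f_R=R^{p}\Big(⨍_{B_{2R}(x_0)}|f|^{\frac{D_w}{p-\varepsilon}}w\Big)^{\frac{p-\varepsilon}{D_w}},\quad g_R=R^{p}\Big(⨍_{B_{2R}(x_0)}|g|^{\frac{D_w}{p-\varepsilon}}w\Big)^{\frac{p-\varepsilon}{D_w}},$$ and $k_R=(e_R+f_R)^{\frac1{p-1}}+g_R^{\frac1p}$.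 Then $$\|u\|_{L^\infty(B_R(x_0))}\le C_R\Big[\Big(⨍_{B_{2R}(x_0)}|u|^pw\,dx\Big)^{1/p}+k_R\Big],$$ where $C_R>0$ depends only on $\varepsilon, D_w, N, p$, the constants of $w$ (doubling and Poincaré constants), and the quantities $b_R,c_R,d_R,e_R,f_R,g_R$.
   Context: Let $\Omega\subseteq\mathbb R^N$ be open and $1<p<\infty$. A weight is a function $w\in L^1_{loc}(\Omega)$ with $0<w<\infty$ Lebesgue-a.e.; write $w(E)=\int_E w\,dx$ and $⨍_E h\,w=w(E)^{-1}\int_E h\,w\,dx$. Standing assumptions on $w$: (i) doubling: there is $\gamma>0$ with $w(2B)\le\gamma\,w(B)$ for every ball $B$ with $2B\subset\Omega$ (here $\rho B$ is the concentric ball with radius multiplied by $\rho$); $\gamma_w$ denotes the smallest such $\gamma$; (ii) local weighted $(1,p)$-Poincaré inequality: there are $C_1>0$, $\rho\ge1$ such that for all $u\in C^1(\Omega)$ and balls $B$ of radius $l(B)$ with $\rho B\subset\Omega$, $w(B)^{-1}\int_B|u-u_{B,w}|w\le C_1 l(B)\big(w(\rho B)^{-1}\int_{\rho B}|\nabla u|^pw\big)^{1/p}$, where $u_{B,w}=w(B)^{-1}\int_B uw$. The dimension of $w$ is $D_w:=\log_2\gamma_w$, and $\chi_w:=D_w/(D_w-p)$ when $p<D_w$. For $1\le s<\infty$, $L^{s,w}(E)$ is the space of measurable $u$ with $\|u\|_{L^{s,w}(E)}^s=\int_E|u|^sw\,dx<\infty$. $H^{1,p,w}(\Omega)$ is the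 completion of $\{u\in C^1(\Omega):u,\partial_iu\in L^{p,w}(\Omega)\ \forall i\}$ under $\|u\|_{1,p,w}^p=\|u\|_{L^{p,w}}^p+\sum_i\|\partial_iu\|_{L^{p,w}}^p$ (its elements have a well-defined gradient $\nabla u$); $H^{1,p,w}_{loc}(U)$ consists of functions lying in $H^{1,p,w}(U')$ for every open $U'\Subset U$. Structure: $\mathcal A:\Omega\times\mathbb R\times\mathbb R^N\to\mathbb R^N$, $\mathcal B:\Omega\times\mathbb R\times\mathbb R^N\to\mathbb R$ are measurable and, for measurable $b,c,d,e,f,g:\Omega\to[0,\infty)$, satisfy for a.e. $x$ and all $(u,z)$: (H1) $\mathcal A(x,u,z)\cdot z\ge w(x)(|z|^p-d|u|^p-g)$; (H2) $|\mathcal A(x,u,z)|\le w(x)(|z|^{p-1}+b|u|^{p-1}+e)$; (H3) $|\mathcal B(x,u,z)|\le w(x)(c|z|^{p-1}+d|u|^{p-1}+f)$. A local weak solution of $\operatorname{div}\mathcal A(x,u,\nabla u)=\mathcal B(x,u,\nabla u)$ in an open set $U\subseteq\Omega$ is $u\in H^{1,p,w}_{loc}(U)$ with $\int_U\mathcal A(x,u,\nabla u)\cdot\nabla\varphi+\mathcal B(x,u,\nabla u)\varphi\,dx=0$ for all $\varphi\in H^{1,p,w}(U)$ with compact support in $U$. *)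

theory Defs
  imports "HOL-Analysis.Analysis"
begin

definition wmeas :: "('n::euclidean_space \<Rightarrow> real) \<Rightarrow> 'n set \<Rightarrow> ennreal" where
  "wmeas w E = (\<integral>\<^sup>+ x. ennreal (indicator E x * w x) \<partial>lebesgue)"

definition wavg :: "('n::euclidean_space \<Rightarrow> real) \<Rightarrow> 'n set \<Rightarrow> ('n \<Rightarrow> real) \<Rightarrow> real" where
  "wavg w E h = (LINT x:E|lebesgue. h x * w x) / (LINT x:E|lebesgue. w x)"

definition is_weight :: "'n::euclidean_space set \<Rightarrow> ('n \<Rightarrow> real) \<Rightarrow> bool" where
  "is_weight \<Omega> w \<longleftrightarrow>
     (\<forall>K. compact K \<and> K \<subseteq> \<Omega> \<longrightarrow> set_integrable lebesgue K w) \<and>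
     (AE x in lebesgue. x \<in> \<Omega> \<longrightarrow> 0 < w x)"

definition doubling_with :: "'n::euclidean_space set \<Rightarrow> ('n \<Rightarrow> real) \<Rightarrow> real \<Rightarrow> bool" where
  "doubling_with \<Omega> w \<gamma> \<longleftrightarrow>
     (\<forall>x r. 0 < r \<and> ball x (2 * r) \<subseteq> \<Omega> \<longrightarrow>
        wmeas w (ball x (2 * r)) \<le> ennreal \<gamma> * wmeas w (ball x r))"

definition gamma_w :: "'n::euclidean_space set \<Rightarrow> ('n \<Rightarrow> real) \<Rightarrow> real" where
  "gamma_w \<Omega> w = Inf {\<gamma>. 0 < \<gamma> \<and> doubling_with \<Omega> w \<gamma>}"

definition dim_w :: "'n::euclidean_space set \<Rightarrow> ('n \<Rightarrow> real) \<Rightarrow> real" where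
  "dim_w \<Omega> w = log 2 (gamma_w \<Omega> w)"

definition C1_grad :: "'n::euclidean_space set \<Rightarrow> ('n \<Rightarrow> real) \<Rightarrow> ('n \<Rightarrow> 'n) \<Rightarrow> bool" where
  "C1_grad U u Du \<longleftrightarrow>
     (\<forall>x\<in>U. (u has_derivative (\<lambda>h. Du x \<bullet> h)) (at x)) \<and> continuous_on U Du"

definition poincare_with ::
  "'n::euclidean_space set \<Rightarrow> ('n \<Rightarrow> real) \<Rightarrow> real \<Rightarrow> real \<Rightarrow> real \<Rightarrow> bool" where
  "poincare_with \<Omega> w p C1 \<rho> \<longleftrightarrow> 0 < C1 \<and> 1 \<le> \<rho> \<and>
     (\<forall>u Du x r. C1_grad \<Omega> u Du \<and> 0 < r \<and> ball x (\<rho> * r) \<subseteq> \<Omega> \<and>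
        set_integrable lebesgue (ball x r) (\<lambda>y. \<bar>u y\<bar> * w y) \<and>
        set_integrable lebesgue (ball x (\<rho> * r)) (\<lambda>y. norm (Du y) powr p * w y) \<longrightarrow>
        wavg w (ball x r) (\<lambda>y. \<bar>u y - wavg w (ball x r) u\<bar>)
          \<le> C1 * r * (wavg w (ball x (\<rho> * r)) (\<lambda>y. norm (Du y) powr p)) powr (1 / p))"

definition Lsw :: "real \<Rightarrow> ('n::euclidean_space \<Rightarrow> real) \<Rightarrow> 'n set \<Rightarrow> ('n \<Rightarrow> real) \<Rightarrow> bool" where
  "Lsw s w E h \<longleftrightarrow> set_borel_measurable lebesgue E h \<and>
     set_integrable lebesgue E (\<lambda>x. \<bar>h x\<bar> powr s * w x)"

(* (u, G) is an element of H^{1,p,w}(U) with gradient G: limit in the norm ||.||_{1,p,w}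
   of C^1 functions u_k with u_k, grad u_k in L^{p,w}(U) (i.e. an element of the completion) *)
definition H1pw :: "real \<Rightarrow> ('n::euclidean_space \<Rightarrow> real) \<Rightarrow> 'n set \<Rightarrow> ('n \<Rightarrow> real) \<Rightarrow> ('n \<Rightarrow> 'n) \<Rightarrow> bool" where
  "H1pw p w U u G \<longleftrightarrow>
     Lsw p w U u \<and> set_borel_measurable lebesgue U G \<and> Lsw p w U (\<lambda>x. norm (G x)) \<and>
     (\<exists>v Dv. (\<forall>k. C1_grad U (v k) (Dv k) \<and> Lsw p w U (v k) \<and> Lsw p w U (\<lambda>x. norm (Dv k x))) \<and>
        (\<lambda>k. LINT x:U|lebesgue. \<bar>v k x - u x\<bar> powr p * w x) \<longlonglongrightarrow> 0 \<and>
        (\<lambda>k. LINT x:U|lebesgue. norm (Dv k x - G x) powr p * w x) \<longlonglongrightarrow> 0)"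

definition cpt_sub :: "'n::euclidean_space set \<Rightarrow> 'n set \<Rightarrow> bool" where
  "cpt_sub V U \<longleftrightarrow> compact (closure V) \<and> closure V \<subseteq> U"

definition H1pw_loc :: "real \<Rightarrow> ('n::euclidean_space \<Rightarrow> real) \<Rightarrow> 'n set \<Rightarrow> ('n \<Rightarrow> real) \<Rightarrow> ('n \<Rightarrow> 'n) \<Rightarrow> bool" where
  "H1pw_loc p w U u G \<longleftrightarrow> (\<forall>V. open V \<and> cpt_sub V U \<longrightarrow> H1pw p w V u G)"

definition local_weak_solution ::
  "real \<Rightarrow> ('n::euclidean_space \<Rightarrow> real) \<Rightarrow> ('n \<Rightarrow> real \<Rightarrow> 'n \<Rightarrow> 'n) \<Rightarrow> ('n \<Rightarrow> real \<Rightarrow> 'n \<Rightarrow> real)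
     \<Rightarrow> 'n set \<Rightarrow> ('n \<Rightarrow> real) \<Rightarrow> bool" where
  "local_weak_solution p w A B U u \<longleftrightarrow>
     (\<exists>G. H1pw_loc p w U u G \<and>
        (\<forall>\<phi> D\<phi> K. H1pw p w U \<phi> D\<phi> \<and> compact K \<and> K \<subseteq> U \<and> (\<forall>x\<in>U - K. \<phi> x = 0) \<longrightarrow>
           set_integrable lebesgue U (\<lambda>x. A x (u x) (G x) \<bullet> D\<phi> x + B x (u x) (G x) * \<phi> x) \<and>
           (LINT x:U|lebesgue. A x (u x) (G x) \<bullet> D\<phi> x + B x (u x) (G x) * \<phi> x) = 0))"

definition structure_conditions ::
  "'n::euclidean_space set \<Rightarrow> ('n \<Rightarrow> real) \<Rightarrow> real \<Rightarrow> ('n \<Rightarrow> real \<Rightarrow> 'n \<Rightarrow> 'n) \<Rightarrow> ('n \<Rightarrow> real \<Rightarrow> 'n \<Rightarrow> real)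
     \<Rightarrow> ('n \<Rightarrow> real) \<Rightarrow> ('n \<Rightarrow> real) \<Rightarrow> ('n \<Rightarrow> real) \<Rightarrow> ('n \<Rightarrow> real) \<Rightarrow> ('n \<Rightarrow> real) \<Rightarrow> ('n \<Rightarrow> real) \<Rightarrow> bool" where
  "structure_conditions \<Omega> w p A B b c d e f g \<longleftrightarrow>
     (\<lambda>(x, t, z). A x t z) \<in> borel_measurable (restrict_space (lebesgue \<Otimes>\<^sub>M borel \<Otimes>\<^sub>M borel) (\<Omega> \<times> UNIV)) \<and>
     (\<lambda>(x, t, z). B x t z) \<in> borel_measurable (restrict_space (lebesgue \<Otimes>\<^sub>M borel \<Otimes>\<^sub>M borel) (\<Omega> \<times> UNIV)) \<and>
     (\<forall>h\<in>{b, c, d, e, f, g}. set_borel_measurable lebesgue \<Omega> h \<and> (\<forall>x\<in>\<Omega>. 0 \<le> h x)) \<and>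
     (AE x in lebesgue. x \<in> \<Omega> \<longrightarrow> (\<forall>t z.
        A x t z \<bullet> z \<ge> w x * (norm z powr p - d x * \<bar>t\<bar> powr p - g x) \<and>
        norm (A x t z) \<le> w x * (norm z powr (p - 1) + b x * \<bar>t\<bar> powr (p - 1) + e x) \<and>
        \<bar>B x t z\<bar> \<le> w x * (c x * norm z powr (p - 1) + d x * \<bar>t\<bar> powr (p - 1) + f x)))"

end

theory Submission
  imports Defs
begin

text \<open>
  De Giorgi iteration. The coefficients lie in \<open>L\<^sup>\<tau>\<close> with \<open>\<tau> = D / (p - \<epsilon>)\<close>, strictly better than the
  borderline \<open>D / p\<close>, so a Sobolev inequality with gain \<open>\<kappa> = D / (D - p + \<epsilon> / 2)\<close>, strictly below the
  critical \<open>D / (D - p)\<close>, is enough. Below the critical gain no maximal function is needed: a test function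
  is the telescoping series of its averages over the balls \<open>B(x, 2\<^sup>-\<^sup>i r)\<close>, the Poincare inequality bounds the
  increments, and the averaging operator at scale \<open>s\<close> maps \<open>L\<^sup>1\<close> to \<open>L\<^sup>\<kappa>\<close> with norm at most a power of \<open>1 / s\<close>
  by Tonelli and doubling, so the series converges geometrically.

  Testing the equation with \<open>\<eta>\<^sup>m F(u)\<close>, \<open>F\<close> a smooth version of \<open>sgn u (|u| - k)\<^sub>+\<close>, gives a Caccioppoli
  inequality for every level \<open>k\<close>. Its lower-order part is absorbed by Hoelder between \<open>L\<^sup>\<tau>\<close>, the Sobolev
  norm of \<open>\<eta>\<^sup>n F(u)\<close> and \<open>L\<^sup>p\<close>, which leaves a superlinear recursion
  \<open>y(j + 1) \<le> C b\<^sup>j y(j)\<^sup>1\<^sup>+\<^sup>\<theta>\<close> for the normalised energies above the levels \<open>K (1 - 2\<^sup>-\<^sup>j)\<close>. If \<open>K\<close> is a large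
  multiple of the right-hand side of the claim, \<open>y\<close> tends to zero, that is \<open>|u| \<le> K\<close>.
\<close>

section \<open>Hoelder inequalities\<close>

text \<open>The resource is the \<open>\<epsilon>\<close> by which \<open>c\<close>,
  \<open>d\<close>, \<open>f\<close>, \<open>g\<close> beat the borderline, and it is spent in two
  halves: \<open>p * \<kappa> - D * (\<kappa> - 1) = \<kappa> * \<epsilon> / 2\<close> is the margin
  that sums the telescoping series, and \<open>\<theta> = 1 - 1 / \<tau> - 1 / \<kappa> = \<epsilon>
  / (2 * D)\<close> is the gain in the recursion. For \<open>b\<close> and \<open>e\<close> no
  \<open>\<epsilon>\<close> is given, but \<open>D / (p - 1)\<close> exceeds
  \<open>D / (p - \<epsilon>)\<close> because \<open>\<epsilon> < 1\<close>. The obstacle is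
  locality. Doubling and Poincare hold only for balls inside \<Omega>, and the solution is a Sobolev
  function only on compact parts of the ball of radius \<open>2 * R\<close>. Hence the cutoffs live
  in radius \<open>5 / 4 * R\<close>, the solution is used in radius \<open>3 / 2 * R\<close>, and
  integrals refer to the weight normalised to mass one on the ball of radius \<open>2 * R\<close>. A
  second obstacle is a circularity: the tested equation gives information only if the lower-order
  integral is finite, and this finiteness has to come from the Sobolev inequality, applied once
  qualitatively before it is applied with constants.\<close>

lemma weighted_amgm2:
  fixes x y :: real
  assumes "0 \<le> x" "0 \<le> y" "0 < a" "0 < b" "a + b = 1"
  shows "x powr a * y powr b \<le> a * x + b * y"
  using Youngs_inequality_0[of a b x y] assms by (cases "x = 0 \<or> y = 0") auto

text \<open>Two applications of the two-term inequality: first to \<open>y\<close> and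
  \<open>z\<close> with renormalised weights, then to \<open>x\<close> and the resulting
  mean.\<close>

lemma weighted_amgm3:
  fixes x y z :: real
  assumes "0 \<le> x" "0 \<le> y" "0 \<le> z" "0 < a" "0 < b" "0 < c" "a + b + c = 1"
  shows "x powr a * y powr b * z powr c \<le> a * x + b * y + c * z"
proof -
  have bc: "b / (b + c) + c / (b + c) = 1"
    using assms by (simp add: add_divide_distrib[symmetric])
  have 1: "y powr (b / (b + c)) * z powr (c / (b + c)) \<le> b / (b + c) * y + c / (b + c) * z"
    by (rule weighted_amgm2) (use assms bc in auto)
  have nn: "0 \<le> y powr (b / (b + c)) * z powr (c / (b + c))" by simp
  have "y powr b * z powr c = (y powr (b / (b + c)) * z powr (c / (b + c))) powr (b + c)"
    using assms by (simp add: powr_mult powr_powr)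
  also have "\<dots> \<le> (b / (b + c) * y + c / (b + c) * z) powr (b + c)"
    by (rule powr_mono2) (use assms 1 nn in auto)
  finally have 2: "y powr b * z powr c \<le> (b / (b + c) * y + c / (b + c) * z) powr (b + c)" .
  have "x powr a * y powr b * z powr c = x powr a * (y powr b * z powr c)" by simp
  also have "\<dots> \<le> x powr a * (b / (b + c) * y + c / (b + c) * z) powr (b + c)"
    by (rule mult_left_mono[OF 2]) simp
  also have "\<dots> \<le> a * x + (b + c) * (b / (b + c) * y + c / (b + c) * z)"
    by (rule weighted_amgm2) (use assms in auto)
  also have "\<dots> = a * x + b * y + c * z"
    using assms by (simp add: distrib_left)
  finally show ?thesis .
qed

text \<open>Formulated for integrable functions raised to weights that sum to one, so that no
  conjugate exponents appear. Weighted AM-GM gives integrability directly and, after division by the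
  three integrals, the bound; if one integral vanishes, the product is zero almost
  everywhere.\<close>

lemma holder3:
  fixes f g h :: "'a \<Rightarrow> real"
  assumes f: "integrable M f" "\<And>x. 0 \<le> f x" and g: "integrable M g" "\<And>x. 0 \<le> g x"
    and h: "integrable M h" "\<And>x. 0 \<le> h x"
    and abc: "0 < a" "0 < b" "0 < c" "a + b + c = 1"
  shows "integrable M (\<lambda>x. f x powr a * g x powr b * h x powr c)" (is ?int)
    and "(\<integral>x. f x powr a * g x powr b * h x powr c \<partial>M)
      \<le> (\<integral>x. f x \<partial>M) powr a * (\<integral>x. g x \<partial>M) powr b * (\<integral>x. h x \<partial>M) powr c"
proof -
  note [measurable] = borel_measurable_integrable[OF f(1)] borel_measurable_integrable[OF g(1)]
    borel_measurable_integrable[OF h(1)]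
  show int: ?int
  proof (rule Bochner_Integration.integrable_bound)
    show "integrable M (\<lambda>x. a * f x + b * g x + c * h x)"
      using f g h by auto
    show "AE x in M. norm (f x powr a * g x powr b * h x powr c) \<le> norm (a * f x + b * g x + c * h x)"
    proof (rule AE_I2)
      fix x
      have "f x powr a * g x powr b * h x powr c \<le> a * f x + b * g x + c * h x"
        by (rule weighted_amgm3) (use assms in auto)
      then show "norm (f x powr a * g x powr b * h x powr c) \<le> norm (a * f x + b * g x + c * h x)"
        by (simp add: abs_mult)
    qed
  qed measurable
  define F G H where "F = (\<integral>x. f x \<partial>M)" and "G = (\<integral>x. g x \<partial>M)" and "H = (\<integral>x. h x \<partial>M)"
  have nn: "0 \<le> F" "0 \<le> G" "0 \<le> H"
    unfolding F_def G_def H_def using f g h by auto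
  have zero: "(\<integral>x. f x powr a * g x powr b * h x powr c \<partial>M) \<le> F powr a * G powr b * H powr c"
    if "F = 0 \<or> G = 0 \<or> H = 0"
  proof -
    have "AE x in M. f x powr a * g x powr b * h x powr c = 0"
      using that
    proof (elim disjE)
      assume "F = 0"
      then have "AE x in M. f x = 0"
        using integral_nonneg_eq_0_iff_AE[OF f(1)] f(2) F_def by auto
      then show ?thesis by eventually_elim simp
    next
      assume "G = 0"
      then have "AE x in M. g x = 0"
        using integral_nonneg_eq_0_iff_AE[OF g(1)] g(2) G_def by auto
      then show ?thesis by eventually_elim simp
    next
      assume "H = 0"
      then have "AE x in M. h x = 0"
        using integral_nonneg_eq_0_iff_AE[OF h(1)] h(2) H_def by auto
      then show ?thesis by eventually_elim simp
    qed
    then have "(\<integral>x. f x powr a * g x powr b * h x powr c \<partial>M) = 0"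
      by (rule integral_eq_zero_AE)
    then show ?thesis by simp
  qed
  show "(\<integral>x. f x powr a * g x powr b * h x powr c \<partial>M) \<le> (\<integral>x. f x \<partial>M) powr a * (\<integral>x. g x \<partial>M) powr b * (\<integral>x. h x \<partial>M) powr c"
    unfolding F_def[symmetric] G_def[symmetric] H_def[symmetric]
  proof (cases "F = 0 \<or> G = 0 \<or> H = 0")
    case False
    then have pos: "0 < F" "0 < G" "0 < H" using nn by auto
    define P where "P = F powr a * G powr b * H powr c"
    have P: "0 < P" unfolding P_def using pos by simp
    have "(\<integral>x. f x powr a * g x powr b * h x powr c \<partial>M)
        \<le> (\<integral>x. P * (a * (f x / F) + b * (g x / G) + c * (h x / H)) \<partial>M)"
    proof (rule integral_mono[OF int])
      show "integrable M (\<lambda>x. P * (a * (f x / F) + b * (g x / G) + c * (h x / H)))"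
        using f g h by auto
      fix x
      have "f x powr a * g x powr b * h x powr c
          = P * ((f x / F) powr a * (g x / G) powr b * (h x / H) powr c)"
        unfolding P_def using pos f(2)[of x] g(2)[of x] h(2)[of x] by (simp add: powr_divide)
      also have "\<dots> \<le> P * (a * (f x / F) + b * (g x / G) + c * (h x / H))"
        by (intro mult_left_mono weighted_amgm3) (use assms pos P in auto)
      finally show "f x powr a * g x powr b * h x powr c \<le> P * (a * (f x / F) + b * (g x / G) + c * (h x / H))" .
    qed
    also have "\<dots> = P * (a * (F / F) + b * (G / G) + c * (H / H))"
      unfolding F_def G_def H_def using f g h by simp
    also have "\<dots> = P" using pos abc by simp
    finally show "(\<integral>x. f x powr a * g x powr b * h x powr c \<partial>M) \<le> F powr a * G powr b * H powr c"
      unfolding P_def .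
  qed (rule zero)
qed

lemma holder2:
  fixes f g :: "'a \<Rightarrow> real"
  assumes f: "integrable M f" "\<And>x. 0 \<le> f x" and g: "integrable M g" "\<And>x. 0 \<le> g x"
    and ab: "0 < a" "0 < b" "a + b = 1"
  shows "integrable M (\<lambda>x. f x powr a * g x powr b)"
    and "(\<integral>x. f x powr a * g x powr b \<partial>M) \<le> (\<integral>x. f x \<partial>M) powr a * (\<integral>x. g x \<partial>M) powr b"
proof -
  \<comment> \<open>The case of two functions is the case of three with \<open>g\<close> used twice,
    each time with weight \<open>b / 2\<close>.\<close>
  have *: "y powr a * z powr (b / 2) * z powr (b / 2) = y powr a * z powr b" for y z :: real
    by (simp add: mult.assoc powr_add[symmetric])
  have s: "a + b / 2 + b / 2 = 1" using ab by simp
  from holder3[OF f g g, of a "b / 2" "b / 2"] ab s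
  show "integrable M (\<lambda>x. f x powr a * g x powr b)"
    and "(\<integral>x. f x powr a * g x powr b \<partial>M) \<le> (\<integral>x. f x \<partial>M) powr a * (\<integral>x. g x \<partial>M) powr b"
    by (simp_all only: * mult.assoc powr_add[symmetric]) simp_all
qed

text \<open>Hoelder against the constant one, whose factor is at most one because the total mass
  is.\<close>

lemma (in finite_measure) integral_powr_jensen:
  fixes f :: "'a \<Rightarrow> real"
  assumes f: "integrable M (\<lambda>x. f x powr p)" "\<And>x. 0 \<le> f x" and p: "1 < p"
    and mass: "measure M (space M) \<le> 1"
  shows "(\<integral>x. f x \<partial>M) powr p \<le> (\<integral>x. f x powr p \<partial>M)"
proof -
  have "(\<integral>x. f x \<partial>M) = (\<integral>x. (f x powr p) powr (1 / p) * 1 powr (1 - 1 / p) \<partial>M)"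
    using f p by (simp add: powr_powr)
  also have "\<dots> \<le> (\<integral>x. f x powr p \<partial>M) powr (1 / p) * (\<integral>x. 1 \<partial>M) powr (1 - 1 / p)"
    by (rule holder2) (use f p in auto)
  also have "\<dots> \<le> (\<integral>x. f x powr p \<partial>M) powr (1 / p)"
  proof -
    have "measure M (space M) powr (1 - 1 / p) \<le> 1"
      by (rule powr_le1) (use mass p in auto)
    then show ?thesis by (simp add: mult_left_le)
  qed
  finally have "(\<integral>x. f x \<partial>M) powr p \<le> ((\<integral>x. f x powr p \<partial>M) powr (1 / p)) powr p"
    by (intro powr_mono2) (use f p in auto)
  also have "\<dots> = (\<integral>x. f x powr p \<partial>M)"
    using f p by (simp add: powr_powr)
  finally show ?thesis .
qed

section \<open>Doubling measures on a ball\<close>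

lemma ball_subset_ballI: "dist x y + s \<le> t \<Longrightarrow> ball x s \<subseteq> ball y t"
  for x y :: "'a::metric_space"
proof
  fix z assume "dist x y + s \<le> t" "z \<in> ball x s"
  then show "z \<in> ball y t"
    using dist_triangle[of y z x] by (simp add: dist_commute)
qed

text \<open>Centres are kept in \<open>ball x0 (5 / 4 * R)\<close> and radii below \<open>3 / 4 * R\<close>, so that no ball leaves
  \<open>ball x0 (2 * R)\<close>, the only region where doubling is available.\<close>

locale doubling_ball = finite_measure N for N :: "'n::euclidean_space measure" +
  fixes x0 :: 'n and R \<gamma> :: real
  assumes sets_N: "sets N = sets lebesgue"
    and R_pos: "0 < R"
    and mass_one: "measure N (ball x0 (2 * R)) = 1"
    and mass_le: "measure N (space N) \<le> 1"
    and gamma_pos: "0 < \<gamma>"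
    and doubling: "\<And>x r. 0 < r \<Longrightarrow> ball x (2 * r) \<subseteq> ball x0 (2 * R) \<Longrightarrow>
      measure N (ball x (2 * r)) \<le> \<gamma> * measure N (ball x r)"
begin

declare sets_N [measurable_cong]

lemma space_N [simp]: "space N = UNIV"
  using sets_eq_imp_space_eq[OF sets_N] by simp

lemma borel_in_sets_N: "A \<in> sets borel \<Longrightarrow> A \<in> sets N"
  by (simp add: sets_N)

lemma ball_in_sets_N [measurable, simp]: "ball x r \<in> sets N"
  by (rule borel_in_sets_N) simp

lemma borel_measurable_N: "f \<in> borel_measurable borel \<Longrightarrow> f \<in> borel_measurable N"
  unfolding measurable_cong_sets[OF sets_N refl] by (intro measurable_completion) simp

lemma ident_N: "(\<lambda>x. x) \<in> measurable N borel"
  by (rule borel_measurable_N) simp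

lemma continuous_measurable_N:
  fixes f :: "'n \<Rightarrow> 'b::topological_space"
  shows "continuous_on UNIV f \<Longrightarrow> f \<in> borel_measurable N"
  by (intro borel_measurable_N borel_measurable_continuous_onI)

lemma gamma_ge_one: "1 \<le> \<gamma>"
proof -
  have "1 \<le> \<gamma> * measure N (ball x0 R)"
    using doubling[OF R_pos, of x0] mass_one by simp
  also have "\<dots> \<le> \<gamma> * 1"
    using gamma_pos finite_measure_mono[of "ball x0 R" "ball x0 (2 * R)"] mass_one R_pos
    by (intro mult_left_mono) (auto simp: subset_ball)
  finally show ?thesis by simp
qed

lemma doubling_pow:
  assumes "0 < r" "ball x (2 ^ n * r) \<subseteq> ball x0 (2 * R)"
  shows "measure N (ball x (2 ^ n * r)) \<le> \<gamma> ^ n * measure N (ball x r)"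
  using assms(2)
proof (induction n)
  case (Suc n)
  have "ball x (2 ^ n * r) \<subseteq> ball x (2 ^ Suc n * r)"
    using assms(1) by (intro subset_ball) auto
  with Suc have IH: "measure N (ball x (2 ^ n * r)) \<le> \<gamma> ^ n * measure N (ball x r)"
    by blast
  have "measure N (ball x (2 ^ Suc n * r)) \<le> \<gamma> * measure N (ball x (2 ^ n * r))"
    using doubling[of "2 ^ n * r" x] Suc.prems assms(1) by (simp add: mult.assoc)
  also have "\<dots> \<le> \<gamma> * (\<gamma> ^ n * measure N (ball x r))"
    using IH gamma_pos by (intro mult_left_mono) auto
  finally show ?case by (simp add: mult.assoc)
qed simp

text \<open>The chain of balls runs from \<open>x0\<close> to \<open>x\<close> through the midpoint, since a ball about \<open>x\<close>
  containing \<open>x0\<close> with room for doubling need not stay inside \<open>ball x0 (2 * R)\<close>.\<close>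

lemma mass_ball_three_quarters:
  assumes "dist x x0 < 5 / 4 * R"
  shows "1 \<le> \<gamma> ^ 6 * measure N (ball x (3 / 4 * R))"
proof -
  define z where "z = midpoint x x0"
  have dz: "dist z x0 < 5 / 8 * R" "dist z x < 5 / 8 * R"
    using assms unfolding z_def by (simp_all add: dist_midpoint dist_commute)
  note g = gamma_pos
  \<comment> \<open>Three doublings lead from \<open>R / 4\<close> to \<open>2 * R\<close> at
    \<open>x0\<close>, three more from \<open>7 / 64 * R\<close> to \<open>7 / 8 * R\<close> at the
    midpoint. The inclusions hold since \<open>5 / 8 + 1 / 4 = 7 / 8\<close> and
    \<open>5 / 8 + 7 / 64 < 3 / 4\<close>.\<close>
  have "1 \<le> \<gamma> ^ 3 * measure N (ball x0 (R / 4))"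
    using doubling_pow[of "R / 4" x0 3] R_pos mass_one by simp
  also have "\<dots> \<le> \<gamma> ^ 3 * measure N (ball z (7 / 8 * R))"
    using dz g by (intro mult_left_mono finite_measure_mono ball_subset_ballI) (auto simp: dist_commute)
  also have "\<dots> \<le> \<gamma> ^ 3 * (\<gamma> ^ 3 * measure N (ball z (7 / 64 * R)))"
  proof (intro mult_left_mono)
    have "ball z (7 / 8 * R) \<subseteq> ball x0 (2 * R)"
      using dz R_pos by (intro ball_subset_ballI) auto
    then show "measure N (ball z (7 / 8 * R)) \<le> \<gamma> ^ 3 * measure N (ball z (7 / 64 * R))"
      using doubling_pow[of "7 / 64 * R" z 3] R_pos by simp
  qed (use g in auto)
  also have "\<dots> \<le> \<gamma> ^ 3 * (\<gamma> ^ 3 * measure N (ball x (3 / 4 * R)))"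
    using dz g R_pos by (intro mult_left_mono finite_measure_mono ball_subset_ballI) auto
  finally show ?thesis by (simp add: mult.assoc[symmetric] power_add[symmetric])
qed

text \<open>Here the dimension \<open>log 2 \<gamma>\<close> enters: about
  \<open>log 2 (R / s)\<close> doublings lead from \<open>s\<close> to \<open>3 / 4 * R\<close>, and
  \<open>\<gamma> powr (log 2 t) = t powr (log 2 \<gamma>)\<close>. Six factors
  \<open>\<gamma>\<close> come from the comparison with \<open>x0\<close>, the seventh from rounding
  the number of doublings up.\<close>

lemma mass_ball_lower:
  assumes x: "dist x x0 < 5 / 4 * R" and s: "0 < s" "s \<le> 3 / 4 * R"
  shows "1 \<le> \<gamma> ^ 7 * (R / s) powr (log 2 \<gamma>) * measure N (ball x s)"
proof -
  define n where "n = nat \<lceil>log 2 (3 / 4 * R / s)\<rceil>"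
  have q: "1 \<le> 3 / 4 * R / s" using s by simp
  then have l0: "0 \<le> log 2 (3 / 4 * R / s)" by simp
  have n1: "log 2 (3 / 4 * R / s) \<le> real n" and n2: "real n \<le> log 2 (3 / 4 * R / s) + 1"
    unfolding n_def using l0 by linarith+
  have "3 / 4 * R / s = 2 powr (log 2 (3 / 4 * R / s))" using q by simp
  also have "\<dots> \<le> 2 powr (real n)" using n1 by simp
  finally have 1: "3 / 4 * R / s \<le> 2 ^ n" by (simp add: powr_realpow)
  \<comment> \<open>Passing from \<open>s\<close> to the smaller \<open>s'\<close> makes
    \<open>n\<close> doublings land exactly on \<open>3 / 4 * R\<close>.\<close>
  define s' where "s' = 3 / 4 * R / 2 ^ n"
  have s': "0 < s'" "s' \<le> s" "2 ^ n * s' = 3 / 4 * R"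
    unfolding s'_def using R_pos s 1 by (auto simp: field_simps)
  have sub: "ball x (2 ^ n * s') \<subseteq> ball x0 (2 * R)"
    unfolding s' using x by (intro ball_subset_ballI) auto
  have "1 \<le> \<gamma> ^ 6 * measure N (ball x (3 / 4 * R))"
    by (rule mass_ball_three_quarters[OF x])
  also have "\<dots> \<le> \<gamma> ^ 6 * (\<gamma> ^ n * measure N (ball x s'))"
    using doubling_pow[OF s'(1) sub] gamma_pos unfolding s'(3) by (intro mult_left_mono) auto
  also have "\<dots> \<le> \<gamma> ^ 6 * (\<gamma> ^ n * measure N (ball x s))"
    using s' gamma_pos by (intro mult_left_mono finite_measure_mono subset_ball) auto
  also have "\<dots> \<le> \<gamma> ^ 6 * ((\<gamma> * (R / s) powr (log 2 \<gamma>)) * measure N (ball x s))"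
  proof (intro mult_left_mono mult_right_mono)
    have "\<gamma> ^ n = \<gamma> powr (real n)" using gamma_pos by (simp add: powr_realpow)
    also have "\<dots> \<le> \<gamma> powr (log 2 (3 / 4 * R / s) + 1)"
      using n2 gamma_ge_one by (intro powr_mono) auto
    also have "\<dots> = \<gamma> * \<gamma> powr (log 2 (3 / 4 * R / s))"
      using gamma_pos by (simp add: powr_add)
    also have "\<gamma> powr (log 2 (3 / 4 * R / s)) = (3 / 4 * R / s) powr (log 2 \<gamma>)"
      using gamma_pos q s R_pos by (simp add: powr_def log_def)
    also have "\<gamma> * \<dots> \<le> \<gamma> * (R / s) powr (log 2 \<gamma>)"
      using gamma_pos gamma_ge_one R_pos s
      by (intro mult_left_mono powr_mono2) (auto simp: field_simps)
    finally show "\<gamma> ^ n \<le> \<gamma> * (R / s) powr (log 2 \<gamma>)" .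
  qed (use gamma_pos in auto)
  also have "\<dots> = \<gamma> ^ 7 * (R / s) powr (log 2 \<gamma>) * measure N (ball x s)"
    using power_add[of \<gamma> 6 1] by (simp add: mult_ac)
  finally show ?thesis .
qed

lemma mass_ball_pos:
  assumes "dist x x0 < 5 / 4 * R" and "0 < s" "s \<le> 3 / 4 * R"
  shows "0 < measure N (ball x s)"
proof (rule ccontr)
  assume "\<not> 0 < measure N (ball x s)"
  then have "measure N (ball x s) = 0"
    using measure_nonneg[of N "ball x s"] by linarith
  then show False using mass_ball_lower[OF assms] by simp
qed

section \<open>Averaging operators at a fixed scale\<close>

definition ball_avg :: "real \<Rightarrow> ('n \<Rightarrow> real) \<Rightarrow> 'n \<Rightarrow> real" where
  "ball_avg s g x = (LINT y:ball x s|N. g y) / measure N (ball x s)"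

lemma ball_avg_nonneg: "(\<And>y. 0 \<le> g y) \<Longrightarrow> 0 \<le> ball_avg s g x"
  unfolding ball_avg_def set_lebesgue_integral_def by (intro divide_nonneg_nonneg integral_nonneg_AE) auto

text \<open>Joint measurability in both points, which makes averages measurable in the centre and
  permits Tonelli.\<close>

lemma dist_pair_sets [measurable]: "{z \<in> space (N \<Otimes>\<^sub>M N). dist (fst z) (snd z) < s} \<in> sets (N \<Otimes>\<^sub>M N)"
  by (intro borel_measurable_less borel_measurable_dist measurable_const
    measurable_compose[OF measurable_fst ident_N] measurable_compose[OF measurable_snd ident_N]) simp

lemma emeasure_ball_measurable [measurable]: "(\<lambda>x. emeasure N (ball x s)) \<in> borel_measurable N"
proof -
  have "(\<lambda>x. emeasure N (Pair x -` {z \<in> space (N \<Otimes>\<^sub>M N). dist (fst z) (snd z) < s})) \<in> borel_measurable N"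
    by (rule measurable_emeasure_Pair) measurable
  moreover have "Pair x -` {z \<in> space (N \<Otimes>\<^sub>M N). dist (fst z) (snd z) < s} = ball x s" for x
    by (auto simp: space_pair_measure)
  ultimately show ?thesis by (simp only:)
qed

lemma ball_avg_measurable [measurable]:
  assumes [measurable]: "g \<in> borel_measurable N"
  shows "ball_avg s g \<in> borel_measurable N"
proof -
  have [measurable]: "(\<lambda>z. indicator (ball (fst z) s) (snd z) :: real) \<in> borel_measurable (N \<Otimes>\<^sub>M N)"
  proof -
    have "(\<lambda>z. indicator (ball (fst z) s) (snd z) :: real) =
        indicator {z \<in> space (N \<Otimes>\<^sub>M N). dist (fst z) (snd z) < s}"
      by (auto simp: indicator_def space_pair_measure fun_eq_iff)
    then show ?thesis by simp
  qed
  have "(\<lambda>x. \<integral>y. indicator (ball x s) y *\<^sub>R g y \<partial>N) \<in> borel_measurable N"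
  proof (rule borel_measurable_lebesgue_integral)
    have "(\<lambda>z. indicator (ball (fst z) s) (snd z) *\<^sub>R g (snd z)) \<in> borel_measurable (N \<Otimes>\<^sub>M N)"
      by measurable
    then show "(\<lambda>(x, y). indicator (ball x s) y *\<^sub>R g y) \<in> borel_measurable (N \<Otimes>\<^sub>M N)"
      by (simp add: case_prod_beta')
  qed
  moreover have "(\<lambda>x. measure N (ball x s)) \<in> borel_measurable N"
    unfolding measure_def by measurable
  ultimately show ?thesis
    unfolding ball_avg_def[abs_def] set_lebesgue_integral_def by measurable
qed

text \<open>By Tonelli it is enough to integrate \<open>1 / measure N (ball x s)\<close> over the
  centres \<open>x\<close> within \<open>s\<close> of a fixed \<open>y\<close>. As
  \<open>ball y s\<close> lies in \<open>ball x (2 * s)\<close>, doubling replaces the denominator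
  by \<open>measure N (ball y s)\<close> at the cost of \<open>\<gamma>\<close>, and the integral is
  at most \<open>\<gamma>\<close>. The limit \<open>3 / 8 * R\<close> keeps
  \<open>ball x (2 * s)\<close> inside \<open>ball x0 (2 * R)\<close>.\<close>

lemma nn_integral_ball_avg:
  assumes g: "integrable N g" "\<And>y. 0 \<le> g y" and s: "0 < s" "s \<le> 3 / 8 * R"
  shows "(\<integral>\<^sup>+x. indicator (ball x0 (5 / 4 * R)) x * ennreal (ball_avg s g x) \<partial>N) \<le> ennreal (\<gamma> * (\<integral>y. g y \<partial>N))"
proof -
  interpret NN: pair_sigma_finite N N ..
  note [measurable] = borel_measurable_integrable[OF g(1)]
  define B where "B = ball x0 (5 / 4 * R)"
  have [measurable]: "B \<in> sets N" by (simp add: B_def)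
  let ?f = "\<lambda>x y. indicator B x * (indicator (ball x s) y * ennreal (g y) * inverse (emeasure N (ball x s)))"
  have avg: "indicator B x * ennreal (ball_avg s g x) = (\<integral>\<^sup>+y. ?f x y \<partial>N)" for x
  proof (cases "x \<in> B")
    case True
    then have pos: "0 < measure N (ball x s)"
      using s R_pos by (intro mass_ball_pos) (auto simp: B_def dist_commute)
    have inv: "inverse (emeasure N (ball x s)) = ennreal (1 / measure N (ball x s))"
      using pos by (simp add: emeasure_eq_measure inverse_ennreal inverse_eq_divide)
    have i: "integrable N (\<lambda>y. indicator (ball x s) y *\<^sub>R g y)"
      using g(1) by (intro integrable_mult_indicator) auto
    have "(\<integral>\<^sup>+y. ?f x y \<partial>N) = (\<integral>\<^sup>+y. ennreal (indicator (ball x s) y *\<^sub>R g y) * inverse (emeasure N (ball x s)) \<partial>N)"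
      using True by (intro nn_integral_cong) (auto simp: indicator_def)
    also have "\<dots> = (\<integral>\<^sup>+y. ennreal (indicator (ball x s) y *\<^sub>R g y) \<partial>N) * inverse (emeasure N (ball x s))"
      by (rule nn_integral_multc) measurable
    also have "(\<integral>\<^sup>+y. ennreal (indicator (ball x s) y *\<^sub>R g y) \<partial>N) = ennreal (LINT y:ball x s|N. g y)"
      unfolding set_lebesgue_integral_def using g(2)
      by (intro nn_integral_eq_integral[OF i]) auto
    also have "ennreal (LINT y:ball x s|N. g y) * inverse (emeasure N (ball x s)) = ennreal (ball_avg s g x)"
      unfolding inv ball_avg_def using g(2)
      by (subst ennreal_mult'[symmetric]) (auto simp: set_lebesgue_integral_def intro!: integral_nonneg_AE)
    finally have fin: "(\<integral>\<^sup>+y. ?f x y \<partial>N) = ennreal (ball_avg s g x)" .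
    show ?thesis by (simp only: fin) (simp add: True)
  qed simp
  have "(\<integral>\<^sup>+x. indicator B x * ennreal (ball_avg s g x) \<partial>N) = (\<integral>\<^sup>+x. \<integral>\<^sup>+y. ?f x y \<partial>N \<partial>N)"
    by (simp only: avg)
  also have "\<dots> = (\<integral>\<^sup>+y. \<integral>\<^sup>+x. ?f x y \<partial>N \<partial>N)"
  proof (rule NN.Fubini'[symmetric])
    have "(\<lambda>z. indicator (ball (fst z) s) (snd z) :: ennreal) =
        indicator {z \<in> space (N \<Otimes>\<^sub>M N). dist (fst z) (snd z) < s}"
      by (auto simp: indicator_def space_pair_measure fun_eq_iff)
    then have [measurable]: "(\<lambda>z. indicator (ball (fst z) s) (snd z) :: ennreal) \<in> borel_measurable (N \<Otimes>\<^sub>M N)"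
      by simp
    have "(\<lambda>z. ?f (fst z) (snd z)) \<in> borel_measurable (N \<Otimes>\<^sub>M N)"
      by measurable
    then show "(\<lambda>(x, y). ?f x y) \<in> borel_measurable (N \<Otimes>\<^sub>M N)"
      by (simp add: case_prod_beta')
  qed
  also have "\<dots> \<le> (\<integral>\<^sup>+y. ennreal \<gamma> * ennreal (g y) \<partial>N)"
  proof (rule nn_integral_mono)
    fix y
    have "(\<integral>\<^sup>+x. ?f x y \<partial>N) \<le> (\<integral>\<^sup>+x. ennreal \<gamma> * ennreal (g y) * inverse (emeasure N (ball y s)) * indicator (ball y s) x \<partial>N)"
    proof (rule nn_integral_mono)
      fix x
      show "?f x y \<le> ennreal \<gamma> * ennreal (g y) * inverse (emeasure N (ball y s)) * indicator (ball y s) x"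
      proof (cases "x \<in> B \<and> y \<in> ball x s")
        case True
        have x: "dist x x0 < 5 / 4 * R" using True by (auto simp: B_def dist_commute)
        have pos: "0 < measure N (ball x s)"
          using s R_pos x by (intro mass_ball_pos) auto
        have "measure N (ball y s) \<le> measure N (ball x (2 * s))"
          using True by (intro finite_measure_mono ball_subset_ballI) (auto simp: dist_commute)
        also have "\<dots> \<le> \<gamma> * measure N (ball x s)"
          using s x by (intro doubling ball_subset_ballI) auto
        finally have le: "measure N (ball y s) \<le> \<gamma> * measure N (ball x s)" .
        \<comment> \<open>The point \<open>y\<close> may leave the region where balls are known to
          have positive mass. For mass zero the inverse in \<open>ennreal\<close> is infinite and
          the bound is trivial.\<close>
        have "inverse (emeasure N (ball x s)) \<le> ennreal \<gamma> * inverse (emeasure N (ball y s))"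
        proof (cases "measure N (ball y s) = 0")
          case True
          then show ?thesis using gamma_pos by (simp add: emeasure_eq_measure ennreal_mult_top)
        next
          case False
          then have p2: "0 < measure N (ball y s)" using measure_nonneg[of N "ball y s"] by linarith
          have "1 / measure N (ball x s) \<le> \<gamma> * (1 / measure N (ball y s))"
            using le pos p2 by (simp add: field_simps)
          then show ?thesis
            using pos p2 gamma_pos
            by (simp add: emeasure_eq_measure inverse_ennreal inverse_eq_divide ennreal_mult[symmetric] ennreal_leI)
        qed
        then have "ennreal (g y) * inverse (emeasure N (ball x s)) \<le> ennreal (g y) * (ennreal \<gamma> * inverse (emeasure N (ball y s)))"
          by (rule mult_left_mono) simp
        then show ?thesis using True by (simp add: mult_ac dist_commute)
      qed auto
    qed
    also have "\<dots> = ennreal \<gamma> * ennreal (g y) * inverse (emeasure N (ball y s)) * emeasure N (ball y s)"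
      by (rule nn_integral_cmult_indicator) simp
    also have "\<dots> = ennreal \<gamma> * ennreal (g y) * (inverse (emeasure N (ball y s)) * emeasure N (ball y s))"
      by (simp add: mult.assoc)
    also have "\<dots> \<le> ennreal \<gamma> * ennreal (g y) * 1"
    proof (rule mult_left_mono)
      show "inverse (emeasure N (ball y s)) * emeasure N (ball y s) \<le> 1"
      proof (cases "measure N (ball y s) = 0")
        case False
        then have "0 < measure N (ball y s)" using measure_nonneg[of N "ball y s"] by linarith
        then show ?thesis
          by (simp add: emeasure_eq_measure inverse_ennreal ennreal_mult[symmetric])
      qed (simp add: emeasure_eq_measure)
    qed simp
    finally show "(\<integral>\<^sup>+x. ?f x y \<partial>N) \<le> ennreal \<gamma> * ennreal (g y)" by simp
  qed
  also have "\<dots> = ennreal \<gamma> * ennreal (\<integral>y. g y \<partial>N)"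
    using g by (simp add: nn_integral_cmult nn_integral_eq_integral)
  also have "\<dots> = ennreal (\<gamma> * (\<integral>y. g y \<partial>N))"
    using gamma_pos by (simp add: ennreal_mult')
  finally show ?thesis unfolding B_def .
qed

text \<open>Interpolation between two endpoints: the lower mass bound gives
  \<open>ball_avg s g x \<le> Q * G\<close> pointwise, which is applied to
  \<open>\<kappa> - 1\<close> of the \<open>\<kappa>\<close> powers, and the remaining first power
  is integrated by the \<open>L^1\<close> bound.\<close>

lemma nn_integral_ball_avg_powr:
  assumes g: "integrable N g" "\<And>y. 0 \<le> g y" and s: "0 < s" "s \<le> 3 / 8 * R" and \<kappa>: "1 < \<kappa>"
  shows "(\<integral>\<^sup>+x. indicator (ball x0 (5 / 4 * R)) x * ennreal (ball_avg s g x powr \<kappa>) \<partial>N)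
    \<le> ennreal (\<gamma> * (\<gamma> ^ 7 * (R / s) powr (log 2 \<gamma>)) powr (\<kappa> - 1) * (\<integral>y. g y \<partial>N) powr \<kappa>)"
proof -
  define G where "G = (\<integral>y. g y \<partial>N)"
  define Q where "Q = \<gamma> ^ 7 * (R / s) powr (log 2 \<gamma>)"
  have G: "0 \<le> G" unfolding G_def using g by auto
  have Q: "0 < Q" unfolding Q_def using gamma_pos R_pos s by auto
  note [measurable] = borel_measurable_integrable[OF g(1)]
  have "(\<integral>\<^sup>+x. indicator (ball x0 (5 / 4 * R)) x * ennreal (ball_avg s g x powr \<kappa>) \<partial>N)
    \<le> (\<integral>\<^sup>+x. ennreal ((Q * G) powr (\<kappa> - 1)) * (indicator (ball x0 (5 / 4 * R)) x * ennreal (ball_avg s g x)) \<partial>N)"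
  proof (rule nn_integral_mono)
    fix x
    show "indicator (ball x0 (5 / 4 * R)) x * ennreal (ball_avg s g x powr \<kappa>) \<le>
      ennreal ((Q * G) powr (\<kappa> - 1)) * (indicator (ball x0 (5 / 4 * R)) x * ennreal (ball_avg s g x))"
    proof (cases "x \<in> ball x0 (5 / 4 * R)")
      case True
      then have x: "dist x x0 < 5 / 4 * R" by (simp add: dist_commute)
      have pos: "0 < measure N (ball x s)"
        using s R_pos x by (intro mass_ball_pos) auto
      have "1 \<le> Q * measure N (ball x s)"
        unfolding Q_def using s R_pos by (intro mass_ball_lower[OF x]) auto
      then have 1: "1 / measure N (ball x s) \<le> Q"
        using pos by (simp add: field_simps)
      have "(LINT y:ball x s|N. g y) \<le> G"
        unfolding set_lebesgue_integral_def G_def using g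
        by (intro integral_mono integrable_mult_indicator) (auto simp: indicator_def)
      then have "ball_avg s g x \<le> G * (1 / measure N (ball x s))"
        unfolding ball_avg_def using pos by (simp add: divide_right_mono)
      also have "\<dots> \<le> G * Q" using 1 G by (rule mult_left_mono)
      finally have 2: "ball_avg s g x \<le> Q * G" by (simp add: mult.commute)
      have 0: "0 \<le> ball_avg s g x" using g by (intro ball_avg_nonneg) auto
      have "ball_avg s g x powr \<kappa> = ball_avg s g x powr (\<kappa> - 1) * ball_avg s g x"
        using powr_mult_base[OF 0, of "\<kappa> - 1"] by (simp add: mult.commute)
      also have "\<dots> \<le> (Q * G) powr (\<kappa> - 1) * ball_avg s g x"
        using 0 2 \<kappa> by (intro mult_right_mono powr_mono2) auto
      finally show ?thesis
        using True 0 by (simp add: ennreal_mult[symmetric] ennreal_leI)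
    qed simp
  qed
  also have "\<dots> = ennreal ((Q * G) powr (\<kappa> - 1)) * (\<integral>\<^sup>+x. indicator (ball x0 (5 / 4 * R)) x * ennreal (ball_avg s g x) \<partial>N)"
    by (rule nn_integral_cmult) measurable
  also have "\<dots> \<le> ennreal ((Q * G) powr (\<kappa> - 1)) * ennreal (\<gamma> * G)"
    unfolding G_def by (intro mult_left_mono nn_integral_ball_avg g s) auto
  also have "\<dots> = ennreal (\<gamma> * Q powr (\<kappa> - 1) * G powr \<kappa>)"
  proof -
    have "(Q * G) powr (\<kappa> - 1) * (\<gamma> * G) = \<gamma> * Q powr (\<kappa> - 1) * (G powr (\<kappa> - 1) * G)"
      using Q G by (simp add: powr_mult)
    also have "G powr (\<kappa> - 1) * G = G powr \<kappa>"
      using powr_mult_base[OF G, of "\<kappa> - 1"] by (simp add: mult.commute)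
    finally show ?thesis using G gamma_pos by (simp add: ennreal_mult'[symmetric])
  qed
  finally show ?thesis unfolding Q_def G_def .
qed

end

section \<open>A subcritical Sobolev inequality\<close>

lemma powr_add_le:
  fixes a b q :: real
  assumes "0 \<le> a" "0 \<le> b" "0 \<le> q"
  shows "(a + b) powr q \<le> 2 powr q * (a powr q + b powr q)"
proof -
  have "(a + b) powr q \<le> (2 * max a b) powr q"
    using assms by (intro powr_mono2) auto
  also have "\<dots> = 2 powr q * max a b powr q"
    using assms by (simp add: powr_mult)
  also have "\<dots> \<le> 2 powr q * (a powr q + b powr q)"
    by (intro mult_left_mono) (auto simp: max_def)
  finally show ?thesis .
qed

text \<open>Half of the relative distance of \<open>\<kappa>\<close> to the critical gain; the telescoping series is summed against
  the weights \<open>2\<^sup>-\<^sup>\<sigma>\<^sup>i\<close>.\<close>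

definition sob_sigma :: "real \<Rightarrow> real \<Rightarrow> real \<Rightarrow> real" where
  "sob_sigma \<gamma> p \<kappa> = (p * \<kappa> - log 2 \<gamma> * (\<kappa> - 1)) / (2 * (p * \<kappa>))"

text \<open>The first summand comes from the average at the initial scale; in the second, the
  geometric sum of the increments multiplies the integral of a weighted series of averages. In the
  proof of \<open>sobolev\<close> these are \<open>c4\<close>, \<open>c3\<close> and
  \<open>c1\<close>.\<close>

definition sob_const :: "real \<Rightarrow> real \<Rightarrow> real \<Rightarrow> real \<Rightarrow> real \<Rightarrow> real" where
  "sob_const \<gamma> p C1 \<rho> \<kappa> = 2 powr (p * \<kappa>) *
     ((\<gamma> ^ 7 * (4 * \<rho>) powr (log 2 \<gamma>)) powr (p * \<kappa>)
      + (\<gamma> * C1 / (4 * \<rho>) / (1 - 2 powr (- sob_sigma \<gamma> p \<kappa>))) powr (p * \<kappa>)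
        * (\<gamma> * (\<gamma> ^ 7 * 4 powr (log 2 \<gamma>)) powr (\<kappa> - 1) / (1 - 2 powr (- (sob_sigma \<gamma> p \<kappa> * (p * \<kappa>))))))"

context doubling_ball
begin

lemma ball_avg_diff_le:
  assumes f: "integrable N f" and pos: "0 < measure N (ball x s)"
  shows "\<bar>ball_avg s f x - c\<bar> \<le> ball_avg s (\<lambda>y. \<bar>f y - c\<bar>) x"
proof -
  have i: "integrable N (\<lambda>y. indicator (ball x s) y *\<^sub>R f y)"
    using f by (intro integrable_mult_indicator) auto
  have i2: "integrable N (\<lambda>y. indicator (ball x s) y *\<^sub>R c)"
    by (intro integrable_mult_indicator) auto
  have "(LINT y:ball x s|N. f y) - c * measure N (ball x s) = (\<integral>y. indicator (ball x s) y *\<^sub>R (f y - c) \<partial>N)"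
    unfolding set_lebesgue_integral_def using i i2
    by (simp add: right_diff_distrib Bochner_Integration.integral_diff)
  then have "ball_avg s f x - c = (\<integral>y. indicator (ball x s) y *\<^sub>R (f y - c) \<partial>N) / measure N (ball x s)"
    unfolding ball_avg_def using pos by (simp add: field_simps)
  also have "\<bar>\<dots>\<bar> \<le> (\<integral>y. \<bar>indicator (ball x s) y *\<^sub>R (f y - c)\<bar> \<partial>N) / measure N (ball x s)"
    using pos by (auto simp: abs_divide intro!: divide_right_mono integral_abs_bound)
  also have "\<dots> = ball_avg s (\<lambda>y. \<bar>f y - c\<bar>) x"
    unfolding ball_avg_def set_lebesgue_integral_def by (simp add: abs_mult)
  finally show ?thesis .
qed

lemma ball_avg_half_le:
  assumes f: "integrable N f" "\<And>y. 0 \<le> f y"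
    and x: "dist x x0 < 5 / 4 * R" and s: "0 < s" "s \<le> 3 / 4 * R"
  shows "ball_avg (s / 2) f x \<le> \<gamma> * ball_avg s f x"
proof -
  have pos: "0 < measure N (ball x s)" "0 < measure N (ball x (s / 2))"
    using x s by (auto intro!: mass_ball_pos)
  have "measure N (ball x s) \<le> \<gamma> * measure N (ball x (s / 2))"
    using doubling[of "s / 2" x] x s ball_subset_ballI[of x x0 s "2 * R"] by auto
  then have 1: "1 / measure N (ball x (s / 2)) \<le> \<gamma> * (1 / measure N (ball x s))"
    using pos by (simp add: field_simps)
  have 2: "(LINT y:ball x (s / 2)|N. f y) \<le> (LINT y:ball x s|N. f y)"
    unfolding set_lebesgue_integral_def using f s
    by (intro integral_mono integrable_mult_indicator) (auto simp: indicator_def)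
  have 0: "0 \<le> (LINT y:ball x s|N. f y)"
    unfolding set_lebesgue_integral_def using f by (intro integral_nonneg_AE) auto
  have "ball_avg (s / 2) f x \<le> (LINT y:ball x s|N. f y) * (1 / measure N (ball x (s / 2)))"
    unfolding ball_avg_def using 2 pos by (simp add: divide_right_mono)
  also have "\<dots> \<le> (LINT y:ball x s|N. f y) * (\<gamma> * (1 / measure N (ball x s)))"
    using 0 1 by (intro mult_left_mono) auto
  finally show ?thesis unfolding ball_avg_def by (simp add: mult.commute)
qed

lemma ball_avg_tendsto:
  assumes f: "integrable N f" "isCont f x"
    and x: "dist x x0 < 5 / 4 * R"
    and r: "r \<longlonglongrightarrow> 0" "\<And>i. 0 < r i" "\<And>i. r i \<le> 3 / 4 * R"
  shows "(\<lambda>i. ball_avg (r i) f x) \<longlonglongrightarrow> f x"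
proof (rule LIMSEQ_I)
  fix e :: real assume e: "0 < e"
  from f(2) e obtain d where d: "0 < d" "\<And>y. dist y x < d \<Longrightarrow> \<bar>f y - f x\<bar> < e / 2"
    unfolding continuous_at_eps_delta by (metis dist_real_def half_gt_zero)
  from order_tendstoD(2)[OF r(1) d(1)] obtain n where n: "\<And>i. i \<ge> n \<Longrightarrow> r i < d"
    by (auto simp: eventually_sequentially)
  have "\<bar>ball_avg (r i) f x - f x\<bar> < e" if i: "i \<ge> n" for i
  proof -
    have pos: "0 < measure N (ball x (r i))"
      using x r by (intro mass_ball_pos) auto
    have "\<bar>ball_avg (r i) f x - f x\<bar> \<le> ball_avg (r i) (\<lambda>y. \<bar>f y - f x\<bar>) x"
      by (rule ball_avg_diff_le[OF f(1) pos])
    also have "\<dots> \<le> (LINT y:ball x (r i)|N. e / 2) / measure N (ball x (r i))"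
      unfolding ball_avg_def set_lebesgue_integral_def
    proof (intro divide_right_mono integral_mono)
      show "integrable N (\<lambda>y. indicator (ball x (r i)) y *\<^sub>R \<bar>f y - f x\<bar>)"
        using f(1) by (intro integrable_mult_indicator) auto
      show "integrable N (\<lambda>y. indicator (ball x (r i)) y *\<^sub>R (e / 2))"
        by (intro integrable_mult_indicator) auto
      fix y
      have "\<bar>f y - f x\<bar> \<le> e / 2" if "y \<in> ball x (r i)"
      proof -
        have "dist y x < d" using that n[OF i] by (simp add: dist_commute)
        then show ?thesis using d(2) by (simp add: less_imp_le)
      qed
      then show "indicator (ball x (r i)) y *\<^sub>R \<bar>f y - f x\<bar> \<le> indicator (ball x (r i)) y *\<^sub>R (e / 2)"
        by (auto simp: indicator_def)
    qed simp
    also have "\<dots> = e / 2"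
      using pos by (simp add: set_lebesgue_integral_def)
    also have "\<dots> < e" using e by simp
    finally show ?thesis .
  qed
  then show "\<exists>n0. \<forall>i\<ge>n0. norm (ball_avg (r i) f x - f x) < e"
    by auto
qed

text \<open>Here \<open>g\<close> stands for the \<open>p\<close>-th power of the norm of the
  gradient. In place of a supremum over scales, the averages \<open>m i x\<close> of
  \<open>g\<close> are collected in a weighted series \<open>T x\<close>. Each term is at most
  \<open>T x\<close>, which bounds all increments at once and gives a pointwise bound by
  \<open>T x powr (1 / q)\<close>; and \<open>T\<close> is integrable because its terms are
  integrated one by one.\<close>

theorem sobolev:
  assumes p: "1 < p" and \<kappa>: "1 < \<kappa>" "log 2 \<gamma> * (\<kappa> - 1) < p * \<kappa>"
    and C1: "0 < C1" and \<rho>: "1 \<le> \<rho>"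
    and \<psi>: "continuous_on UNIV \<psi>" "\<And>x. \<bar>\<psi> x\<bar> \<le> M" "\<And>x. x \<notin> ball x0 (5 / 4 * R) \<Longrightarrow> \<psi> x = 0"
    and g: "integrable N g" "\<And>x. 0 \<le> g x"
    and poincare: "\<And>x r. 0 < r \<Longrightarrow> ball x (\<rho> * r) \<subseteq> ball x0 (2 * R) \<Longrightarrow>
      ball_avg r (\<lambda>y. \<bar>\<psi> y - ball_avg r \<psi> x\<bar>) x \<le> C1 * r * ball_avg (\<rho> * r) g x powr (1 / p)"
  shows "(\<integral>\<^sup>+x. ennreal (\<bar>\<psi> x\<bar> powr (p * \<kappa>)) \<partial>N)
    \<le> ennreal (sob_const \<gamma> p C1 \<rho> \<kappa> * (R powr p * (\<integral>x. g x \<partial>N) + (\<integral>x. \<bar>\<psi> x\<bar> powr p \<partial>N)) powr \<kappa>)"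
proof -
  define q where "q = p * \<kappa>"
  define D where "D = log 2 \<gamma>"
  define \<sigma> where "\<sigma> = sob_sigma \<gamma> p \<kappa>"
  have q: "1 < q" unfolding q_def using p \<kappa> by (simp add: less_1_mult)
  have D0: "0 \<le> D" unfolding D_def using gamma_ge_one by simp
  have \<sigma>: "0 < \<sigma>" unfolding \<sigma>_def sob_sigma_def using p \<kappa> by simp
  have \<sigma>q: "2 * (\<sigma> * q) = q - D * (\<kappa> - 1)"
    unfolding \<sigma>_def sob_sigma_def D_def q_def using p \<kappa> by simp
  define G P where "G = (\<integral>x. g x \<partial>N)" and "P = (\<integral>x. \<bar>\<psi> x\<bar> powr p \<partial>N)"
  have G: "0 \<le> G" and P: "0 \<le> P" unfolding G_def P_def using g by auto
  have m\<psi> [measurable]: "\<psi> \<in> borel_measurable N"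
    by (rule continuous_measurable_N[OF \<psi>(1)])
  note [measurable] = borel_measurable_integrable[OF g(1)]
  have M: "0 \<le> M" using \<psi>(2)[of x0] by linarith
  have i\<psi>: "integrable N \<psi>"
    by (rule integrable_const_bound[where B = M]) (use \<psi>(2) in auto)
  have i\<psi>p: "integrable N (\<lambda>x. \<bar>\<psi> x\<bar> powr p)"
    by (rule integrable_const_bound[where B = "M powr p"]) (use \<psi>(2) p in \<open>auto intro!: powr_mono2\<close>)
  \<comment> \<open>The Poincare inequality enlarges balls by \<open>\<rho>\<close>; after the
    enlargement the radius is \<open>R / (4 * 2 ^ i)\<close>, within reach of all bounds on
    averages.\<close>
  define r where "r i = R / (4 * \<rho> * 2 ^ i)" for i :: nat
  define m where "m i x = ball_avg (R / (4 * 2 ^ i)) g x" for i :: nat and x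
  have r_pos: "0 < r i" for i unfolding r_def using R_pos \<rho> by simp
  have \<rho>r: "\<rho> * r i = R / (4 * 2 ^ i)" for i unfolding r_def using \<rho> by simp
  have s_le: "R / (4 * 2 ^ i) \<le> R / 4" for i :: nat
    using R_pos by (intro divide_left_mono) auto
  have r_le: "r i \<le> R / 4" for i
  proof -
    have "r i \<le> \<rho> * r i" using \<rho> r_pos[of i] by simp
    then show ?thesis unfolding \<rho>r using s_le[of i] by linarith
  qed
  have m0: "0 \<le> m i x" for i x unfolding m_def using g(2) by (rule ball_avg_nonneg)
  have [measurable]: "m i \<in> borel_measurable N" for i
    unfolding m_def[abs_def] by measurable
  \<comment> \<open>The weight balances two demands. An increment carries
    \<open>2 powr (- i)\<close> from the radius, so the loss
    \<open>2 powr ((1 - \<sigma>) * i)\<close> in bounding \<open>m i x powr (1 / p)\<close> by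
    \<open>T x powr (1 / q)\<close> leaves a summable \<open>2 powr (- \<sigma> * i)\<close>.
    Integration of \<open>m i x powr \<kappa>\<close> costs
    \<open>2 powr (i * D * (\<kappa> - 1))\<close>, and since
    \<open>2 * (\<sigma> * q) = q - D * (\<kappa> - 1)\<close>, the product with the weight is
    \<open>2 powr (- \<sigma> * q * i)\<close>.\<close>
  define a where "a i x = 2 powr ((\<sigma> - 1) * q * real i) * m i x powr \<kappa>" for i x
  have [measurable]: "a i \<in> borel_measurable N" for i
    unfolding a_def[abs_def] by measurable
  have a0: "0 \<le> a i x" for i x unfolding a_def by simp
  define T where "T x = (\<Sum>i. ennreal (a i x))" for x
  have [measurable]: "T \<in> borel_measurable N" unfolding T_def[abs_def] by measurable
  define B where "B = ball x0 (5 / 4 * R)"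
  have [measurable]: "B \<in> sets N" unfolding B_def by simp
  define c1 where "c1 = \<gamma> * (\<gamma> ^ 7 * 4 powr D) powr (\<kappa> - 1) / (1 - 2 powr (- (\<sigma> * q)))"
  define c3 where "c3 = \<gamma> * C1 / (4 * \<rho>) / (1 - 2 powr (- \<sigma>))"
  define c4 where "c4 = \<gamma> ^ 7 * (4 * \<rho>) powr D"
  have two\<sigma>: "2 powr (- \<sigma>) < 1" "2 powr (- (\<sigma> * q)) < 1"
    using \<sigma> q powr_less_mono[of "-\<sigma>" 0 2] powr_less_mono[of "-(\<sigma> * q)" 0 2] by auto
  have c1: "0 \<le> c1" and c3: "0 \<le> c3" and c4: "0 \<le> c4"
    unfolding c1_def c3_def c4_def using two\<sigma> gamma_pos C1 \<rho> by auto
  have intT: "(\<integral>\<^sup>+x. indicator B x * T x \<partial>N) \<le> ennreal (c1 * G powr \<kappa>)"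
  proof -
    have "(\<integral>\<^sup>+x. indicator B x * T x \<partial>N) = (\<integral>\<^sup>+x. (\<Sum>i. indicator B x * ennreal (a i x)) \<partial>N)"
      unfolding T_def by (simp add: ennreal_suminf_cmult)
    also have "\<dots> = (\<Sum>i. \<integral>\<^sup>+x. indicator B x * ennreal (a i x) \<partial>N)"
      by (rule nn_integral_suminf) measurable
    also have "\<dots> \<le> (\<Sum>i. ennreal (\<gamma> * (\<gamma> ^ 7 * 4 powr D) powr (\<kappa> - 1) * G powr \<kappa> * (2 powr (- (\<sigma> * q))) ^ i))"
    proof (intro suminf_le)
      fix i :: nat
      define s where "s = R / (4 * 2 ^ i)"
      have s: "0 < s" "s \<le> 3 / 8 * R" unfolding s_def using R_pos s_le[of i] by auto
      have "(\<integral>\<^sup>+x. indicator B x * ennreal (a i x) \<partial>N)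
        = (\<integral>\<^sup>+x. ennreal (2 powr ((\<sigma> - 1) * q * real i)) * (indicator B x * ennreal (ball_avg s g x powr \<kappa>)) \<partial>N)"
        unfolding a_def m_def s_def by (intro nn_integral_cong) (simp add: ennreal_mult' mult_ac)
      also have "\<dots> = ennreal (2 powr ((\<sigma> - 1) * q * real i)) * (\<integral>\<^sup>+x. indicator B x * ennreal (ball_avg s g x powr \<kappa>) \<partial>N)"
        by (rule nn_integral_cmult) measurable
      also have "\<dots> \<le> ennreal (2 powr ((\<sigma> - 1) * q * real i)) *
          ennreal (\<gamma> * (\<gamma> ^ 7 * (R / s) powr D) powr (\<kappa> - 1) * G powr \<kappa>)"
        unfolding B_def D_def G_def
        by (intro mult_left_mono nn_integral_ball_avg_powr g s \<kappa>) auto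
      also have "\<dots> = ennreal (2 powr ((\<sigma> - 1) * q * real i) *
          (\<gamma> * (\<gamma> ^ 7 * (R / s) powr D) powr (\<kappa> - 1) * G powr \<kappa>))"
        using gamma_pos by (simp add: ennreal_mult')
      also have "2 powr ((\<sigma> - 1) * q * real i) * (\<gamma> * (\<gamma> ^ 7 * (R / s) powr D) powr (\<kappa> - 1) * G powr \<kappa>)
        = \<gamma> * (\<gamma> ^ 7 * 4 powr D) powr (\<kappa> - 1) * G powr \<kappa> * (2 powr (- (\<sigma> * q))) ^ i"
      proof -
        have "R / s = 4 * 2 powr (real i)"
          unfolding s_def using R_pos by (simp add: powr_realpow)
        then have "(R / s) powr D = 4 powr D * 2 powr (real i * D)"
          by (simp add: powr_mult powr_powr)
        then have 1: "(\<gamma> ^ 7 * (R / s) powr D) powr (\<kappa> - 1)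
            = (\<gamma> ^ 7 * 4 powr D) powr (\<kappa> - 1) * 2 powr (real i * D * (\<kappa> - 1))"
          using gamma_pos by (simp add: powr_mult powr_powr mult.assoc)
        have 2: "(2 powr (- (\<sigma> * q))) ^ i = 2 powr ((\<sigma> - 1) * q * real i) * 2 powr (real i * D * (\<kappa> - 1))"
        proof -
          have "(2 powr (- (\<sigma> * q))) ^ i = 2 powr (- (\<sigma> * q) * real i)"
            by (simp add: powr_powr powr_realpow[symmetric])
          also have "- (\<sigma> * q) * real i = (\<sigma> * q - 2 * (\<sigma> * q)) * real i" by (simp add: algebra_simps)
          also have "\<dots> = (\<sigma> - 1) * q * real i + real i * D * (\<kappa> - 1)"
            unfolding \<sigma>q by (simp add: algebra_simps)
          finally show ?thesis by (simp add: powr_add)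
        qed
        show ?thesis unfolding 1 2 by (simp add: mult_ac)
      qed
      finally show "(\<integral>\<^sup>+x. indicator B x * ennreal (a i x) \<partial>N)
        \<le> ennreal (\<gamma> * (\<gamma> ^ 7 * 4 powr D) powr (\<kappa> - 1) * G powr \<kappa> * (2 powr (- (\<sigma> * q))) ^ i)" .
    qed auto
    also have "\<dots> = ennreal (\<Sum>i. \<gamma> * (\<gamma> ^ 7 * 4 powr D) powr (\<kappa> - 1) * G powr \<kappa> * (2 powr (- (\<sigma> * q))) ^ i)"
      using two\<sigma> gamma_pos by (intro suminf_ennreal2 summable_mult summable_geometric) auto
    also have "(\<Sum>i. \<gamma> * (\<gamma> ^ 7 * 4 powr D) powr (\<kappa> - 1) * G powr \<kappa> * (2 powr (- (\<sigma> * q))) ^ i) = c1 * G powr \<kappa>"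
      using two\<sigma> by (subst suminf_mult) (auto simp: suminf_geometric c1_def)
    finally show ?thesis .
  qed
  define J where "J = (\<integral>x. \<bar>\<psi> x\<bar> \<partial>N)"
  have J: "0 \<le> J" unfolding J_def by simp
  \<comment> \<open>The chain of averages starts from an \<open>L^1\<close> mean of
    \<open>\<psi>\<close>; Jensen converts it into the \<open>L^p\<close> term of the claim.\<close>
  have Jq: "J powr q \<le> P powr \<kappa>"
  proof -
    have "J powr q = (J powr p) powr \<kappa>" using J by (simp add: powr_powr q_def)
    also have "\<dots> \<le> P powr \<kappa>"
      unfolding J_def P_def using i\<psi>p p \<kappa> mass_le
      by (intro powr_mono2 integral_powr_jensen) auto
    finally show ?thesis .
  qed
  have pw: "\<bar>\<psi> x\<bar> \<le> c4 * J + c3 * R * t powr (1 / q)"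
    if x: "x \<in> B" and t: "T x = ennreal t" "0 \<le> t" for x t
  proof -
    have dx: "dist x x0 < 5 / 4 * R" using x by (simp add: B_def dist_commute)
    have a_le: "a i x \<le> t" for i
    proof -
      have "(\<Sum>j\<in>{i}. ennreal (a j x)) \<le> T x"
        unfolding T_def by (rule sum_le_suminf) auto
      then have "ennreal (a i x) \<le> ennreal t" using t by simp
      then show ?thesis using t by simp
    qed
    have m_le: "m i x powr (1 / p) \<le> 2 powr ((1 - \<sigma>) * real i) * t powr (1 / q)" for i
    proof -
      have "m i x powr (1 / p) = (2 powr ((1 - \<sigma>) * q * real i) * a i x) powr (1 / q)"
      proof -
        have "2 powr ((1 - \<sigma>) * q * real i) * a i x = m i x powr \<kappa>"
        proof -
          have "(1 - \<sigma>) * q * real i + (\<sigma> - 1) * q * real i = 0" by (simp add: algebra_simps)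
          then have "2 powr ((1 - \<sigma>) * q * real i) * 2 powr ((\<sigma> - 1) * q * real i) = (1::real)"
            by (simp only: powr_add[symmetric]) simp
          then show ?thesis unfolding a_def by (simp only: mult.assoc[symmetric] mult_1_left)
        qed
        then show ?thesis using p \<kappa> by (simp add: powr_powr q_def)
      qed
      also have "\<dots> \<le> (2 powr ((1 - \<sigma>) * q * real i) * t) powr (1 / q)"
        using a_le a0 q by (intro powr_mono2 mult_left_mono) auto
      also have "\<dots> = 2 powr ((1 - \<sigma>) * real i) * t powr (1 / q)"
        using q t by (simp add: powr_mult powr_powr)
      finally show ?thesis .
    qed
    define A where "A i = ball_avg (r i) \<psi> x" for i
    define c2 where "c2 = \<gamma> * C1 / (4 * \<rho>)"
    have c2: "0 \<le> c2" unfolding c2_def using gamma_pos C1 \<rho> by simp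
    have step: "\<bar>A (Suc i) - A i\<bar> \<le> c2 * R * t powr (1 / q) * (2 powr (- \<sigma>)) ^ i" for i
    proof -
      have half: "r (Suc i) = r i / 2" unfolding r_def by simp
      have "\<bar>A (Suc i) - A i\<bar> \<le> ball_avg (r (Suc i)) (\<lambda>y. \<bar>\<psi> y - A i\<bar>) x"
        unfolding A_def using r_pos r_le[of "Suc i"] R_pos dx
        by (intro ball_avg_diff_le i\<psi> mass_ball_pos) auto
      also have "\<dots> \<le> \<gamma> * ball_avg (r i) (\<lambda>y. \<bar>\<psi> y - A i\<bar>) x"
        unfolding half using i\<psi> dx r_pos[of i] r_le[of i] R_pos by (intro ball_avg_half_le) auto
      also have "\<dots> \<le> \<gamma> * (C1 * r i * ball_avg (\<rho> * r i) g x powr (1 / p))"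
        unfolding A_def
      proof (intro mult_left_mono poincare r_pos)
        show "ball x (\<rho> * r i) \<subseteq> ball x0 (2 * R)"
          unfolding \<rho>r using dx s_le[of i] R_pos by (intro ball_subset_ballI) linarith
      qed (use gamma_pos in auto)
      also have "\<dots> = \<gamma> * C1 * r i * m i x powr (1 / p)"
        unfolding \<rho>r m_def by simp
      also have "\<dots> \<le> \<gamma> * C1 * r i * (2 powr ((1 - \<sigma>) * real i) * t powr (1 / q))"
        using gamma_pos C1 r_pos[of i] by (intro mult_left_mono m_le) auto
      also have "\<dots> = c2 * R * t powr (1 / q) * (2 powr (- \<sigma>)) ^ i"
      proof -
        have e: "2 powr ((1 - \<sigma>) * real i) = 2 ^ i * (2 powr (- \<sigma>)) ^ i"
        proof -
          have "2 powr ((1 - \<sigma>) * real i) = 2 powr (real i) * 2 powr (- \<sigma> * real i)"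
            by (simp only: powr_add[symmetric]) (simp add: left_diff_distrib)
          also have "2 powr (- \<sigma> * real i) = (2 powr (- \<sigma>)) ^ i"
            by (simp add: powr_powr powr_realpow[symmetric])
          finally show ?thesis by (simp add: powr_realpow)
        qed
        show ?thesis unfolding e c2_def r_def by (simp add: field_simps)
      qed
      finally show ?thesis .
    qed
    have bound: "\<bar>A n\<bar> \<le> \<bar>A 0\<bar> + c3 * R * t powr (1 / q)" for n
    proof -
      have "\<bar>A n - A 0\<bar> \<le> (\<Sum>i<n. c2 * R * t powr (1 / q) * (2 powr (- \<sigma>)) ^ i)"
      proof -
        have "A n - A 0 = (\<Sum>i<n. A (Suc i) - A i)" by (simp add: sum_lessThan_telescope)
        also have "\<bar>\<dots>\<bar> \<le> (\<Sum>i<n. \<bar>A (Suc i) - A i\<bar>)" by (rule sum_abs)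
        also have "\<dots> \<le> (\<Sum>i<n. c2 * R * t powr (1 / q) * (2 powr (- \<sigma>)) ^ i)"
          by (intro sum_mono step)
        finally show ?thesis .
      qed
      also have "\<dots> \<le> (\<Sum>i. c2 * R * t powr (1 / q) * (2 powr (- \<sigma>)) ^ i)"
        using two\<sigma> c2 R_pos by (intro sum_le_suminf summable_mult summable_geometric) auto
      also have "\<dots> = c3 * R * t powr (1 / q)"
        using two\<sigma> by (subst suminf_mult) (auto simp: suminf_geometric c3_def c2_def)
      finally show ?thesis by linarith
    qed
    have lim: "A \<longlonglongrightarrow> \<psi> x"
      unfolding A_def
    proof (rule ball_avg_tendsto[OF i\<psi> _ dx])
      show "isCont \<psi> x" using \<psi>(1) by (simp add: continuous_on_eq_continuous_at)
      have "(\<lambda>i. R / (4 * \<rho>) * (1 / 2) ^ i) \<longlonglongrightarrow> R / (4 * \<rho>) * 0"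
        by (intro tendsto_mult tendsto_const LIMSEQ_power_zero) simp
      then show "r \<longlonglongrightarrow> 0"
        unfolding r_def[abs_def] by (simp add: power_one_over field_simps)
      show "r i \<le> 3 / 4 * R" for i using r_le[of i] R_pos by simp
    qed (rule r_pos)
    have A0: "\<bar>A 0\<bar> \<le> c4 * J"
    proof -
      have mp: "0 < measure N (ball x (r 0))"
        using dx r_pos r_le[of 0] R_pos by (intro mass_ball_pos) auto
      have "1 \<le> \<gamma> ^ 7 * (R / r 0) powr D * measure N (ball x (r 0))"
        unfolding D_def using dx r_pos r_le[of 0] R_pos by (intro mass_ball_lower) auto
      then have "1 \<le> c4 * measure N (ball x (r 0))"
        using R_pos \<rho> by (simp add: c4_def r_def)
      then have 1: "1 / measure N (ball x (r 0)) \<le> c4" using mp by (simp add: field_simps)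
      have "\<bar>A 0 - 0\<bar> \<le> ball_avg (r 0) (\<lambda>y. \<bar>\<psi> y - 0\<bar>) x"
        unfolding A_def by (rule ball_avg_diff_le[OF i\<psi> mp])
      also have "\<dots> \<le> J * (1 / measure N (ball x (r 0)))"
      proof -
        have "(LINT y:ball x (r 0)|N. \<bar>\<psi> y - 0\<bar>) \<le> J"
          unfolding set_lebesgue_integral_def J_def using i\<psi>
          by (intro integral_mono integrable_mult_indicator) (auto simp: indicator_def)
        then show ?thesis unfolding ball_avg_def using mp by (simp add: divide_right_mono)
      qed
      also have "\<dots> \<le> J * c4" using 1 J by (rule mult_left_mono)
      finally show ?thesis by (simp add: mult.commute)
    qed
    have "\<bar>\<psi> x\<bar> \<le> \<bar>A 0\<bar> + c3 * R * t powr (1 / q)"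
      by (rule LIMSEQ_le_const2[OF tendsto_rabs[OF lim]]) (use bound in auto)
    then show ?thesis using A0 by linarith
  qed
  have "(\<integral>\<^sup>+x. ennreal (\<bar>\<psi> x\<bar> powr q) \<partial>N)
    \<le> (\<integral>\<^sup>+x. ennreal (2 powr q * (c4 * J) powr q) + ennreal (2 powr q * (c3 * R) powr q) * (indicator B x * T x) \<partial>N)"
  proof (rule nn_integral_mono_AE)
    \<comment> \<open>Finiteness of the integral makes the series converge almost everywhere, and
      the pointwise bound is applied at such points.\<close>
    have "AE x in N. indicator B x * T x \<noteq> \<infinity>"
      using intT by (intro nn_integral_PInf_AE) (auto simp: top_unique)
    then show "AE x in N. ennreal (\<bar>\<psi> x\<bar> powr q) \<le> ennreal (2 powr q * (c4 * J) powr q) + ennreal (2 powr q * (c3 * R) powr q) * (indicator B x * T x)"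
    proof eventually_elim
      case (elim x)
      show ?case
      proof (cases "x \<in> B")
        case True
        then have "T x \<noteq> \<infinity>" using elim by simp
        then obtain t where t: "T x = ennreal t" "0 \<le> t" by (cases "T x") auto
        have "\<bar>\<psi> x\<bar> powr q \<le> (c4 * J + c3 * R * t powr (1 / q)) powr q"
          using pw[OF True t] q by (intro powr_mono2) auto
        also have "\<dots> \<le> 2 powr q * ((c4 * J) powr q + (c3 * R * t powr (1 / q)) powr q)"
          using c3 c4 J R_pos q by (intro powr_add_le) auto
        also have "(c3 * R * t powr (1 / q)) powr q = (c3 * R) powr q * t"
          using c3 R_pos t q by (simp add: powr_mult powr_powr)
        finally have "\<bar>\<psi> x\<bar> powr q \<le> 2 powr q * (c4 * J) powr q + 2 powr q * (c3 * R) powr q * t"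
          by (simp add: algebra_simps)
        then show ?thesis
          using True t by (simp add: ennreal_plus[symmetric] ennreal_mult[symmetric] ennreal_leI del: ennreal_plus)
      next
        case False
        then have "\<psi> x = 0" using \<psi>(3) by (simp add: B_def)
        then show ?thesis using q by simp
      qed
    qed
  qed
  also have "\<dots> = (\<integral>\<^sup>+x. ennreal (2 powr q * (c4 * J) powr q) \<partial>N) + ennreal (2 powr q * (c3 * R) powr q) * (\<integral>\<^sup>+x. indicator B x * T x \<partial>N)"
    by (subst nn_integral_add) (auto simp: nn_integral_cmult)
  also have "\<dots> \<le> ennreal (2 powr q * (c4 * J) powr q) + ennreal (2 powr q * (c3 * R) powr q) * ennreal (c1 * G powr \<kappa>)"
  proof (intro add_mono mult_left_mono intT)
    have "emeasure N (space N) \<le> 1" using mass_le by (simp add: emeasure_eq_measure)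
    then show "(\<integral>\<^sup>+x. ennreal (2 powr q * (c4 * J) powr q) \<partial>N) \<le> ennreal (2 powr q * (c4 * J) powr q)"
      using mult_left_mono[of "emeasure N (space N)" 1 "ennreal (2 powr q * (c4 * J) powr q)"] by simp
  qed simp
  also have "\<dots> = ennreal (2 powr q * (c4 powr q * J powr q) + 2 powr q * (c3 powr q * (R powr p) powr \<kappa>) * (c1 * G powr \<kappa>))"
    using c1 c3 c4 J R_pos
    by (simp add: ennreal_plus[symmetric] ennreal_mult[symmetric] powr_mult powr_powr q_def del: ennreal_plus)
  also have "\<dots> \<le> ennreal (2 powr q * (c4 powr q + c3 powr q * c1) * (R powr p * G + P) powr \<kappa>)"
  proof (rule ennreal_leI)
    define E where "E = (R powr p * G + P) powr \<kappa>"
    have 1: "J powr q \<le> E"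
    proof -
      have "P powr \<kappa> \<le> E" unfolding E_def using P G \<kappa> by (intro powr_mono2) auto
      then show ?thesis using Jq by linarith
    qed
    have 2: "(R powr p) powr \<kappa> * G powr \<kappa> \<le> E"
      unfolding E_def using P G \<kappa> by (subst powr_mult[symmetric]) (auto intro!: powr_mono2)
    have "2 powr q * (c4 powr q * J powr q) + 2 powr q * (c3 powr q * (R powr p) powr \<kappa>) * (c1 * G powr \<kappa>)
      = 2 powr q * (c4 powr q * J powr q + c3 powr q * c1 * ((R powr p) powr \<kappa> * G powr \<kappa>))"
      by (simp add: algebra_simps)
    also have "\<dots> \<le> 2 powr q * (c4 powr q * E + c3 powr q * c1 * E)"
      using 1 2 c1 by (intro mult_left_mono add_mono) auto
    finally show "2 powr q * (c4 powr q * J powr q) + 2 powr q * (c3 powr q * (R powr p) powr \<kappa>) * (c1 * G powr \<kappa>)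
      \<le> 2 powr q * (c4 powr q + c3 powr q * c1) * (R powr p * G + P) powr \<kappa>"
      unfolding E_def by (simp add: algebra_simps)
  qed
  finally show ?thesis
    unfolding sob_const_def G_def[symmetric] P_def[symmetric] D_def[symmetric] \<sigma>_def[symmetric] q_def[symmetric]
      c1_def c3_def c4_def .
qed

end

section \<open>Compactly supported Sobolev functions\<close>

lemma C1_grad_continuous_on: "C1_grad U u Du \<Longrightarrow> continuous_on U u"
  unfolding C1_grad_def
  by (rule continuous_at_imp_continuous_on) (auto intro: has_derivative_continuous)

text \<open>The open sets \<open>V\<close> and \<open>- K\<close> cover the space. On the first the
  product and chain rules apply, on the second the function is zero, so derivative and continuity of
  the gradient glue. The indicator performs the extension by zero of a function that is
  \<open>C^1\<close> only on \<open>V\<close>.\<close>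

lemma C1_grad_mult_compose:
  fixes F F' :: "real \<Rightarrow> real" and \<eta> :: "'n::euclidean_space \<Rightarrow> real"
  assumes V: "open V" and v: "C1_grad V v Dv" and \<eta>: "C1_grad UNIV \<eta> D\<eta>"
    and F: "\<And>t. (F has_real_derivative F' t) (at t)" "continuous_on UNIV F'"
    and K: "closed K" "K \<subseteq> V" "\<And>x. x \<notin> K \<Longrightarrow> \<eta> x = 0" "\<And>x. x \<notin> K \<Longrightarrow> D\<eta> x = 0"
  shows "C1_grad UNIV (\<lambda>x. indicator V x * (\<eta> x * F (v x)))
    (\<lambda>x. indicator V x *\<^sub>R ((\<eta> x * F' (v x)) *\<^sub>R Dv x + F (v x) *\<^sub>R D\<eta> x))"
    (is "C1_grad UNIV ?\<psi> ?D")
proof -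
  have cF: "continuous_on UNIV F"
    by (meson DERIV_continuous F(1) continuous_at_imp_continuous_on)
  have cv: "continuous_on V v" by (rule C1_grad_continuous_on[OF v])
  have cover: "UNIV = V \<union> - K" using K by auto
  have oK: "open (- K)" using K by auto
  have der: "(?\<psi> has_derivative (\<lambda>h. ?D x \<bullet> h)) (at x)" for x
  proof (cases "x \<in> V")
    case True
    have dv: "(v has_derivative (\<lambda>h. Dv x \<bullet> h)) (at x)"
      using v True unfolding C1_grad_def by auto
    have d\<eta>: "(\<eta> has_derivative (\<lambda>h. D\<eta> x \<bullet> h)) (at x)"
      using \<eta> unfolding C1_grad_def by auto
    have dF: "(F has_derivative (\<lambda>h. F' (v x) * h)) (at (v x))"
      using F(1)[of "v x"] unfolding has_field_derivative_def .
    have "((\<lambda>x. F (v x)) has_derivative (\<lambda>h. F' (v x) * (Dv x \<bullet> h))) (at x)"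
      by (rule has_derivative_compose[OF dv dF])
    from has_derivative_mult[OF d\<eta> this]
    have "((\<lambda>x. \<eta> x * F (v x)) has_derivative (\<lambda>h. ?D x \<bullet> h)) (at x)"
      by (rule has_derivative_eq_rhs) (use True in \<open>auto simp: fun_eq_iff inner_add_left algebra_simps\<close>)
    then show ?thesis
      by (rule has_derivative_transform_within_open[OF _ V True]) auto
  next
    case False
    then have xK: "x \<in> - K" using K by auto
    have "((\<lambda>_. 0) has_derivative (\<lambda>h. ?D x \<bullet> h)) (at x)"
      using False by simp
    then show ?thesis
      by (rule has_derivative_transform_within_open[OF _ oK xK]) (use K in auto)
  qed
  have "continuous_on V (\<lambda>x. (\<eta> x * F' (v x)) *\<^sub>R Dv x + F (v x) *\<^sub>R D\<eta> x)"
  proof -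
    have 1: "continuous_on V (\<lambda>x. F' (v x))" "continuous_on V (\<lambda>x. F (v x))"
      using continuous_on_compose2[OF F(2) cv] continuous_on_compose2[OF cF cv] by auto
    have 2: "continuous_on V \<eta>" "continuous_on V D\<eta>" "continuous_on V Dv"
      using C1_grad_continuous_on[OF \<eta>] \<eta> v unfolding C1_grad_def
      by (auto intro: continuous_on_subset)
    show ?thesis by (intro continuous_intros 1 2)
  qed
  then have "continuous_on V ?D" by (rule continuous_on_eq) auto
  moreover have "continuous_on (- K) ?D"
    by (rule continuous_on_eq[of _ "\<lambda>_. 0"]) (use K in auto)
  ultimately have "continuous_on UNIV ?D"
    unfolding cover by (intro continuous_on_open_Un V oK)
  then show ?thesis unfolding C1_grad_def by (intro conjI ballI der)
qed

context doubling_ball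
begin

text \<open>The closure, in the Sobolev norm of \<open>N\<close>, of \<open>C^1\<close> functions
  vanishing off a fixed ball: the Sobolev inequality extends to it, and the test functions belong to
  it. As in \<open>H1pw\<close>, the gradient is a separate component. The approximants are
  \<open>C^1\<close> on the whole space so that the Poincare inequality applies to them
  directly.\<close>

definition sobolev0 :: "real \<Rightarrow> ('n \<Rightarrow> real) \<Rightarrow> ('n \<Rightarrow> 'n) \<Rightarrow> bool" where
  "sobolev0 p \<phi> D\<phi> \<longleftrightarrow> \<phi> \<in> borel_measurable N \<and> D\<phi> \<in> borel_measurable N \<and>
     integrable N (\<lambda>x. \<bar>\<phi> x\<bar> powr p) \<and> integrable N (\<lambda>x. norm (D\<phi> x) powr p) \<and>
     (\<exists>v Dv. (\<forall>k. C1_grad UNIV (v k) (Dv k) \<and> (\<forall>x. x \<notin> ball x0 (5 / 4 * R) \<longrightarrow> v k x = 0 \<and> Dv k x = 0)) \<and>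
        (\<lambda>k. \<integral>x. \<bar>v k x - \<phi> x\<bar> powr p \<partial>N) \<longlonglongrightarrow> 0 \<and>
        (\<lambda>k. \<integral>x. norm (Dv k x - D\<phi> x) powr p \<partial>N) \<longlonglongrightarrow> 0)"

lemma integrable_powr_diff:
  fixes f g :: "'n \<Rightarrow> 'b::euclidean_space"
  assumes [measurable]: "f \<in> borel_measurable N" "g \<in> borel_measurable N"
    and "integrable N (\<lambda>x. norm (f x) powr p)" "integrable N (\<lambda>x. norm (g x) powr p)" and p: "0 < p"
  shows "integrable N (\<lambda>x. norm (f x - g x) powr p)"
proof (rule Bochner_Integration.integrable_bound)
  show "integrable N (\<lambda>x. 2 powr p * (norm (f x) powr p + norm (g x) powr p))"
    using assms by auto
  show "AE x in N. norm (norm (f x - g x) powr p) \<le> norm (2 powr p * (norm (f x) powr p + norm (g x) powr p))"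
  proof (rule AE_I2)
    fix x
    have "norm (f x - g x) powr p \<le> (norm (f x) + norm (g x)) powr p"
      using p by (intro powr_mono2 norm_triangle_ineq4) auto
    also have "\<dots> \<le> 2 powr p * (norm (f x) powr p + norm (g x) powr p)"
      using p by (intro powr_add_le) auto
    finally show "norm (norm (f x - g x) powr p) \<le> norm (2 powr p * (norm (f x) powr p + norm (g x) powr p))"
      by (simp add: abs_of_nonneg)
  qed
qed measurable

lemma bounded_of_compact_support:
  fixes f :: "'n \<Rightarrow> 'b::real_normed_vector"
  assumes "continuous_on UNIV f" "\<And>x. x \<notin> ball x0 r \<Longrightarrow> f x = 0"
  obtains M where "\<And>x. norm (f x) \<le> M"
proof -
  have "compact (f ` cball x0 r)"
    using assms(1) by (intro compact_continuous_image) (auto intro: continuous_on_subset)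
  then obtain M where M: "\<And>y. y \<in> f ` cball x0 r \<Longrightarrow> norm y \<le> M"
    using compact_imp_bounded bounded_iff by metis
  have "norm (f x) \<le> max M 0" for x
  proof (cases "x \<in> ball x0 r")
    case True
    then have "f x \<in> f ` cball x0 r" using ball_subset_cball by blast
    then show ?thesis using M by (simp add: le_max_iff_disj)
  qed (use assms(2) in auto)
  then show ?thesis by (rule that)
qed

lemma integrable_powr_compact_support:
  fixes f :: "'n \<Rightarrow> 'b::euclidean_space"
  assumes "continuous_on UNIV f" "\<And>x. x \<notin> ball x0 r \<Longrightarrow> f x = 0" "0 < p"
  shows "integrable N (\<lambda>x. norm (f x) powr p)"
proof -
  obtain M where M: "\<And>x. norm (f x) \<le> M" using bounded_of_compact_support[OF assms(1,2)] by blast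
  note [measurable] = continuous_measurable_N[OF assms(1)]
  show ?thesis
    by (rule integrable_const_bound[where B = "M powr p"]) (use M assms(3) in \<open>auto intro!: powr_mono2\<close>)
qed

lemma sob_const_nonneg:
  assumes p: "1 < p" and \<kappa>: "1 < \<kappa>" "log 2 \<gamma> * (\<kappa> - 1) < p * \<kappa>"
  shows "0 \<le> sob_const \<gamma> p C1 \<rho> \<kappa>"
proof -
  have "0 < sob_sigma \<gamma> p \<kappa>" unfolding sob_sigma_def using p \<kappa> by simp
  then have "2 powr (- (sob_sigma \<gamma> p \<kappa> * (p * \<kappa>))) < 1"
    using p \<kappa> powr_less_mono[of "- (sob_sigma \<gamma> p \<kappa> * (p * \<kappa>))" 0 2] by auto
  then show ?thesis unfolding sob_const_def using gamma_pos by auto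
qed

text \<open>Fatou along an almost everywhere convergent subsequence of the approximants. Their
  energies are bounded by \<open>E k\<close>, the distance to the limit plus the energy of the
  limit, which converges by assumption; this comparison is the source of the factor
  \<open>2 powr p\<close>.\<close>

lemma sobolev0_inequality:
  assumes p: "1 < p" and \<kappa>: "1 < \<kappa>" "log 2 \<gamma> * (\<kappa> - 1) < p * \<kappa>"
    and C1: "0 < C1" and \<rho>: "1 \<le> \<rho>"
    and poincare: "\<And>\<psi> D\<psi> x r. C1_grad UNIV \<psi> D\<psi> \<Longrightarrow> (\<And>x. x \<notin> ball x0 (5 / 4 * R) \<Longrightarrow> \<psi> x = 0 \<and> D\<psi> x = 0) \<Longrightarrow>
      0 < r \<Longrightarrow> ball x (\<rho> * r) \<subseteq> ball x0 (2 * R) \<Longrightarrow>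
      ball_avg r (\<lambda>y. \<bar>\<psi> y - ball_avg r \<psi> x\<bar>) x \<le> C1 * r * ball_avg (\<rho> * r) (\<lambda>y. norm (D\<psi> y) powr p) x powr (1 / p)"
    and \<phi>: "sobolev0 p \<phi> D\<phi>"
  shows "(\<integral>\<^sup>+x. ennreal (\<bar>\<phi> x\<bar> powr (p * \<kappa>)) \<partial>N)
    \<le> ennreal (sob_const \<gamma> p C1 \<rho> \<kappa> * (2 powr p * (R powr p * (\<integral>x. norm (D\<phi> x) powr p \<partial>N) + (\<integral>x. \<bar>\<phi> x\<bar> powr p \<partial>N))) powr \<kappa>)"
proof -
  from \<phi> have [measurable]: "\<phi> \<in> borel_measurable N" "D\<phi> \<in> borel_measurable N"
    and i\<phi>: "integrable N (\<lambda>x. norm (\<phi> x) powr p)" "integrable N (\<lambda>x. norm (D\<phi> x) powr p)"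
    unfolding sobolev0_def by auto
  from \<phi> obtain v Dv where v: "\<And>k. C1_grad UNIV (v k) (Dv k)"
    "\<And>k x. x \<notin> ball x0 (5 / 4 * R) \<Longrightarrow> v k x = 0 \<and> Dv k x = 0"
    and lim: "(\<lambda>k. \<integral>x. \<bar>v k x - \<phi> x\<bar> powr p \<partial>N) \<longlonglongrightarrow> 0" "(\<lambda>k. \<integral>x. norm (Dv k x - D\<phi> x) powr p \<partial>N) \<longlonglongrightarrow> 0"
    unfolding sobolev0_def by auto
  have c: "continuous_on UNIV (v k)" "continuous_on UNIV (Dv k)" for k
    using v(1)[of k] C1_grad_continuous_on[OF v(1)[of k]] unfolding C1_grad_def by auto
  have [measurable]: "v k \<in> borel_measurable N" "Dv k \<in> borel_measurable N" for k
    using c continuous_measurable_N by auto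
  have iv: "integrable N (\<lambda>x. norm (v k x) powr p)" "integrable N (\<lambda>x. norm (Dv k x) powr p)" for k
    by (rule integrable_powr_compact_support[OF c(1)[of k], where r = "5 / 4 * R"]; use v(2) p in simp)
      (rule integrable_powr_compact_support[OF c(2)[of k], where r = "5 / 4 * R"]; use v(2) p in simp)
  have id: "integrable N (\<lambda>x. norm (v k x - \<phi> x) powr p)" "integrable N (\<lambda>x. norm (Dv k x - D\<phi> x) powr p)" for k
    by (rule integrable_powr_diff; use iv i\<phi> p in simp)+
  define c0 where "c0 = sob_const \<gamma> p C1 \<rho> \<kappa>"
  have c0: "0 \<le> c0" unfolding c0_def by (rule sob_const_nonneg[OF p \<kappa>])
  define E where "E k = 2 powr p * (R powr p * ((\<integral>x. norm (Dv k x - D\<phi> x) powr p \<partial>N) + (\<integral>x. norm (D\<phi> x) powr p \<partial>N))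
      + ((\<integral>x. \<bar>v k x - \<phi> x\<bar> powr p \<partial>N) + (\<integral>x. \<bar>\<phi> x\<bar> powr p \<partial>N)))" for k
  have bound: "(\<integral>\<^sup>+x. ennreal (\<bar>v k x\<bar> powr (p * \<kappa>)) \<partial>N) \<le> ennreal (c0 * E k powr \<kappa>)" for k
  proof -
    obtain M where M: "\<And>x. norm (v k x) \<le> M" using bounded_of_compact_support[OF c(1)] v(2) by metis
    have "(\<integral>\<^sup>+x. ennreal (\<bar>v k x\<bar> powr (p * \<kappa>)) \<partial>N)
      \<le> ennreal (c0 * (R powr p * (\<integral>x. norm (Dv k x) powr p \<partial>N) + (\<integral>x. \<bar>v k x\<bar> powr p \<partial>N)) powr \<kappa>)"
      unfolding c0_def
    proof (rule sobolev[OF p \<kappa> C1 \<rho> c(1)])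
      show "\<bar>v k x\<bar> \<le> M" for x using M[of x] by simp
      show "ball_avg r (\<lambda>y. \<bar>v k y - ball_avg r (v k) x\<bar>) x \<le> C1 * r * ball_avg (\<rho> * r) (\<lambda>x. norm (Dv k x) powr p) x powr (1 / p)"
        if "0 < r" "ball x (\<rho> * r) \<subseteq> ball x0 (2 * R)" for x r
        using that by (intro poincare v)
    qed (use v(2) iv in auto)
    also have "\<dots> \<le> ennreal (c0 * E k powr \<kappa>)"
    proof (intro ennreal_leI mult_left_mono powr_mono2)
      have 1: "(\<integral>x. norm (f x) powr p \<partial>N) \<le> 2 powr p * ((\<integral>x. norm (f x - g x) powr p \<partial>N) + (\<integral>x. norm (g x) powr p \<partial>N))"
        if "integrable N (\<lambda>x. norm (f x) powr p)" "integrable N (\<lambda>x. norm (g x) powr p)" "integrable N (\<lambda>x. norm (f x - g x) powr p)"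
        for f g :: "'n \<Rightarrow> 'b::euclidean_space"
      proof -
        have "(\<integral>x. norm (f x) powr p \<partial>N) \<le> (\<integral>x. 2 powr p * (norm (f x - g x) powr p + norm (g x) powr p) \<partial>N)"
        proof (rule integral_mono)
          fix x
          have "norm (f x) powr p \<le> (norm (f x - g x) + norm (g x)) powr p"
            using p norm_triangle_sub[of "f x" "g x"] by (intro powr_mono2) (auto simp: add.commute)
          also have "\<dots> \<le> 2 powr p * (norm (f x - g x) powr p + norm (g x) powr p)"
            using p by (intro powr_add_le) auto
          finally show "norm (f x) powr p \<le> 2 powr p * (norm (f x - g x) powr p + norm (g x) powr p)" .
        qed (use that in auto)
        also have "\<dots> = 2 powr p * ((\<integral>x. norm (f x - g x) powr p \<partial>N) + (\<integral>x. norm (g x) powr p \<partial>N))"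
          using that by simp
        finally show ?thesis .
      qed
      have "R powr p * (\<integral>x. norm (Dv k x) powr p \<partial>N) \<le> R powr p * (2 powr p * ((\<integral>x. norm (Dv k x - D\<phi> x) powr p \<partial>N) + (\<integral>x. norm (D\<phi> x) powr p \<partial>N)))"
        by (intro mult_left_mono 1 iv i\<phi> id) simp
      moreover have "(\<integral>x. norm (v k x) powr p \<partial>N) \<le> 2 powr p * ((\<integral>x. norm (v k x - \<phi> x) powr p \<partial>N) + (\<integral>x. norm (\<phi> x) powr p \<partial>N))"
        by (intro 1 iv i\<phi> id)
      ultimately show "R powr p * (\<integral>x. norm (Dv k x) powr p \<partial>N) + (\<integral>x. \<bar>v k x\<bar> powr p \<partial>N) \<le> E k"
        unfolding E_def by (simp add: algebra_simps)
      show "0 \<le> R powr p * (\<integral>x. norm (Dv k x) powr p \<partial>N) + (\<integral>x. \<bar>v k x\<bar> powr p \<partial>N)"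
        by (intro add_nonneg_nonneg mult_nonneg_nonneg integral_nonneg_AE) auto
    qed (use \<kappa> c0 in auto)
    finally show ?thesis .
  qed
  define E0 where "E0 = 2 powr p * (R powr p * (0 + (\<integral>x. norm (D\<phi> x) powr p \<partial>N)) + (0 + (\<integral>x. \<bar>\<phi> x\<bar> powr p \<partial>N)))"
  have E: "E \<longlonglongrightarrow> E0"
    unfolding E_def[abs_def] E0_def by (intro tendsto_intros lim)
  have E0: "0 \<le> E k" for k
    unfolding E_def by (intro mult_nonneg_nonneg add_nonneg_nonneg integral_nonneg_AE) auto
  have EE: "(\<lambda>k. ennreal (c0 * E k powr \<kappa>)) \<longlonglongrightarrow> ennreal (c0 * E0 powr \<kappa>)"
  proof -
    have "(\<lambda>k. c0 * E k powr \<kappa>) \<longlonglongrightarrow> c0 * E0 powr \<kappa>"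
      using \<kappa> E0 by (intro tendsto_mult tendsto_const tendsto_powr' E) auto
    then show ?thesis by (simp add: tendsto_ennrealI)
  qed
  have "(\<lambda>n. \<integral>x. norm (norm (v n x - \<phi> x) powr p) \<partial>N) \<longlonglongrightarrow> 0" using lim(1) by simp
  from tendsto_L1_AE_subseq[OF id(1) this] obtain s :: "nat \<Rightarrow> nat" where s: "strict_mono s"
    "AE x in N. (\<lambda>n. norm (v (s n) x - \<phi> x) powr p) \<longlonglongrightarrow> 0" by auto
  have "(\<integral>\<^sup>+x. ennreal (\<bar>\<phi> x\<bar> powr (p * \<kappa>)) \<partial>N) = (\<integral>\<^sup>+x. liminf (\<lambda>n. ennreal (\<bar>v (s n) x\<bar> powr (p * \<kappa>))) \<partial>N)"
  proof (rule nn_integral_cong_AE)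
    show "AE x in N. ennreal (\<bar>\<phi> x\<bar> powr (p * \<kappa>)) = liminf (\<lambda>n. ennreal (\<bar>v (s n) x\<bar> powr (p * \<kappa>)))"
      using s(2)
    proof eventually_elim
      case (elim x)
      have "(\<lambda>n. (norm (v (s n) x - \<phi> x) powr p) powr (1 / p)) \<longlonglongrightarrow> 0 powr (1 / p)"
        using p by (intro tendsto_powr' elim tendsto_const) auto
      then have "(\<lambda>n. v (s n) x - \<phi> x) \<longlonglongrightarrow> 0"
        using p by (simp add: powr_powr tendsto_rabs_zero_iff)
      then have "(\<lambda>n. v (s n) x) \<longlonglongrightarrow> \<phi> x" by (simp add: LIM_zero_iff)
      then have "(\<lambda>n. \<bar>v (s n) x\<bar> powr (p * \<kappa>)) \<longlonglongrightarrow> \<bar>\<phi> x\<bar> powr (p * \<kappa>)"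
        using p \<kappa> by (intro tendsto_powr' tendsto_rabs tendsto_const) auto
      then have "(\<lambda>n. ennreal (\<bar>v (s n) x\<bar> powr (p * \<kappa>))) \<longlonglongrightarrow> ennreal (\<bar>\<phi> x\<bar> powr (p * \<kappa>))"
        by (rule tendsto_ennrealI)
      then show ?case by (rule lim_imp_Liminf[OF trivial_limit_sequentially, symmetric])
    qed
  qed
  also have "\<dots> \<le> liminf (\<lambda>n. \<integral>\<^sup>+x. ennreal (\<bar>v (s n) x\<bar> powr (p * \<kappa>)) \<partial>N)"
    by (rule nn_integral_liminf) measurable
  also have "\<dots> \<le> liminf (\<lambda>n. ennreal (c0 * E (s n) powr \<kappa>))"
    by (intro Liminf_mono always_eventually allI bound)
  also have "\<dots> = ennreal (c0 * E0 powr \<kappa>)"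
    using LIMSEQ_subseq_LIMSEQ[OF EE s(1)] by (intro lim_imp_Liminf) (auto simp: o_def)
  finally show ?thesis unfolding c0_def E0_def by simp
qed

text \<open>The gradient error splits into terms with \<open>F' (v k) * (Dv k - G)\<close>,
  \<open>(F' (v k) - F' u) * G\<close> and \<open>(F (v k) - F u) * D\<eta>\<close>. The outer two
  vanish in \<open>L^p\<close> because \<open>F'\<close> is bounded by one. The middle one needs
  continuity of \<open>F'\<close> and dominated convergence along an almost everywhere convergent
  subsequence, so only a subsequence of the approximants is kept.\<close>

lemma sobolev0_mult_compose:
  fixes F F' :: "real \<Rightarrow> real" and \<eta> :: "'n \<Rightarrow> real"
  assumes p: "1 < p" and V: "open V" "cball x0 (5 / 4 * R) \<subseteq> V"
    and u: "u \<in> borel_measurable N" "G \<in> borel_measurable N"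
      "integrable N (\<lambda>x. \<bar>u x\<bar> powr p)" "integrable N (\<lambda>x. norm (G x) powr p)"
      "\<And>x. x \<notin> V \<Longrightarrow> u x = 0"
    and v: "\<And>k. C1_grad V (v k) (Dv k)"
      "\<And>k. integrable N (\<lambda>x. indicator V x * \<bar>v k x - u x\<bar> powr p)"
      "\<And>k. integrable N (\<lambda>x. indicator V x * norm (Dv k x - G x) powr p)"
      "(\<lambda>k. \<integral>x. indicator V x * \<bar>v k x - u x\<bar> powr p \<partial>N) \<longlonglongrightarrow> 0"
      "(\<lambda>k. \<integral>x. indicator V x * norm (Dv k x - G x) powr p \<partial>N) \<longlonglongrightarrow> 0"
    and F: "\<And>t. (F has_real_derivative F' t) (at t)" "continuous_on UNIV F'" "\<And>t. \<bar>F' t\<bar> \<le> 1" "F 0 = 0"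
    and \<eta>: "C1_grad UNIV \<eta> D\<eta>" "\<And>x. \<bar>\<eta> x\<bar> \<le> 1" "\<And>x. norm (D\<eta> x) \<le> L"
      "\<And>x. x \<notin> ball x0 (5 / 4 * R) \<Longrightarrow> \<eta> x = 0 \<and> D\<eta> x = 0"
  shows "sobolev0 p (\<lambda>x. \<eta> x * F (u x)) (\<lambda>x. (\<eta> x * F' (u x)) *\<^sub>R G x + F (u x) *\<^sub>R D\<eta> x)"
proof -
  note [measurable] = u(1,2)
  have mV [measurable]: "V \<in> sets N" using V by (intro borel_in_sets_N) auto
  have ballV: "x \<in> V" if "x \<in> ball x0 (5 / 4 * R)" for x
    using V that ball_subset_cball by blast
  have lip: "\<bar>F s - F t\<bar> \<le> \<bar>s - t\<bar>" for s t
  proof -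
    have "norm (F s - F t) \<le> 1 * norm (s - t)"
      by (rule field_differentiable_bound[of UNIV F F']) (use F in \<open>auto intro: has_field_derivative_at_within\<close>)
    then show ?thesis by simp
  qed
  have Fle: "\<bar>F t\<bar> \<le> \<bar>t\<bar>" for t using lip[of t 0] F(4) by simp
  have cF: "continuous_on UNIV F"
    by (meson DERIV_continuous F(1) continuous_at_imp_continuous_on)
  have [measurable]: "F \<in> borel_measurable borel" "F' \<in> borel_measurable borel"
    using cF F(2) by (auto intro: borel_measurable_continuous_onI)
  have c\<eta>: "continuous_on UNIV \<eta>" "continuous_on UNIV D\<eta>"
    using \<eta>(1) C1_grad_continuous_on[OF \<eta>(1)] unfolding C1_grad_def by auto
  have [measurable]: "\<eta> \<in> borel_measurable N" "D\<eta> \<in> borel_measurable N"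
    using c\<eta> continuous_measurable_N by auto
  have L: "0 \<le> L" using \<eta>(3)[of x0] norm_ge_zero order_trans by blast
  let ?\<phi> = "\<lambda>x. \<eta> x * F (u x)"
  let ?D = "\<lambda>x. (\<eta> x * F' (u x)) *\<^sub>R G x + F (u x) *\<^sub>R D\<eta> x"
  define \<psi> where "\<psi> k x = indicator V x * (\<eta> x * F (v k x))" for k x
  define D\<psi> where "D\<psi> k x = indicator V x *\<^sub>R ((\<eta> x * F' (v k x)) *\<^sub>R Dv k x + F (v k x) *\<^sub>R D\<eta> x)" for k x
  have C1\<psi>: "C1_grad UNIV (\<psi> k) (D\<psi> k)" for k
    unfolding \<psi>_def[abs_def] D\<psi>_def[abs_def]
    by (rule C1_grad_mult_compose[OF V(1) v(1) \<eta>(1) F(1,2) closed_cball V(2)]) (use \<eta>(4) in auto)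
  have supp: "\<psi> k x = 0 \<and> D\<psi> k x = 0" if "x \<notin> ball x0 (5 / 4 * R)" for k x
    unfolding \<psi>_def D\<psi>_def using \<eta>(4)[OF that] by simp
  have c\<psi>: "continuous_on UNIV (\<psi> k)" "continuous_on UNIV (D\<psi> k)" for k
    using C1\<psi>[of k] C1_grad_continuous_on[OF C1\<psi>[of k]] unfolding C1_grad_def by auto
  have [measurable]: "\<psi> k \<in> borel_measurable N" "D\<psi> k \<in> borel_measurable N" for k
    using c\<psi> continuous_measurable_N by auto
  have cv: "continuous_on V (v k)" "continuous_on V (Dv k)" for k
    using v(1)[of k] C1_grad_continuous_on[OF v(1)[of k]] unfolding C1_grad_def by auto
  have m\<phi> [measurable]: "?\<phi> \<in> borel_measurable N" "?D \<in> borel_measurable N" by measurable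
  have \<phi>le: "\<bar>?\<phi> x\<bar> \<le> \<bar>u x\<bar>" for x
    using mult_mono[OF \<eta>(2)[of x] Fle[of "u x"]] by (simp add: abs_mult)
  have int\<phi>: "integrable N (\<lambda>x. \<bar>?\<phi> x\<bar> powr p)"
    by (rule Bochner_Integration.integrable_bound[OF u(3)]) (use \<phi>le p in \<open>auto intro!: powr_mono2\<close>)
  have Dle: "norm (?D x) \<le> norm (G x) + L * \<bar>u x\<bar>" for x
  proof -
    have "norm (?D x) \<le> \<bar>\<eta> x * F' (u x)\<bar> * norm (G x) + \<bar>F (u x)\<bar> * norm (D\<eta> x)"
      by (rule order_trans[OF norm_triangle_ineq]) simp
    also have "\<dots> \<le> 1 * norm (G x) + \<bar>u x\<bar> * L"
      using mult_mono[OF \<eta>(2)[of x] F(3)[of "u x"]] \<eta>(3)[of x] Fle[of "u x"] L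
      by (intro add_mono mult_mono) (auto simp: abs_mult)
    finally show ?thesis by (simp add: mult.commute)
  qed
  have intD: "integrable N (\<lambda>x. norm (?D x) powr p)"
  proof (rule Bochner_Integration.integrable_bound)
    show "integrable N (\<lambda>x. 2 powr p * (norm (G x) powr p + L powr p * \<bar>u x\<bar> powr p))"
      using u by auto
    show "AE x in N. norm (norm (?D x) powr p) \<le> norm (2 powr p * (norm (G x) powr p + L powr p * \<bar>u x\<bar> powr p))"
    proof (rule AE_I2)
      fix x
      have "norm (?D x) powr p \<le> (norm (G x) + L * \<bar>u x\<bar>) powr p"
        using p Dle[of x] by (intro powr_mono2) auto
      also have "\<dots> \<le> 2 powr p * (norm (G x) powr p + (L * \<bar>u x\<bar>) powr p)"
        using p L by (intro powr_add_le) auto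
      also have "(L * \<bar>u x\<bar>) powr p = L powr p * \<bar>u x\<bar> powr p" using L by (simp add: powr_mult)
      finally show "norm (norm (?D x) powr p) \<le> norm (2 powr p * (norm (G x) powr p + L powr p * \<bar>u x\<bar> powr p))"
        by simp
    qed
  qed measurable
  have "(\<lambda>n. \<integral>x. norm (indicator V x * \<bar>v n x - u x\<bar> powr p) \<partial>N) \<longlonglongrightarrow> 0"
    using v(4) by (simp add: abs_mult)
  from tendsto_L1_AE_subseq[OF v(2) this] obtain s :: "nat \<Rightarrow> nat" where s: "strict_mono s"
    "AE x in N. (\<lambda>n. indicator V x * \<bar>v (s n) x - u x\<bar> powr p) \<longlonglongrightarrow> 0" by auto
  define e where "e n x = indicator V x * \<bar>v (s n) x - u x\<bar> powr p" for n x
  define e' where "e' n x = indicator V x * norm (Dv (s n) x - G x) powr p" for n x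
  define h where "h n x = (indicator V x * \<bar>F' (v (s n) x) - F' (u x)\<bar> * norm (G x)) powr p" for n x
  have ie: "integrable N (e n)" "integrable N (e' n)" for n
    unfolding e_def[abs_def] e'_def[abs_def] using v by auto
  \<comment> \<open>The approximants are continuous only on \<open>V\<close>, so measurability is
    available only after multiplication by the indicator.\<close>
  have mh [measurable]: "h n \<in> borel_measurable N" for n
  proof -
    have "(\<lambda>x. indicator V x *\<^sub>R F' (v (s n) x)) \<in> borel_measurable borel"
      using cv(1)[of "s n"] F(2) V(1)
      by (intro borel_measurable_continuous_on_indicator) (auto intro: continuous_on_compose2)
    then have [measurable]: "(\<lambda>x. indicator V x *\<^sub>R F' (v (s n) x)) \<in> borel_measurable N"
      by (rule borel_measurable_N)
    have "h n = (\<lambda>x. (\<bar>indicator V x *\<^sub>R F' (v (s n) x) - indicator V x *\<^sub>R F' (u x)\<bar> * norm (G x)) powr p)"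
      unfolding h_def by (auto simp: fun_eq_iff indicator_def)
    then show ?thesis by (simp only:) measurable
  qed
  have h_le: "h n x \<le> 2 powr p * norm (G x) powr p" for n x
  proof -
    have "indicator V x * \<bar>F' (v (s n) x) - F' (u x)\<bar> \<le> 1 * 2"
    proof (rule mult_mono)
      show "\<bar>F' (v (s n) x) - F' (u x)\<bar> \<le> 2"
        using F(3)[of "v (s n) x"] F(3)[of "u x"] by linarith
    qed (auto simp: indicator_def)
    then have "h n x \<le> (2 * norm (G x)) powr p"
      unfolding h_def using p by (intro powr_mono2 mult_right_mono) auto
    then show ?thesis by (simp add: powr_mult)
  qed
  have ih: "integrable N (h n)" for n
    by (rule Bochner_Integration.integrable_bound[of N "\<lambda>x. 2 powr p * norm (G x) powr p"])
      (use u h_le in \<open>auto simp: h_def\<close>)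
  have lim_h: "(\<lambda>n. \<integral>x. h n x \<partial>N) \<longlonglongrightarrow> (\<integral>x. 0 \<partial>N)"
  proof (rule integral_dominated_convergence)
    show "integrable N (\<lambda>x. 2 powr p * norm (G x) powr p)" using u by auto
    show "AE x in N. norm (h n x) \<le> 2 powr p * norm (G x) powr p" for n
      using h_le[of n] by (auto simp: h_def)
    show "AE x in N. (\<lambda>n. h n x) \<longlonglongrightarrow> 0"
      using s(2)
    proof eventually_elim
      case (elim x)
      show ?case
      proof (cases "x \<in> V")
        case True
        then have el: "(\<lambda>n. \<bar>v (s n) x - u x\<bar> powr p) \<longlonglongrightarrow> 0" using elim by simp
        have "(\<lambda>n. (\<bar>v (s n) x - u x\<bar> powr p) powr (1 / p)) \<longlonglongrightarrow> 0 powr (1 / p)"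
          using p by (intro tendsto_powr' el tendsto_const) auto
        then have "(\<lambda>n. v (s n) x - u x) \<longlonglongrightarrow> 0"
          using p by (simp add: powr_powr tendsto_rabs_zero_iff)
        then have "(\<lambda>n. v (s n) x) \<longlonglongrightarrow> u x" by (simp add: LIM_zero_iff)
        then have "(\<lambda>n. F' (v (s n) x)) \<longlonglongrightarrow> F' (u x)"
          using F(2) by (intro isCont_tendsto_compose[of "u x" F']) (auto simp: continuous_on_eq_continuous_at)
        then have "(\<lambda>n. (\<bar>F' (v (s n) x) - F' (u x)\<bar> * norm (G x)) powr p) \<longlonglongrightarrow> (\<bar>F' (u x) - F' (u x)\<bar> * norm (G x)) powr p"
          using p by (intro tendsto_powr' tendsto_intros) auto
        then show ?thesis unfolding h_def using True by simp
      qed (simp add: h_def)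
    qed
  qed measurable
  have lim1: "(\<lambda>n. \<integral>x. \<bar>\<psi> (s n) x - ?\<phi> x\<bar> powr p \<partial>N) \<longlonglongrightarrow> 0"
  proof (rule tendsto_sandwich[OF _ _ tendsto_const])
    show "\<forall>\<^sub>F n in sequentially. (\<integral>x. \<bar>\<psi> (s n) x - ?\<phi> x\<bar> powr p \<partial>N) \<le> (\<integral>x. e n x \<partial>N)"
    proof (intro always_eventually allI)
      fix n
      have "\<bar>\<psi> (s n) x - ?\<phi> x\<bar> powr p \<le> e n x" for x
      proof (cases "x \<in> V")
        case True
        have "\<bar>\<psi> (s n) x - ?\<phi> x\<bar> = \<bar>\<eta> x\<bar> * \<bar>F (v (s n) x) - F (u x)\<bar>"
          unfolding \<psi>_def using True by (simp add: abs_mult[symmetric] right_diff_distrib)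
        also have "\<dots> \<le> 1 * \<bar>v (s n) x - u x\<bar>" by (intro mult_mono \<eta>(2) lip) auto
        finally show ?thesis unfolding e_def using True p by (auto intro!: powr_mono2)
      next
        case False
        then show ?thesis unfolding e_def \<psi>_def using ballV \<eta>(4)[of x] by auto
      qed
      moreover have "integrable N (\<lambda>x. norm (\<psi> (s n) x - ?\<phi> x) powr p)"
      proof (rule integrable_powr_diff)
        show "integrable N (\<lambda>x. norm (\<psi> (s n) x) powr p)"
          by (rule integrable_powr_compact_support[OF c\<psi>(1), where r = "5 / 4 * R"]) (use supp p in auto)
      qed (use int\<phi> p in auto)
      ultimately show "(\<integral>x. \<bar>\<psi> (s n) x - ?\<phi> x\<bar> powr p \<partial>N) \<le> (\<integral>x. e n x \<partial>N)"
        by (intro integral_mono ie) auto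
    qed
    show "(\<lambda>n. \<integral>x. e n x \<partial>N) \<longlonglongrightarrow> 0"
      unfolding e_def using LIMSEQ_subseq_LIMSEQ[OF v(4) s(1)] by (simp add: o_def)
  qed auto
  have tri: "norm (a + b + c) \<le> norm a + norm b + norm c" for a b c :: 'n
    using norm_triangle_ineq[of "a + b" c] norm_triangle_ineq[of a b] by linarith
  have lim2: "(\<lambda>n. \<integral>x. norm (D\<psi> (s n) x - ?D x) powr p \<partial>N) \<longlonglongrightarrow> 0"
  proof (rule tendsto_sandwich[OF _ _ tendsto_const])
    show "\<forall>\<^sub>F n in sequentially. (\<integral>x. norm (D\<psi> (s n) x - ?D x) powr p \<partial>N)
      \<le> 2 powr p * (\<integral>x. e' n x \<partial>N) + 2 powr p * 2 powr p * ((\<integral>x. h n x \<partial>N) + L powr p * (\<integral>x. e n x \<partial>N))"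
    proof (intro always_eventually allI)
      fix n
      let ?r = "\<lambda>x. 2 powr p * e' n x + 2 powr p * 2 powr p * (h n x + L powr p * e n x)"
      have "norm (D\<psi> (s n) x - ?D x) powr p \<le> ?r x" for x
      proof (cases "x \<in> V")
        case True
        have "D\<psi> (s n) x - ?D x = (\<eta> x * F' (v (s n) x)) *\<^sub>R (Dv (s n) x - G x)
          + (\<eta> x * (F' (v (s n) x) - F' (u x))) *\<^sub>R G x + (F (v (s n) x) - F (u x)) *\<^sub>R D\<eta> x"
          unfolding D\<psi>_def using True by (simp add: algebra_simps)
        also have "norm \<dots> \<le> \<bar>\<eta> x * F' (v (s n) x)\<bar> * norm (Dv (s n) x - G x)
          + \<bar>\<eta> x * (F' (v (s n) x) - F' (u x))\<bar> * norm (G x) + \<bar>F (v (s n) x) - F (u x)\<bar> * norm (D\<eta> x)"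
          by (rule order_trans[OF tri]) simp
        also have "\<dots> \<le> 1 * norm (Dv (s n) x - G x) + \<bar>F' (v (s n) x) - F' (u x)\<bar> * norm (G x) + \<bar>v (s n) x - u x\<bar> * L"
        proof -
          have 1: "\<bar>\<eta> x * F' (v (s n) x)\<bar> \<le> 1"
            using mult_mono[OF \<eta>(2)[of x] F(3)[of "v (s n) x"]] by (simp add: abs_mult)
          have 2: "\<bar>\<eta> x * (F' (v (s n) x) - F' (u x))\<bar> \<le> \<bar>F' (v (s n) x) - F' (u x)\<bar>"
            using mult_right_mono[OF \<eta>(2)[of x], of "\<bar>F' (v (s n) x) - F' (u x)\<bar>"] by (simp add: abs_mult)
          have 3: "\<bar>F (v (s n) x) - F (u x)\<bar> * norm (D\<eta> x) \<le> \<bar>v (s n) x - u x\<bar> * L"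
            by (rule mult_mono[OF lip \<eta>(3)]) auto
          show ?thesis
            using mult_right_mono[OF 1 norm_ge_zero] mult_right_mono[OF 2 norm_ge_zero] 3
            by (intro add_mono) blast+
        qed
        finally have "norm (D\<psi> (s n) x - ?D x) powr p
          \<le> (norm (Dv (s n) x - G x) + (\<bar>F' (v (s n) x) - F' (u x)\<bar> * norm (G x) + L * \<bar>v (s n) x - u x\<bar>)) powr p"
          using p by (intro powr_mono2) (auto simp: algebra_simps)
        also have "\<dots> \<le> 2 powr p * (norm (Dv (s n) x - G x) powr p + (\<bar>F' (v (s n) x) - F' (u x)\<bar> * norm (G x) + L * \<bar>v (s n) x - u x\<bar>) powr p)"
          using p L by (intro powr_add_le) auto
        also have "\<dots> \<le> 2 powr p * (norm (Dv (s n) x - G x) powr p + 2 powr p * ((\<bar>F' (v (s n) x) - F' (u x)\<bar> * norm (G x)) powr p + (L * \<bar>v (s n) x - u x\<bar>) powr p))"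
          using p L by (intro mult_left_mono add_left_mono powr_add_le) auto
        also have "\<dots> = ?r x"
          unfolding e_def e'_def h_def using True L by (simp add: powr_mult distrib_left)
        finally show ?thesis .
      next
        case False
        then have "\<eta> x = 0 \<and> D\<eta> x = 0" using ballV \<eta>(4)[of x] by blast
        then have "D\<psi> (s n) x - ?D x = 0" unfolding D\<psi>_def by simp
        then show ?thesis unfolding e_def e'_def h_def using False by simp
      qed
      moreover have "integrable N (\<lambda>x. norm (D\<psi> (s n) x - ?D x) powr p)"
      proof (rule integrable_powr_diff)
        show "integrable N (\<lambda>x. norm (D\<psi> (s n) x) powr p)"
          by (rule integrable_powr_compact_support[OF c\<psi>(2), where r = "5 / 4 * R"]) (use supp p in auto)
      qed (use intD p in auto)
      ultimately have "(\<integral>x. norm (D\<psi> (s n) x - ?D x) powr p \<partial>N) \<le> (\<integral>x. ?r x \<partial>N)"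
        using ie ih by (intro integral_mono) auto
      also have "\<dots> = 2 powr p * (\<integral>x. e' n x \<partial>N) + 2 powr p * 2 powr p * ((\<integral>x. h n x \<partial>N) + L powr p * (\<integral>x. e n x \<partial>N))"
        using ie ih by simp
      finally show "(\<integral>x. norm (D\<psi> (s n) x - ?D x) powr p \<partial>N)
        \<le> 2 powr p * (\<integral>x. e' n x \<partial>N) + 2 powr p * 2 powr p * ((\<integral>x. h n x \<partial>N) + L powr p * (\<integral>x. e n x \<partial>N))" .
    qed
    have 1: "(\<lambda>n. \<integral>x. e n x \<partial>N) \<longlonglongrightarrow> 0" "(\<lambda>n. \<integral>x. e' n x \<partial>N) \<longlonglongrightarrow> 0"
      unfolding e_def e'_def using LIMSEQ_subseq_LIMSEQ[OF v(4) s(1)] LIMSEQ_subseq_LIMSEQ[OF v(5) s(1)]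
      by (simp_all add: o_def)
    have "(\<lambda>n. 2 powr p * (\<integral>x. e' n x \<partial>N) + 2 powr p * 2 powr p * ((\<integral>x. h n x \<partial>N) + L powr p * (\<integral>x. e n x \<partial>N)))
      \<longlonglongrightarrow> 2 powr p * 0 + 2 powr p * 2 powr p * ((\<integral>x. 0 \<partial>N) + L powr p * 0)"
      by (intro tendsto_intros 1 lim_h)
    then show "(\<lambda>n. 2 powr p * (\<integral>x. e' n x \<partial>N) + 2 powr p * 2 powr p * ((\<integral>x. h n x \<partial>N) + L powr p * (\<integral>x. e n x \<partial>N))) \<longlonglongrightarrow> 0"
      by simp
  qed auto
  show ?thesis
    unfolding sobolev0_def
  proof (intro conjI)
    show "\<exists>v Dv. (\<forall>k. C1_grad UNIV (v k) (Dv k) \<and> (\<forall>x. x \<notin> ball x0 (5 / 4 * R) \<longrightarrow> v k x = 0 \<and> Dv k x = 0)) \<and>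
        (\<lambda>k. \<integral>x. \<bar>v k x - ?\<phi> x\<bar> powr p \<partial>N) \<longlonglongrightarrow> 0 \<and>
        (\<lambda>k. \<integral>x. norm (Dv k x - ?D x) powr p \<partial>N) \<longlonglongrightarrow> 0"
      using C1\<psi> supp lim1 lim2 by (intro exI[of _ "\<lambda>n. \<psi> (s n)"] exI[of _ "\<lambda>n. D\<psi> (s n)"]) auto
  qed (use m\<phi> int\<phi> intD in auto)
qed

end

section \<open>Truncations, cutoffs and the pointwise energy estimate\<close>

text \<open>\<open>ramp \<delta>\<close> is a \<open>C\<^sup>1\<close> version of the positive part with \<open>ramp \<delta> r \<le> ramp' \<delta> r * r\<close>. Thanks to this
  inequality every term of the tested equation carries the factor \<open>ramp'\<close> and the estimates hold for fixed
  \<open>\<delta>\<close>, without a passage to the limit \<open>\<delta> \<rightarrow> 0\<close>.\<close>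

definition ramp :: "real \<Rightarrow> real \<Rightarrow> real" where
  "ramp \<delta> r = (max 0 r)\<^sup>2 / (max 0 r + \<delta>)"

definition ramp' :: "real \<Rightarrow> real \<Rightarrow> real" where
  "ramp' \<delta> r = 1 - \<delta>\<^sup>2 / (max 0 r + \<delta>)\<^sup>2"

text \<open>Settles the junction point of functions that vanish on the left and grow at most
  quadratically on the right.\<close>

lemma DERIV_zero_at_zero:
  fixes f :: "real \<Rightarrow> real"
  assumes "f 0 = 0" "\<And>h. \<bar>h\<bar> \<le> 1 \<Longrightarrow> \<bar>f h\<bar> \<le> C * h\<^sup>2"
  shows "(f has_real_derivative 0) (at 0)"
proof -
  have "((\<lambda>h. (f h - f 0) / (h - 0)) \<longlongrightarrow> 0) (at 0)"
  proof (rule Lim_null_comparison)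
    show "\<forall>\<^sub>F h in at 0. norm ((f h - f 0) / (h - 0)) \<le> C * \<bar>h\<bar>"
    proof (rule eventually_at_le[THEN iffD2], intro exI[of _ 1] conjI ballI impI)
      fix h :: real assume "h \<noteq> 0 \<and> dist h 0 \<le> 1"
      then have h: "h \<noteq> 0" "\<bar>h\<bar> \<le> 1" by auto
      have "\<bar>f h\<bar> \<le> (C * \<bar>h\<bar>) * \<bar>h\<bar>"
        using assms(2)[OF h(2)] by (simp add: power2_eq_square mult.assoc)
      then have "\<bar>f h\<bar> / \<bar>h\<bar> \<le> C * \<bar>h\<bar>"
        using h by (simp add: pos_divide_le_eq)
      then show "norm ((f h - f 0) / (h - 0)) \<le> C * \<bar>h\<bar>"
        using assms(1) by (simp add: abs_divide)
    qed auto
    have "((\<lambda>h. C * \<bar>h\<bar>) \<longlongrightarrow> C * \<bar>0\<bar>) (at 0)" by (intro tendsto_intros)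
    then show "((\<lambda>h. C * \<bar>h\<bar>) \<longlongrightarrow> 0) (at 0)" by simp
  qed
  then show ?thesis by (simp add: has_field_derivative_iff)
qed

lemma ramp_derivative:
  assumes "0 < \<delta>"
  shows "(ramp \<delta> has_real_derivative ramp' \<delta> r) (at r)"
proof -
  consider "r < 0" | "r = 0" | "0 < r" by linarith
  then show ?thesis
  proof cases
    case 1
    have "((\<lambda>_. 0) has_real_derivative ramp' \<delta> r) (at r)"
      using 1 assms by (simp add: ramp'_def)
    then show ?thesis
      by (rule has_field_derivative_transform_within_open[of _ _ _ "{..<0}"]) (use 1 in \<open>auto simp: ramp_def\<close>)
  next
    case 2
    have "(ramp \<delta> has_real_derivative 0) (at 0)"
    proof (rule DERIV_zero_at_zero)
      fix h :: real
      have "(max 0 h)\<^sup>2 / (max 0 h + \<delta>) \<le> h\<^sup>2 / \<delta>"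
        using assms by (intro frac_le) (auto simp: max_def)
      then show "\<bar>ramp \<delta> h\<bar> \<le> (1 / \<delta>) * h\<^sup>2"
        using assms by (simp add: ramp_def abs_of_nonneg)
    qed (simp add: ramp_def)
    then show ?thesis using 2 assms by (simp add: ramp'_def)
  next
    case 3
    have "((\<lambda>r. r\<^sup>2 / (r + \<delta>)) has_real_derivative ramp' \<delta> r) (at r)"
    proof -
      define q where "q = r + \<delta>"
      have q: "0 < q" using 3 assms by (simp add: q_def)
      have "((\<lambda>r. r\<^sup>2 / (r + \<delta>)) has_real_derivative (2 * r * q - r\<^sup>2) / q\<^sup>2) (at r)"
        using q by (auto intro!: derivative_eq_intros simp: q_def power2_eq_square)
      also have "2 * r * q - r\<^sup>2 = q\<^sup>2 - \<delta>\<^sup>2" by (simp add: q_def power2_eq_square algebra_simps)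
      also have "(q\<^sup>2 - \<delta>\<^sup>2) / q\<^sup>2 = ramp' \<delta> r" using q 3 by (simp add: ramp'_def q_def diff_divide_distrib)
      finally show ?thesis .
    qed
    then show ?thesis
      by (rule has_field_derivative_transform_within_open[of _ _ _ "{0<..}"]) (use 3 in \<open>auto simp: ramp_def\<close>)
  qed
qed

lemma ramp'_bounds:
  assumes "0 < \<delta>"
  shows "0 \<le> ramp' \<delta> r" "ramp' \<delta> r \<le> 1"
proof -
  have "\<delta>\<^sup>2 \<le> (max 0 r + \<delta>)\<^sup>2" using assms by (intro power_mono) auto
  moreover have "0 < (max 0 r + \<delta>)\<^sup>2" using assms by (intro zero_less_power) auto
  ultimately show "0 \<le> ramp' \<delta> r" "ramp' \<delta> r \<le> 1"
    by (simp_all add: ramp'_def)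
qed

lemma ramp_nonpos: "r \<le> 0 \<Longrightarrow> ramp \<delta> r = 0" "r \<le> 0 \<Longrightarrow> 0 < \<delta> \<Longrightarrow> ramp' \<delta> r = 0"
  by (auto simp: ramp_def ramp'_def)

lemma ramp_nonneg: "0 < \<delta> \<Longrightarrow> 0 \<le> ramp \<delta> r"
  by (auto simp: ramp_def)

lemma ramp_le_ramp': "0 < \<delta> \<Longrightarrow> 0 < r \<Longrightarrow> ramp \<delta> r \<le> ramp' \<delta> r * r"
proof -
  assume *: "0 < \<delta>" "0 < r"
  have "ramp' \<delta> r * r - ramp \<delta> r = r\<^sup>2 * \<delta> / (r + \<delta>)\<^sup>2"
  proof -
    define q where "q = r + \<delta>"
    have q: "0 < q" using * by (simp add: q_def)
    have "ramp' \<delta> r * r - ramp \<delta> r = (1 - \<delta>\<^sup>2 / q\<^sup>2) * r - r\<^sup>2 / q"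
      using * by (simp add: ramp_def ramp'_def q_def)
    also have "\<dots> = (q\<^sup>2 * r - \<delta>\<^sup>2 * r - r\<^sup>2 * q) / q\<^sup>2"
      using q by (simp add: field_simps power2_eq_square)
    also have "q\<^sup>2 * r - \<delta>\<^sup>2 * r - r\<^sup>2 * q = r\<^sup>2 * \<delta>"
      by (simp add: q_def power2_eq_square algebra_simps)
    finally show ?thesis by (simp add: q_def)
  qed
  moreover have "0 \<le> r\<^sup>2 * \<delta> / (r + \<delta>)\<^sup>2" using * by simp
  ultimately show ?thesis by linarith
qed

lemma ramp_ge_half: "0 < \<delta> \<Longrightarrow> \<delta> \<le> r \<Longrightarrow> r / 2 \<le> ramp \<delta> r"
  by (simp add: ramp_def field_simps power2_eq_square)

lemma le_ramp: "0 < \<delta> \<Longrightarrow> r \<le> 2 * ramp \<delta> r + \<delta>"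
  using ramp_ge_half[of \<delta> r] ramp_nonneg[of \<delta> r] by (cases "\<delta> \<le> r") auto

lemma ramp_le: "0 < \<delta> \<Longrightarrow> 0 \<le> r \<Longrightarrow> ramp \<delta> r \<le> r"
  by (simp add: ramp_def field_simps power2_eq_square)

section \<open>Two-sided truncations\<close>

definition trunc :: "real \<Rightarrow> real \<Rightarrow> real \<Rightarrow> real" where
  "trunc k \<delta> t = ramp \<delta> (t - k) - ramp \<delta> (- t - k)"

definition trunc' :: "real \<Rightarrow> real \<Rightarrow> real \<Rightarrow> real" where
  "trunc' k \<delta> t = ramp' \<delta> (t - k) + ramp' \<delta> (- t - k)"

lemma trunc_derivative: "0 < \<delta> \<Longrightarrow> (trunc k \<delta> has_real_derivative trunc' k \<delta> t) (at t)"
proof -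
  assume d: "0 < \<delta>"
  have 1: "((\<lambda>t. t - k) has_real_derivative 1) (at t)" "((\<lambda>t. - t - k) has_real_derivative -1) (at t)"
    by (auto intro!: derivative_eq_intros)
  have "((\<lambda>t. ramp \<delta> (t - k) - ramp \<delta> (- t - k)) has_real_derivative (ramp' \<delta> (t - k) * 1 - ramp' \<delta> (- t - k) * -1)) (at t)"
    by (intro DERIV_diff DERIV_chain2[OF ramp_derivative[OF d]] 1)
  then show ?thesis by (simp add: trunc_def[abs_def] trunc'_def)
qed

lemma trunc'_continuous: "0 < \<delta> \<Longrightarrow> continuous_on UNIV (trunc' k \<delta>)"
proof -
  assume d: "0 < \<delta>"
  have "max 0 r + \<delta> \<noteq> 0" for r :: real using d by (simp add: max_def)
  then show ?thesis unfolding trunc'_def[abs_def] ramp'_def by (intro continuous_intros) auto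
qed

lemma trunc_below: "0 < \<delta> \<Longrightarrow> \<bar>t\<bar> \<le> k \<Longrightarrow> trunc k \<delta> t = 0 \<and> trunc' k \<delta> t = 0"
  by (simp add: trunc_def trunc'_def ramp_nonpos)

lemma trunc_above:
  assumes "0 < \<delta>" "0 \<le> k" "k < \<bar>t\<bar>"
  shows "\<bar>trunc k \<delta> t\<bar> = ramp \<delta> (\<bar>t\<bar> - k)" "trunc' k \<delta> t = ramp' \<delta> (\<bar>t\<bar> - k)"
proof -
  have "\<bar>trunc k \<delta> t\<bar> = ramp \<delta> (\<bar>t\<bar> - k) \<and> trunc' k \<delta> t = ramp' \<delta> (\<bar>t\<bar> - k)"
  proof (cases "0 \<le> t")
    case True
    then have "ramp \<delta> (- t - k) = 0" "ramp' \<delta> (- t - k) = 0" using assms by (auto intro!: ramp_nonpos)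
    then show ?thesis using True assms ramp_nonneg[of \<delta> "t - k"] by (simp add: trunc_def trunc'_def)
  next
    case False
    then have "ramp \<delta> (t - k) = 0" "ramp' \<delta> (t - k) = 0" using assms by (auto intro!: ramp_nonpos)
    then show ?thesis using False assms ramp_nonneg[of \<delta> "- t - k"] by (simp add: trunc_def trunc'_def)
  qed
  then show "\<bar>trunc k \<delta> t\<bar> = ramp \<delta> (\<bar>t\<bar> - k)" "trunc' k \<delta> t = ramp' \<delta> (\<bar>t\<bar> - k)" by auto
qed

lemma trunc'_bounds:
  assumes "0 < \<delta>" "0 \<le> k"
  shows "0 \<le> trunc' k \<delta> t" "trunc' k \<delta> t \<le> 1"
proof -
  have "0 \<le> trunc' k \<delta> t \<and> trunc' k \<delta> t \<le> 1"
  proof (cases "k < \<bar>t\<bar>")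
    case True
    show ?thesis unfolding trunc_above(2)[OF assms True] using ramp'_bounds[OF assms(1)] by blast
  qed (use trunc_below[OF assms(1), of t k] in auto)
  then show "0 \<le> trunc' k \<delta> t" "trunc' k \<delta> t \<le> 1" by auto
qed

lemma abs_trunc_le:
  assumes "0 < \<delta>" "0 \<le> k" "k < \<bar>t\<bar>"
  shows "\<bar>trunc k \<delta> t\<bar> \<le> trunc' k \<delta> t * (\<bar>t\<bar> - k)"
  unfolding trunc_above[OF assms] using assms by (intro ramp_le_ramp') auto

lemma abs_trunc_le_abs:
  assumes "0 < \<delta>" "0 \<le> k"
  shows "\<bar>trunc k \<delta> t\<bar> \<le> \<bar>t\<bar>"
proof (cases "k < \<bar>t\<bar>")
  case True
  show ?thesis unfolding trunc_above[OF assms True]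
    using ramp_le[OF assms(1), of "\<bar>t\<bar> - k"] True assms by simp
qed (use trunc_below[OF assms(1)] in auto)

lemma abs_trunc_ge:
  assumes "0 < \<delta>" "0 \<le> k" "k + \<delta> \<le> \<bar>t\<bar>"
  shows "(\<bar>t\<bar> - k) / 2 \<le> \<bar>trunc k \<delta> t\<bar>"
  using trunc_above(1)[of \<delta> k t] ramp_ge_half[of \<delta> "\<bar>t\<bar> - k"] assms by auto

lemma abs_le_trunc:
  assumes "0 < \<delta>" "0 \<le> k"
  shows "\<bar>t\<bar> \<le> k + \<delta> + 2 * \<bar>trunc k \<delta> t\<bar>"
  using trunc_above(1)[OF assms, of t] le_ramp[OF assms(1), of "\<bar>t\<bar> - k"] assms by (cases "k < \<bar>t\<bar>") auto

section \<open>Powers of a radial cutoff\<close>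

lemma DERIV_max_power:
  assumes "2 \<le> n"
  shows "((\<lambda>s. max 0 s ^ n) has_real_derivative real n * max 0 s ^ (n - 1)) (at s)"
proof -
  consider "s < 0" | "s = 0" | "0 < s" by linarith
  then show ?thesis
  proof cases
    case 1
    have "((\<lambda>_. 0) has_real_derivative real n * max 0 s ^ (n - 1)) (at s)"
      using 1 assms by (simp add: zero_power)
    then show ?thesis
      by (rule has_field_derivative_transform_within_open[of _ _ _ "{..<0}"]) (use 1 assms in auto)
  next
    case 2
    have "((\<lambda>s. max 0 s ^ n) has_real_derivative 0) (at 0)"
    proof (rule DERIV_zero_at_zero)
      fix h :: real assume h: "\<bar>h\<bar> \<le> 1"
      have "max 0 h ^ n \<le> max 0 h ^ 2"
        using assms h by (intro power_decreasing) auto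
      also have "\<dots> \<le> h\<^sup>2" by (simp add: max_def)
      finally show "\<bar>max 0 h ^ n\<bar> \<le> 1 * h\<^sup>2" by simp
    qed (use assms in auto)
    then show ?thesis using 2 assms by (simp add: zero_power)
  next
    case 3
    have "((\<lambda>s. s ^ n) has_real_derivative real n * max 0 s ^ (n - 1)) (at s)"
      using 3 by (auto intro!: derivative_eq_intros)
    then show ?thesis
      by (rule has_field_derivative_transform_within_open[of _ _ _ "{0<..}"]) (use 3 in auto)
  qed
qed

text \<open>Not a plateau function: on \<open>ball x0 s\<close> with \<open>s < r\<close> it is merely at least \<open>(r - s) / r\<close>. In the iteration
  this costs a factor geometric in the step.\<close>

definition cutoff :: "'n::euclidean_space \<Rightarrow> real \<Rightarrow> 'n \<Rightarrow> real" where
  "cutoff x0 r x = max 0 (1 - (norm (x - x0) / r)\<^sup>2)"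

text \<open>This is the gradient of the power \<open>cutoff x0 r x ^ n\<close>, which is
  \<open>C^1\<close> for \<open>n \<ge> 2\<close>, whereas the cutoff itself has a kink on the
  sphere of radius \<open>r\<close>. The square of the norm keeps the centre smooth.\<close>

definition cutoff_grad :: "'n::euclidean_space \<Rightarrow> real \<Rightarrow> nat \<Rightarrow> 'n \<Rightarrow> 'n" where
  "cutoff_grad x0 r n x = (real n * cutoff x0 r x ^ (n - 1) * (- 2 / r\<^sup>2)) *\<^sub>R (x - x0)"

lemma cutoff_bounds: "0 \<le> cutoff x0 r x" "cutoff x0 r x \<le> 1"
  by (auto simp: cutoff_def)

lemma cutoff_outside: "0 < r \<Longrightarrow> x \<notin> ball x0 r \<Longrightarrow> cutoff x0 r x = 0"
proof -
  assume "0 < r" "x \<notin> ball x0 r"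
  then have "1 \<le> norm (x - x0) / r" by (simp add: dist_norm norm_minus_commute)
  then have "1 \<le> (norm (x - x0) / r)\<^sup>2" by (simp add: one_le_power)
  then show ?thesis by (simp add: cutoff_def)
qed

lemma cutoff_ge:
  assumes r: "0 < r" "norm (x - x0) \<le> s" "s \<le> r"
  shows "(r - s) / r \<le> cutoff x0 r x"
proof -
  have "norm (x - x0) / r \<le> s / r" using r by (simp add: divide_right_mono)
  moreover have "norm (x - x0) / r \<le> 1" using r by simp
  ultimately have "(norm (x - x0) / r) * (norm (x - x0) / r) \<le> s / r * 1"
    using r order_trans[OF norm_ge_zero r(2)] by (intro mult_mono) auto
  then show ?thesis using r by (simp add: cutoff_def power2_eq_square diff_divide_distrib)
qed

lemma C1_grad_cutoff:
  assumes n: "2 \<le> n" and r: "0 < r"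
  shows "C1_grad UNIV (\<lambda>x. cutoff x0 r x ^ n) (cutoff_grad x0 r n)"
  unfolding C1_grad_def
proof (intro conjI ballI)
  fix x :: 'a
  define c where "c = 1 / r\<^sup>2"
  have 1: "((\<lambda>x. 1 - c * ((x - x0) \<bullet> (x - x0))) has_derivative (\<lambda>h. - (c * (2 * ((x - x0) \<bullet> h))))) (at x)"
    by (auto intro!: derivative_eq_intros simp: fun_eq_iff inner_commute)
  have e: "(norm (x - x0) / r)\<^sup>2 = c * ((x - x0) \<bullet> (x - x0))" for x
    by (simp add: power_divide power2_norm_eq_inner c_def)
  have "((\<lambda>x. (\<lambda>s. max 0 s ^ n) (1 - c * ((x - x0) \<bullet> (x - x0)))) has_derivative
      (\<lambda>h. real n * max 0 (1 - c * ((x - x0) \<bullet> (x - x0))) ^ (n - 1) * (- (c * (2 * ((x - x0) \<bullet> h)))))) (at x)"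
    by (rule has_derivative_compose[OF 1])
      (use DERIV_max_power[OF n] in \<open>simp add: has_field_derivative_def\<close>)
  then show "((\<lambda>x. cutoff x0 r x ^ n) has_derivative (\<lambda>h. cutoff_grad x0 r n x \<bullet> h)) (at x)"
    unfolding cutoff_def cutoff_grad_def e
    by (rule has_derivative_eq_rhs) (simp add: fun_eq_iff c_def)
next
  have "cutoff_grad x0 r n = (\<lambda>x. (real n * max 0 (1 - (norm (x - x0) / r)\<^sup>2) ^ (n - 1) * (- 2 / r\<^sup>2)) *\<^sub>R (x - x0))"
    by (simp add: fun_eq_iff cutoff_grad_def cutoff_def)
  moreover have "continuous_on UNIV (\<lambda>x. (real n * max 0 (1 - (norm (x - x0) / r)\<^sup>2) ^ (n - 1) * (- 2 / r\<^sup>2)) *\<^sub>R (x - x0))"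
    using r by (intro continuous_intros) auto
  ultimately show "continuous_on UNIV (cutoff_grad x0 r n)" by simp
qed

lemma norm_cutoff_grad_le:
  assumes n: "2 \<le> n" and r: "0 < r"
  shows "norm (cutoff_grad x0 r n x) \<le> real n * cutoff x0 r x ^ (n - 1) * (2 / r)"
proof (cases "x \<in> ball x0 r")
  case True
  then have x: "norm (x - x0) \<le> r" by (simp add: dist_norm norm_minus_commute)
  have "norm (cutoff_grad x0 r n x) = real n * cutoff x0 r x ^ (n - 1) * (2 / r\<^sup>2) * norm (x - x0)"
    unfolding cutoff_grad_def using r cutoff_bounds[of x0 r x] by (simp add: abs_mult)
  also have "\<dots> \<le> real n * cutoff x0 r x ^ (n - 1) * (2 / r\<^sup>2) * r"
    using x cutoff_bounds[of x0 r x] by (intro mult_left_mono) auto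
  also have "\<dots> = real n * cutoff x0 r x ^ (n - 1) * (2 / r)"
    using r by (simp add: power2_eq_square)
  finally show ?thesis .
next
  case False
  then have "cutoff x0 r x = 0" by (rule cutoff_outside[OF r])
  then show ?thesis using n by (simp add: cutoff_grad_def zero_power)
qed

text \<open>Young's inequality by comparing \<open>y\<close> with \<open>4 * X\<close>. The weight
  \<open>1 / 4\<close> is chosen because \<open>energy_pointwise\<close> applies it twice, to the
  cutoff derivative and to the coefficient \<open>c\<close>, and has to keep half of the gradient
  term.\<close>

lemma young_split:
  fixes X y p :: real
  assumes "0 \<le> X" "0 \<le> y" "1 < p"
  shows "X * y powr (p - 1) \<le> y powr p / 4 + 4 powr p * X powr p"
proof (cases "y \<le> 4 * X")
  case True
  have "X * y powr (p - 1) \<le> (4 * X) * (4 * X) powr (p - 1)"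
    using assms True by (intro mult_mono powr_mono2) auto
  also have "\<dots> = (4 * X) powr p"
    using powr_mult_base[of "4 * X" "p - 1"] assms by simp
  also have "\<dots> = 4 powr p * X powr p" using assms by (simp add: powr_mult)
  finally show ?thesis using powr_ge_zero[of y p] by linarith
next
  case False
  then have "X * y powr (p - 1) \<le> (y / 4) * y powr (p - 1)"
    by (intro mult_right_mono) auto
  also have "\<dots> = y powr p / 4" using powr_mult_base[OF assms(2), of "p - 1"] by simp
  finally show ?thesis by (simp add: add_increasing2)
qed

text \<open>All lower-order contributions of the structure conditions, with the gradient powers absorbed,
  collapse to one coefficient in front of \<open>|u|^p\<close> because \<open>|u| > K / 4\<close> where the truncation is active.\<close>

definition coef :: "real \<Rightarrow> real \<Rightarrow> real \<Rightarrow> real \<Rightarrow> real \<Rightarrow> real \<Rightarrow> real \<Rightarrow> real \<Rightarrow> real \<Rightarrow> real" where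
  "coef p R K b c d e f g = 1 + R powr (p - 1) * b + (R * c) powr p + R powr p * d
     + R powr (p - 1) * e / K powr (p - 1) + R powr p * f / K powr (p - 1) + R powr p * g / K powr p"

text \<open>To be read with \<open>T = |u|\<close>, \<open>n\<close> the norm of the gradient, and
  \<open>F\<close>, \<open>F'\<close> the modulus of the truncation and its derivative. The bound
  \<open>F \<le> F' * (T - k)\<close> puts the factor \<open>F'\<close> on every term, so that the
  gradient powers are absorbed by \<open>F' * \<eta> ^ m * n powr p\<close>; only afterwards
  \<open>F' \<le> 1\<close> removes it from the error.\<close>

lemma energy_pointwise:
  fixes T n b c d e f g k K R F F' \<eta> p :: real and m :: nat
  assumes p: "1 < p" and m: "1 \<le> m" and R: "0 < R" and K: "0 < K" "K / 4 \<le> k" and T: "k < T"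
    and \<eta>: "0 < \<eta>" "\<eta> \<le> 1" and F': "0 \<le> F'" "F' \<le> 1" and F: "0 \<le> F" "F \<le> F' * (T - k)"
    and n: "0 \<le> n" and co: "0 \<le> b" "0 \<le> c" "0 \<le> d" "0 \<le> e" "0 \<le> f" "0 \<le> g"
  shows "F' * \<eta> ^ m * n powr p / 2 \<le>
     F' * \<eta> ^ m * (n powr p - d * T powr p - g)
     - F * (real m * \<eta> ^ (m - 1) * (2 / R)) * (n powr (p - 1) + b * T powr (p - 1) + e)
     - \<eta> ^ m * F * (c * n powr (p - 1) + d * T powr (p - 1) + f)
     + (8 * real m) powr p * (\<eta> powr (real m - p) * T powr p * coef p R K b c d e f g / R powr p)"
proof -
  define h where "h = \<eta> powr (real m - p)"
  \<comment> \<open>Large enough to dominate every numerical constant below, those from Young's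
    inequality as well as those from \<open>K \<le> 4 * T\<close>.\<close>
  define M where "M = (8 * real m) powr p"
  have T0: "0 < T" "K \<le> 4 * T" using K T by auto
  have h0: "0 < h" unfolding h_def using \<eta> by simp
  have \<eta>m: "\<eta> ^ m \<le> h" "\<eta> ^ (m - 1) \<le> h"
  proof -
    have "\<eta> ^ m = \<eta> powr (real m)" using \<eta> by (simp add: powr_realpow)
    also have "\<dots> \<le> h" unfolding h_def using p by (intro powr_mono') (use \<eta> in auto)
    finally show "\<eta> ^ m \<le> h" .
    have "\<eta> ^ (m - 1) = \<eta> powr (real (m - 1))" using \<eta> by (simp add: powr_realpow)
    also have "\<dots> \<le> h" unfolding h_def using p m by (intro powr_mono') (use \<eta> in auto)
    finally show "\<eta> ^ (m - 1) \<le> h" .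
  qed
  have m8: "8 \<le> 8 * real m" using m by simp
  have Mge: "8 * real m \<le> M" "4 powr p \<le> M" "2 * real m * 4 powr (p - 1) \<le> M"
  proof -
    show "8 * real m \<le> M" unfolding M_def using powr_mono[of 1 p "8 * real m"] p m8 by simp
    show "4 powr p \<le> M" unfolding M_def using p m8 by (intro powr_mono2) auto
    have "2 * real m * 4 powr (p - 1) \<le> (8 * real m) * (8 * real m) powr (p - 1)"
      using p m8 by (intro mult_mono powr_mono2) auto
    also have "\<dots> = M" unfolding M_def using powr_mult_base[of "8 * real m" "p - 1"] m8 by simp
    finally show "2 * real m * 4 powr (p - 1) \<le> M" .
  qed
  have M2: "2 \<le> M" "4 powr (p - 1) \<le> M"
  proof -
    show "2 \<le> M" using Mge(1) m8 by linarith
    have "4 powr (p - 1) \<le> 4 powr p" by (rule powr_mono) auto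
    then show "4 powr (p - 1) \<le> M" using Mge(2) by linarith
  qed
  have sT: "0 \<le> T - k" "T - k \<le> T" using T K by auto
  have Tp: "T * T powr (p - 1) = T powr p" using powr_mult_base[of T "p - 1"] T0 by simp
  \<comment> \<open>Since \<open>K \<le> 4 * T\<close>, the inhomogeneous data may be multiplied by
    powers of \<open>T / K\<close>, which turns them into coefficients of
    \<open>T powr p\<close>.\<close>
  have K1: "1 \<le> 4 powr (p - 1) * T powr (p - 1) / K powr (p - 1)"
  proof -
    have "K powr (p - 1) \<le> (4 * T) powr (p - 1)" using T0 K p by (intro powr_mono2) auto
    then show ?thesis using T0 K by (simp add: powr_mult)
  qed
  have K2: "1 \<le> 4 powr p * T powr p / K powr p"
  proof -
    have "K powr p \<le> (4 * T) powr p" using T0 K p by (intro powr_mono2) auto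
    then show ?thesis using T0 K by (simp add: powr_mult)
  qed
  define s where "s = T - k"
  have F2: "F \<le> F' * s" and s: "0 \<le> s" "s \<le> T" using F sT by (auto simp: s_def)
  define a1 where "a1 = h * T powr p * (M * (R powr (p - 1) * b / R powr p))"
  define a2 where "a2 = h * T powr p * (M * ((R * c) powr p / R powr p))"
  define a3 where "a3 = h * T powr p * (M * (R powr p * d / R powr p))"
  define a4 where "a4 = h * T powr p * (M * (R powr (p - 1) * e / K powr (p - 1) / R powr p))"
  define a5 where "a5 = h * T powr p * (M * (R powr p * f / K powr (p - 1) / R powr p))"
  define a6 where "a6 = h * T powr p * (M * (R powr p * g / K powr p / R powr p))"
  define a0 where "a0 = h * T powr p * (M * (1 / R powr p))"
  have RR: "R powr (p - 1) / R powr p = 1 / R"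
    using R powr_diff[of R "p - 1" p] by (simp add: powr_minus_divide)
  have hT: "0 \<le> h * T powr p" using h0 by simp
  have mR: "real m * \<eta> ^ (m - 1) * (2 / R) \<le> real m * h * (2 / R)"
    using R \<eta>m(2) by (intro mult_right_mono mult_left_mono) auto
  have t_g: "\<eta> ^ m * g \<le> a6"
  proof -
    have "\<eta> ^ m * g \<le> h * (g * (4 powr p * T powr p / K powr p))"
      by (rule mult_mono[OF \<eta>m(1)]) (use h0 co mult_left_mono[OF K2 co(6)] in auto)
    also have "\<dots> = h * T powr p * (4 powr p * (g / K powr p))" by simp
    also have "\<dots> \<le> h * T powr p * (M * (g / K powr p))"
      using Mge co K hT by (intro mult_left_mono mult_right_mono) auto
    finally show ?thesis unfolding a6_def using R by simp
  qed
  have t_d: "\<eta> ^ m * (d * T powr p) + \<eta> ^ m * (s * (d * T powr (p - 1))) \<le> a3"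
  proof -
    have "s * T powr (p - 1) \<le> T powr p" using Tp s mult_right_mono[OF s(2), of "T powr (p - 1)"] by simp
    then have "\<eta> ^ m * (s * (d * T powr (p - 1))) \<le> \<eta> ^ m * (d * T powr p)"
      using co \<eta> by (intro mult_left_mono) (auto simp: mult.left_commute[of s] intro!: mult_left_mono)
    moreover have "\<eta> ^ m * (d * T powr p) \<le> h * (d * T powr p)"
      using \<eta>m co by (intro mult_right_mono) auto
    ultimately have "\<eta> ^ m * (d * T powr p) + \<eta> ^ m * (s * (d * T powr (p - 1))) \<le> h * T powr p * (2 * d)"
      by (simp add: algebra_simps)
    also have "\<dots> \<le> h * T powr p * (M * d)" using M2 co hT by (intro mult_left_mono mult_right_mono) auto
    finally show ?thesis unfolding a3_def using R by simp
  qed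
  have t_f: "\<eta> ^ m * (s * f) \<le> a5"
  proof -
    have "s * f \<le> T * (f * (4 powr (p - 1) * T powr (p - 1) / K powr (p - 1)))"
      by (rule mult_mono[OF s(2)]) (use s co T0 mult_left_mono[OF K1 co(5)] in auto)
    note sf = this
    have "\<eta> ^ m * (s * f) \<le> h * (T * (f * (4 powr (p - 1) * T powr (p - 1) / K powr (p - 1))))"
      by (rule mult_mono[OF \<eta>m(1) sf]) (use h0 co s in auto)
    also have "\<dots> = h * (T * T powr (p - 1)) * (4 powr (p - 1) * (f / K powr (p - 1)))" by simp
    also have "\<dots> \<le> h * (T * T powr (p - 1)) * (M * (f / K powr (p - 1)))"
      unfolding Tp using M2 co K hT by (intro mult_left_mono mult_right_mono) auto
    finally show ?thesis unfolding a5_def Tp using R by simp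
  qed
  have t_b: "real m * \<eta> ^ (m - 1) * (2 / R) * (s * (b * T powr (p - 1))) \<le> a1"
  proof -
    have "s * T powr (p - 1) \<le> T powr p" using Tp s mult_right_mono[OF s(2), of "T powr (p - 1)"] by simp
    then have "s * (b * T powr (p - 1)) \<le> b * T powr p"
      using co by (simp add: mult.left_commute[of s] mult_left_mono)
    note sb = this
    have "real m * \<eta> ^ (m - 1) * (2 / R) * (s * (b * T powr (p - 1))) \<le> real m * h * (2 / R) * (b * T powr p)"
      by (rule mult_mono[OF mR sb]) (use h0 co s R in auto)
    also have "\<dots> = h * T powr p * (2 * real m * (b / R))" by simp
    also have "\<dots> \<le> h * T powr p * (M * (b / R))"
      using Mge(1) co R hT by (intro mult_left_mono mult_right_mono) auto
    also have "b / R = R powr (p - 1) * b / R powr p"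
      using arg_cong[OF RR, of "\<lambda>x. b * x"] by (simp add: mult.commute)
    finally show ?thesis unfolding a1_def .
  qed
  have t_e: "real m * \<eta> ^ (m - 1) * (2 / R) * (s * e) \<le> a4"
  proof -
    have "s * e \<le> T * (e * (4 powr (p - 1) * T powr (p - 1) / K powr (p - 1)))"
      by (rule mult_mono[OF s(2)]) (use s co T0 mult_left_mono[OF K1 co(4)] in auto)
    note sb = this
    have "real m * \<eta> ^ (m - 1) * (2 / R) * (s * e)
        \<le> real m * h * (2 / R) * (T * (e * (4 powr (p - 1) * T powr (p - 1) / K powr (p - 1))))"
      by (rule mult_mono[OF mR sb]) (use h0 co s R in auto)
    also have "\<dots> = h * (T * T powr (p - 1)) * ((2 * real m * 4 powr (p - 1)) * (e / K powr (p - 1) / R))"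
      by (simp add: ac_simps)
    also have "\<dots> \<le> h * (T * T powr (p - 1)) * (M * (e / K powr (p - 1) / R))"
      unfolding Tp using Mge(3) co K R hT by (intro mult_left_mono mult_right_mono) auto
    also have "e / K powr (p - 1) / R = R powr (p - 1) * e / K powr (p - 1) / R powr p"
      using arg_cong[OF RR, of "\<lambda>x. e / K powr (p - 1) * x"] by (simp add: mult.commute)
    finally show ?thesis unfolding a4_def Tp .
  qed
  have t_c: "\<eta> ^ m * (s * (c * n powr (p - 1))) \<le> \<eta> ^ m * n powr p / 4 + a2"
  proof -
    have "s * (c * n powr (p - 1)) \<le> n powr p / 4 + 4 powr p * (s * c) powr p"
      using young_split[of "s * c" n p] s co n p by (simp add: mult.assoc)
    also have "\<dots> \<le> n powr p / 4 + M * (T powr p * c powr p)"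
    proof -
      have "(s * c) powr p \<le> (T * c) powr p" using s co p by (intro powr_mono2 mult_right_mono) auto
      then have "4 powr p * (s * c) powr p \<le> M * (T * c) powr p" using Mge by (intro mult_mono) auto
      then show ?thesis using T0 co by (simp add: powr_mult)
    qed
    finally have "\<eta> ^ m * (s * (c * n powr (p - 1))) \<le> \<eta> ^ m * (n powr p / 4 + M * (T powr p * c powr p))"
      using \<eta> by (intro mult_left_mono) auto
    also have "\<dots> = \<eta> ^ m * n powr p / 4 + \<eta> ^ m * (M * (T powr p * c powr p))" by (simp add: distrib_left)
    also have "\<dots> \<le> \<eta> ^ m * n powr p / 4 + h * (M * (T powr p * c powr p))"
      using \<eta>m M2 by (intro add_left_mono mult_right_mono) auto
    also have "h * (M * (T powr p * c powr p)) = a2"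
      unfolding a2_def using R co by (simp add: powr_mult)
    finally show ?thesis .
  qed
  have t_0: "real m * \<eta> ^ (m - 1) * (2 / R) * (s * n powr (p - 1)) \<le> \<eta> ^ m * n powr p / 4 + a0"
  proof -
    \<comment> \<open>Writing \<open>\<eta> ^ (m - 1)\<close> as \<open>\<eta> ^ m / \<eta>\<close>
      moves the cutoff derivative into \<open>X\<close>; the power \<open>X powr p\<close> is the
      origin of the exponent \<open>m - p\<close> of the cutoff.\<close>
    define X where "X = 2 * real m * s / (R * \<eta>)"
    have X: "0 \<le> X" unfolding X_def using s R \<eta> by simp
    have \<eta>1: "\<eta> ^ m = \<eta> * \<eta> ^ (m - 1)" using m by (simp add: power_eq_if)
    have "real m * \<eta> ^ (m - 1) * (2 / R) * (s * n powr (p - 1)) = \<eta> ^ m * (X * n powr (p - 1))"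
      unfolding X_def \<eta>1 using \<eta> R by (simp add: field_simps)
    also have "\<dots> \<le> \<eta> ^ m * (n powr p / 4 + 4 powr p * X powr p)"
      using \<eta> young_split[OF X n p] by (intro mult_left_mono) auto
    also have "\<dots> = \<eta> ^ m * n powr p / 4 + 4 powr p * (\<eta> ^ m * X powr p)" by (simp add: algebra_simps)
    also have "\<eta> ^ m * X powr p = h * ((2 * real m) powr p * s powr p / R powr p)"
      unfolding X_def h_def using \<eta> R s by (simp add: powr_mult powr_divide powr_diff powr_realpow)
    also have "4 powr p * (h * ((2 * real m) powr p * s powr p / R powr p)) = h * s powr p * (M / R powr p)"
    proof -
      have "M = 4 powr p * (2 * real m) powr p" unfolding M_def by (simp add: powr_mult[symmetric])
      then show ?thesis by simp
    qed
    also have "\<dots> \<le> h * T powr p * (M / R powr p)"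
      using h0 s p M2 by (intro mult_left_mono mult_right_mono powr_mono2) auto
    finally show ?thesis unfolding a0_def by simp
  qed
  define Z where "Z = \<eta> ^ m * n powr p"
  have sum: "\<eta> ^ m * (d * T powr p) + \<eta> ^ m * g
      + real m * \<eta> ^ (m - 1) * (2 / R) * (s * (n powr (p - 1) + b * T powr (p - 1) + e))
      + \<eta> ^ m * (s * (c * n powr (p - 1) + d * T powr (p - 1) + f))
      \<le> Z / 2 + (a0 + a1 + a2 + a3 + a4 + a5 + a6)"
    using t_g t_d t_f t_b t_e t_c t_0 unfolding Z_def by (simp add: distrib_left)
  define Q where "Q = a0 + a1 + a2 + a3 + a4 + a5 + a6"
  have Q0: "0 \<le> Q"
    unfolding Q_def a0_def a1_def a2_def a3_def a4_def a5_def a6_def using hT h0 M2 co R K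
    by (intro add_nonneg_nonneg mult_nonneg_nonneg divide_nonneg_nonneg) auto
  have Q: "Q = (8 * real m) powr p * (\<eta> powr (real m - p) * T powr p * coef p R K b c d e f g / R powr p)"
    unfolding Q_def a0_def a1_def a2_def a3_def a4_def a5_def a6_def M_def[symmetric] h_def[symmetric] coef_def
    by (simp add: add_divide_distrib distrib_left ac_simps)
  define P1 where "P1 = n powr (p - 1) + b * T powr (p - 1) + e"
  define P2 where "P2 = c * n powr (p - 1) + d * T powr (p - 1) + f"
  have P: "0 \<le> P1" "0 \<le> P2" unfolding P1_def P2_def using co by auto
  have "F * (real m * \<eta> ^ (m - 1) * (2 / R)) * P1 \<le> F' * s * (real m * \<eta> ^ (m - 1) * (2 / R)) * P1"
    using F2 P \<eta> R by (intro mult_right_mono) auto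
  moreover have "\<eta> ^ m * F * P2 \<le> \<eta> ^ m * (F' * s) * P2"
    using F2 P \<eta> by (intro mult_right_mono mult_left_mono) auto
  moreover have "F' * (\<eta> ^ m * (d * T powr p) + \<eta> ^ m * g + real m * \<eta> ^ (m - 1) * (2 / R) * (s * P1) + \<eta> ^ m * (s * P2))
      \<le> F' * (Z / 2 + Q)"
    using sum F' unfolding P1_def[symmetric] P2_def[symmetric] Q_def[symmetric] by (intro mult_left_mono) auto
  moreover have "F' * Q \<le> Q" using F' Q0 by (intro mult_left_le_one_le) auto
  ultimately have "F' * Z / 2 \<le> F' * \<eta> ^ m * (n powr p - d * T powr p - g)
     - F * (real m * \<eta> ^ (m - 1) * (2 / R)) * P1 - \<eta> ^ m * F * P2 + Q"
    unfolding Z_def by (simp add: algebra_simps)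
  then show ?thesis unfolding Q P1_def P2_def Z_def by (simp add: mult.assoc)
qed

section \<open>The weighted probability measure\<close>

text \<open>The weight and the solution are controlled only on compact subsets of the open ball.
  Closed balls with radii increasing to \<open>2 * R\<close> exhaust it, and measurability passes to
  the pointwise limit.\<close>

lemma set_borel_measurable_ball_exhaust:
  fixes f :: "'n::euclidean_space \<Rightarrow> 'b::{real_normed_vector, second_countable_topology}"
  assumes R: "0 < R" and f: "\<And>s. s < 2 * R \<Longrightarrow> set_borel_measurable lebesgue (cball x0 s) f"
  shows "set_borel_measurable lebesgue (ball x0 (2 * R)) f"
proof -
  define s where "s n = 2 * R - R / real (Suc n)" for n
  have s: "s n < 2 * R" for n unfolding s_def using R by simp
  have "(\<lambda>x. indicator (ball x0 (2 * R)) x *\<^sub>R f x) \<in> borel_measurable lebesgue"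
  proof (rule borel_measurable_LIMSEQ_metric)
    show "(\<lambda>x. indicator (cball x0 (s n)) x *\<^sub>R f x) \<in> borel_measurable lebesgue" for n
      using f[OF s] unfolding set_borel_measurable_def .
    fix x
    show "(\<lambda>n. indicator (cball x0 (s n)) x *\<^sub>R f x) \<longlonglongrightarrow> indicator (ball x0 (2 * R)) x *\<^sub>R f x"
    proof (cases "x \<in> ball x0 (2 * R)")
      case True
      then have d: "dist x0 x < 2 * R" by simp
      have "(\<lambda>n. 2 * R - R * inverse (real (Suc n))) \<longlonglongrightarrow> 2 * R - R * 0"
        by (intro tendsto_intros LIMSEQ_inverse_real_of_nat)
      then have "s \<longlonglongrightarrow> 2 * R" unfolding s_def[abs_def] by (simp add: divide_inverse)
      from order_tendstoD(1)[OF this d] have "\<forall>\<^sub>F n in sequentially. dist x0 x < s n" .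
      then have "\<forall>\<^sub>F n in sequentially. indicator (cball x0 (s n)) x *\<^sub>R f x = indicator (ball x0 (2 * R)) x *\<^sub>R f x"
        by eventually_elim (use True in auto)
      then show ?thesis by (rule tendsto_eventually)
    next
      case False
      then have "x \<notin> cball x0 (s n)" for n using s[of n] by auto
      then show ?thesis using False by simp
    qed
  qed
  then show ?thesis unfolding set_borel_measurable_def .
qed

locale weighted_ball =
  fixes \<Omega> :: "'n::euclidean_space set" and w :: "'n \<Rightarrow> real" and \<gamma> :: real and x0 :: 'n and R :: real
  assumes open_Omega: "open \<Omega>" and weight: "is_weight \<Omega> w" and doubling_w: "doubling_with \<Omega> w \<gamma>"
    and gamma_gt_0: "0 < \<gamma>" and radius_pos: "0 < R" and ball_subset: "ball x0 (2 * R) \<subseteq> \<Omega>"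
begin

abbreviation "B2 \<equiv> ball x0 (2 * R)"

definition w_mass :: real where "w_mass = (LINT x:B2|lebesgue. w x)"

definition dens :: "'n \<Rightarrow> real" where "dens x = indicator B2 x * w x / w_mass"

text \<open>The weighted measure on \<open>B2\<close>, normalised to mass one and extended by zero.
  Averages over \<open>B2\<close> become integrals, and constants in Hoelder and Jensen become
  one.\<close>

definition N :: "'n measure" where "N = density lebesgue (\<lambda>x. ennreal (dens x))"

lemma w_AE_pos: "AE x in lebesgue. x \<in> B2 \<longrightarrow> 0 < w x"
proof -
  have "AE x in lebesgue. x \<in> \<Omega> \<longrightarrow> 0 < w x"
    using weight unfolding is_weight_def by blast
  then show ?thesis by eventually_elim (use ball_subset in blast)
qed

lemma w_cball: "cball x s \<subseteq> \<Omega> \<Longrightarrow> set_integrable lebesgue (cball x s) w"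
  using weight unfolding is_weight_def by auto

lemma cball_subset_Omega: "s < 2 * R \<Longrightarrow> cball x0 s \<subseteq> \<Omega>"
  using ball_subset by (auto simp: subset_iff)

lemma w_measurable [measurable]: "(\<lambda>x. indicator B2 x * w x) \<in> borel_measurable lebesgue"
proof -
  have "set_borel_measurable lebesgue B2 w"
  proof (rule set_borel_measurable_ball_exhaust[OF radius_pos])
    fix s assume "s < 2 * R"
    then have "set_integrable lebesgue (cball x0 s) w" by (intro w_cball cball_subset_Omega)
    then show "set_borel_measurable lebesgue (cball x0 s) w"
      unfolding set_integrable_def set_borel_measurable_def by (rule borel_measurable_integrable)
  qed
  then show ?thesis unfolding set_borel_measurable_def by simp
qed

text \<open>The weight is integrable on compact subsets of \<Omega>, and the closure of
  \<open>B2\<close> may leave \<Omega>. The closed ball of radius \<open>R\<close> is a compact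
  subset, and one doubling carries finiteness over to \<open>B2\<close>.\<close>

lemma wmeas_B2_finite: "wmeas w B2 < \<infinity>"
proof -
  have "wmeas w (ball x0 R) \<le> (\<integral>\<^sup>+x. ennreal (norm (indicator (cball x0 R) x *\<^sub>R w x)) \<partial>lebesgue)"
    unfolding wmeas_def by (intro nn_integral_mono ennreal_leI) (auto simp: indicator_def)
  also have "\<dots> < \<infinity>"
    using w_cball[OF cball_subset_Omega, of R] radius_pos
    unfolding set_integrable_def integrable_iff_bounded by simp
  finally have "wmeas w (ball x0 R) < \<infinity>" .
  moreover have "wmeas w B2 \<le> ennreal \<gamma> * wmeas w (ball x0 R)"
    using doubling_w radius_pos ball_subset unfolding doubling_with_def by simp
  ultimately show ?thesis
    by (metis ennreal_less_top ennreal_mult_less_top infinity_ennreal_def order_le_less_trans)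
qed

lemma w_integrable: "integrable lebesgue (\<lambda>x. indicator B2 x * w x)"
proof (rule integrableI_bounded)
  have "(\<integral>\<^sup>+x. ennreal (norm (indicator B2 x * w x)) \<partial>lebesgue) = wmeas w B2"
    unfolding wmeas_def
    by (rule nn_integral_cong_AE) (use w_AE_pos in eventually_elim, auto simp: indicator_def)
  then show "(\<integral>\<^sup>+x. ennreal (norm (indicator B2 x * w x)) \<partial>lebesgue) < \<infinity>" using wmeas_B2_finite by simp
qed measurable

lemma w_AE_nonneg: "AE x in lebesgue. 0 \<le> indicator B2 x * w x"
  using w_AE_pos by eventually_elim (auto simp: indicator_def)

lemma w_mass_pos: "0 < w_mass"
proof -
  have eq: "w_mass = (\<integral>x. indicator B2 x * w x \<partial>lebesgue)"
    unfolding w_mass_def set_lebesgue_integral_def by simp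
  have "0 \<le> w_mass" unfolding eq by (rule integral_nonneg_AE[OF w_AE_nonneg])
  moreover have "w_mass \<noteq> 0"
  proof
    assume "w_mass = 0"
    then have "AE x in lebesgue. indicator B2 x * w x = 0"
      using integral_nonneg_eq_0_iff_AE[OF w_integrable w_AE_nonneg] eq by simp
    with w_AE_pos have "AE x in lebesgue. x \<notin> B2"
      by eventually_elim (auto simp: indicator_def)
    then have "B2 \<in> null_sets lebesgue" by (subst AE_iff_null_sets) auto
    then have "negligible B2" by (simp add: negligible_iff_null_sets)
    then show False using open_not_negligible[of B2] radius_pos by simp
  qed
  ultimately show ?thesis by simp
qed

lemma dens_measurable [measurable]: "dens \<in> borel_measurable lebesgue"
  unfolding dens_def[abs_def] by measurable

lemma dens_nonneg: "AE x in lebesgue. 0 \<le> dens x"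
  using w_AE_nonneg by eventually_elim (use w_mass_pos in \<open>auto simp: dens_def\<close>)

lemma sets_density_N: "sets N = sets lebesgue"
  by (simp add: N_def)

lemma emeasure_N:
  assumes "E \<in> sets lebesgue" "E \<subseteq> B2"
  shows "emeasure N E = wmeas w E / ennreal w_mass"
proof -
  have "emeasure N E = (\<integral>\<^sup>+x. ennreal (dens x) * indicator E x \<partial>lebesgue)"
    unfolding N_def using assms by (intro emeasure_density) auto
  also have "\<dots> = (\<integral>\<^sup>+x. ennreal (indicator E x * (indicator B2 x * w x)) / ennreal w_mass \<partial>lebesgue)"
  proof (rule nn_integral_cong_AE)
    show "AE x in lebesgue. ennreal (dens x) * indicator E x = ennreal (indicator E x * (indicator B2 x * w x)) / ennreal w_mass"
      using w_AE_nonneg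
    proof eventually_elim
      case (elim x)
      then show ?case
        using w_mass_pos assms(2) by (cases "x \<in> E") (auto simp: dens_def divide_ennreal)
    qed
  qed
  also have "\<dots> = (\<integral>\<^sup>+x. ennreal (indicator E x * (indicator B2 x * w x)) \<partial>lebesgue) / ennreal w_mass"
  proof (rule nn_integral_divide)
    note [measurable] = assms(1)
    show "(\<lambda>x. ennreal (indicator E x * (indicator B2 x * w x))) \<in> borel_measurable lebesgue"
      by measurable
  qed
  also have "(\<integral>\<^sup>+x. ennreal (indicator E x * (indicator B2 x * w x)) \<partial>lebesgue) = wmeas w E"
    unfolding wmeas_def by (rule nn_integral_cong) (use assms(2) in \<open>auto simp: indicator_def\<close>)
  finally show ?thesis .
qed

lemma wmeas_B2: "wmeas w B2 = ennreal w_mass"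
  unfolding wmeas_def w_mass_def set_lebesgue_integral_def
  using nn_integral_eq_integral[OF w_integrable w_AE_nonneg] by simp

lemma emeasure_N_B2: "emeasure N B2 = 1"
  using emeasure_N[of B2] w_mass_pos by (simp add: wmeas_B2 ennreal_divide_self)

lemma emeasure_N_space: "emeasure N (space N) = 1"
proof -
  have "emeasure N (space N) = (\<integral>\<^sup>+x. ennreal (dens x) * indicator UNIV x \<partial>lebesgue)"
    unfolding N_def by (subst emeasure_density) auto
  also have "\<dots> = (\<integral>\<^sup>+x. ennreal (dens x) * indicator B2 x \<partial>lebesgue)"
    by (rule nn_integral_cong) (auto simp: dens_def indicator_def)
  also have "\<dots> = emeasure N B2"
    unfolding N_def by (subst emeasure_density) auto
  finally show ?thesis using emeasure_N_B2 by simp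
qed

sublocale doubling_ball N x0 R \<gamma>
proof -
  interpret finite_measure N
    by (rule finite_measureI) (simp add: emeasure_N_space)
  show "doubling_ball N x0 R \<gamma>"
  proof
    show "sets N = sets lebesgue" by (rule sets_density_N)
    show "measure N B2 = 1" using emeasure_N_B2 by (simp add: measure_def)
    show "measure N (space N) \<le> 1" using emeasure_N_space by (simp add: measure_def)
    fix x r assume r: "0 < r" "ball x (2 * r) \<subseteq> B2"
    have sub: "ball x r \<subseteq> ball x (2 * r)" using r by (intro subset_ball) simp
    have "wmeas w (ball x (2 * r)) \<le> ennreal \<gamma> * wmeas w (ball x r)"
      using doubling_w r ball_subset unfolding doubling_with_def by auto
    then have "wmeas w (ball x (2 * r)) / ennreal w_mass \<le> ennreal \<gamma> * (wmeas w (ball x r) / ennreal w_mass)"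
      by (simp add: divide_right_mono_ennreal ennreal_times_divide)
    moreover have "emeasure N (ball x (2 * r)) = wmeas w (ball x (2 * r)) / ennreal w_mass"
      by (rule emeasure_N) (use r in auto)
    moreover have "emeasure N (ball x r) = wmeas w (ball x r) / ennreal w_mass"
      by (rule emeasure_N) (use r sub in auto)
    ultimately have "emeasure N (ball x (2 * r)) \<le> ennreal \<gamma> * emeasure N (ball x r)"
      by simp
    then show "measure N (ball x (2 * r)) \<le> \<gamma> * measure N (ball x r)"
      using gamma_gt_0 by (simp add: emeasure_eq_measure ennreal_mult[symmetric])
  qed (use radius_pos gamma_gt_0 in auto)
qed

text \<open>Because the weight is positive almost everywhere, \<open>N\<close> and Lebesgue measure
  have the same null sets inside \<open>B2\<close>; the final bound for \<open>N\<close> is thereby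
  one for Lebesgue measure.\<close>

lemma AE_N_iff: "(AE x in N. P x) \<longleftrightarrow> (AE x in lebesgue. x \<in> B2 \<longrightarrow> P x)"
proof -
  have "(AE x in N. P x) \<longleftrightarrow> (AE x in lebesgue. 0 < ennreal (dens x) \<longrightarrow> P x)"
    unfolding N_def by (rule AE_density) measurable
  also have "\<dots> \<longleftrightarrow> (AE x in lebesgue. x \<in> B2 \<longrightarrow> P x)"
  proof (rule eventually_subst)
    show "AE x in lebesgue. (0 < ennreal (dens x) \<longrightarrow> P x) = (x \<in> B2 \<longrightarrow> P x)"
      using w_AE_pos by eventually_elim (use w_mass_pos in \<open>auto simp: dens_def indicator_def zero_less_divide_iff\<close>)
  qed
  finally show ?thesis .
qed

text \<open>Measurability is asked of the restriction to \<open>E\<close> alone, since coefficients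
  and solution are known only on subsets of \<Omega>.\<close>

lemma N_conversion:
  fixes h :: "'n \<Rightarrow> real"
  assumes h: "(\<lambda>x. indicator E x * h x) \<in> borel_measurable lebesgue" and E: "E \<subseteq> B2"
  shows "(LINT x:E|lebesgue. h x * w x) = w_mass * (\<integral>x. indicator E x * h x \<partial>N)"
    and "set_integrable lebesgue E (\<lambda>x. h x * w x) \<longleftrightarrow> integrable N (\<lambda>x. indicator E x * h x)"
proof -
  have eq: "dens x *\<^sub>R (indicator E x * h x) = (1 / w_mass) * (indicator E x *\<^sub>R (h x * w x))" for x
    using E by (auto simp: dens_def indicator_def)
  have "(\<integral>x. indicator E x * h x \<partial>N) = (\<integral>x. dens x *\<^sub>R (indicator E x * h x) \<partial>lebesgue)"
    unfolding N_def by (rule integral_density[OF h dens_measurable dens_nonneg])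
  also have "\<dots> = (1 / w_mass) * (LINT x:E|lebesgue. h x * w x)"
    unfolding eq set_lebesgue_integral_def by simp
  finally show "(LINT x:E|lebesgue. h x * w x) = w_mass * (\<integral>x. indicator E x * h x \<partial>N)"
    using w_mass_pos by simp
  have "integrable N (\<lambda>x. indicator E x * h x) \<longleftrightarrow> integrable lebesgue (\<lambda>x. dens x *\<^sub>R (indicator E x * h x))"
    unfolding N_def by (rule integrable_density[OF h dens_measurable dens_nonneg])
  also have "\<dots> \<longleftrightarrow> set_integrable lebesgue E (\<lambda>x. h x * w x)"
    unfolding eq set_integrable_def using w_mass_pos by (subst integrable_mult_left_iff) simp
  finally show "set_integrable lebesgue E (\<lambda>x. h x * w x) \<longleftrightarrow> integrable N (\<lambda>x. indicator E x * h x)" by simp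
qed

lemma wavg_eq:
  assumes E: "E \<in> sets lebesgue" "E \<subseteq> B2" and h: "(\<lambda>x. indicator E x * h x) \<in> borel_measurable lebesgue"
  shows "wavg w E h = (\<integral>x. indicator E x * h x \<partial>N) / measure N E"
proof -
  have "(LINT x:E|lebesgue. 1 * w x) = w_mass * (\<integral>x. indicator E x * 1 \<partial>N)"
    using E by (intro N_conversion) auto
  also have "(\<integral>x. indicator E x * 1 \<partial>N) = measure N E"
    using E by (simp add: sets_density_N)
  finally have "(LINT x:E|lebesgue. w x) = w_mass * measure N E" by simp
  then show ?thesis
    unfolding wavg_def N_conversion(1)[OF h E(2)] using w_mass_pos by simp
qed

lemma wavg_B2:
  assumes "(\<lambda>x. indicator B2 x * h x) \<in> borel_measurable lebesgue"
  shows "wavg w B2 h = (\<integral>x. indicator B2 x * h x \<partial>N)"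
  using wavg_eq[OF _ _ assms] mass_one by simp

lemma wavg_ball:
  assumes "h \<in> borel_measurable lebesgue" "ball x r \<subseteq> B2"
  shows "wavg w (ball x r) h = ball_avg r h x"
  using wavg_eq[of "ball x r" h] assms by (simp add: ball_avg_def set_lebesgue_integral_def)

lemma borel_measurable_N_iff: "f \<in> borel_measurable N \<longleftrightarrow> f \<in> borel_measurable lebesgue"
  by (simp add: measurable_cong_sets[OF sets_density_N refl])

text \<open>The bounded support supplies the integrability that \<open>poincare_with\<close> asks
  for, and averages do not change when the weight is normalised.\<close>

lemma poincare_N:
  assumes poin: "poincare_with \<Omega> w p C1 \<rho>" and p: "0 < p"
    and \<psi>: "C1_grad UNIV \<psi> D\<psi>" "\<And>x. x \<notin> ball x0 (5 / 4 * R) \<Longrightarrow> \<psi> x = 0 \<and> D\<psi> x = 0"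
    and r: "0 < r" "ball x (\<rho> * r) \<subseteq> B2"
  shows "ball_avg r (\<lambda>y. \<bar>\<psi> y - ball_avg r \<psi> x\<bar>) x
    \<le> C1 * r * ball_avg (\<rho> * r) (\<lambda>y. norm (D\<psi> y) powr p) x powr (1 / p)"
proof -
  have \<rho>: "1 \<le> \<rho>" using poin unfolding poincare_with_def by simp
  have sub: "ball x r \<subseteq> B2"
    using r \<rho> subset_ball[of r "\<rho> * r" x] by auto
  have c: "continuous_on UNIV \<psi>" "continuous_on UNIV D\<psi>"
    using \<psi>(1) C1_grad_continuous_on[OF \<psi>(1)] unfolding C1_grad_def by auto
  have [measurable]: "\<psi> \<in> borel_measurable lebesgue" "D\<psi> \<in> borel_measurable lebesgue"
    using c continuous_measurable_N by (auto simp: borel_measurable_N_iff[symmetric])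
  have C1\<Omega>: "C1_grad \<Omega> \<psi> D\<psi>"
    using \<psi>(1) unfolding C1_grad_def by (auto intro: continuous_on_subset)
  obtain M where M: "\<And>x. norm (\<psi> x) \<le> M"
    using bounded_of_compact_support[OF c(1), of "5 / 4 * R"] \<psi>(2) by blast
  have i1: "integrable N (\<lambda>x. \<bar>\<psi> x\<bar>)"
    by (rule integrable_const_bound[where B = M]) (use M in \<open>auto simp: borel_measurable_N_iff\<close>)
  have i2: "integrable N (\<lambda>x. norm (D\<psi> x) powr p)"
    by (rule integrable_powr_compact_support[OF c(2), of "5 / 4 * R"]) (use \<psi>(2) p in auto)
  have si1: "set_integrable lebesgue (ball x r) (\<lambda>y. \<bar>\<psi> y\<bar> * w y)"
    using sub integrable_mult_indicator[OF _ i1, of "ball x r"] by (subst N_conversion(2)) auto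
  have si2: "set_integrable lebesgue (ball x (\<rho> * r)) (\<lambda>y. norm (D\<psi> y) powr p * w y)"
    using r(2) integrable_mult_indicator[OF _ i2, of "ball x (\<rho> * r)"] by (subst N_conversion(2)) auto
  have "wavg w (ball x r) (\<lambda>y. \<bar>\<psi> y - wavg w (ball x r) \<psi>\<bar>)
      \<le> C1 * r * (wavg w (ball x (\<rho> * r)) (\<lambda>y. norm (D\<psi> y) powr p)) powr (1 / p)"
    using poin C1\<Omega> r ball_subset si1 si2 unfolding poincare_with_def by auto
  moreover have "wavg w (ball x r) \<psi> = ball_avg r \<psi> x"
    by (rule wavg_ball[OF _ sub]) measurable
  moreover have "wavg w (ball x r) (\<lambda>y. \<bar>\<psi> y - ball_avg r \<psi> x\<bar>) = ball_avg r (\<lambda>y. \<bar>\<psi> y - ball_avg r \<psi> x\<bar>) x"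
    by (rule wavg_ball[OF _ sub]) measurable
  moreover have "wavg w (ball x (\<rho> * r)) (\<lambda>y. norm (D\<psi> y) powr p) = ball_avg (\<rho> * r) (\<lambda>y. norm (D\<psi> y) powr p) x"
    by (rule wavg_ball[OF _ r(2)]) measurable
  ultimately show ?thesis by simp
qed

lemma Lsw_of_integrable:
  assumes h: "h \<in> borel_measurable N" and i: "integrable N (\<lambda>x. \<bar>h x\<bar> powr p)"
  shows "Lsw p w B2 h"
proof -
  have [measurable]: "h \<in> borel_measurable lebesgue" using h by (simp add: borel_measurable_N_iff)
  have "integrable N (\<lambda>x. indicator B2 x * \<bar>h x\<bar> powr p)"
    using integrable_mult_indicator[OF _ i, of B2] by simp
  then have "set_integrable lebesgue B2 (\<lambda>x. \<bar>h x\<bar> powr p * w x)"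
    by (subst N_conversion(2)) auto
  moreover have "set_borel_measurable lebesgue B2 h"
    unfolding set_borel_measurable_def by measurable
  ultimately show ?thesis unfolding Lsw_def by simp
qed

lemma N_integral_B2:
  fixes h :: "'n \<Rightarrow> real"
  assumes "h \<in> borel_measurable N"
  shows "(LINT x:B2|lebesgue. h x * w x) = w_mass * (\<integral>x. h x \<partial>N)"
proof -
  have [measurable]: "h \<in> borel_measurable lebesgue" using assms by (simp add: borel_measurable_N_iff)
  have "(LINT x:B2|lebesgue. h x * w x) = w_mass * (\<integral>x. indicator B2 x * h x \<partial>N)"
    by (rule N_conversion) auto
  also have "(\<integral>x. indicator B2 x * h x \<partial>N) = (\<integral>x. h x \<partial>N)"
    by (rule integral_cong_AE) (auto simp: AE_N_iff borel_measurable_N_iff)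
  finally show ?thesis .
qed

text \<open>Makes functions built from the solution admissible in the weak formulation; convergence
  for \<open>N\<close> and for the weight differ by the factor \<open>w_mass\<close>.\<close>

lemma sobolev0_H1pw:
  assumes s: "sobolev0 p \<phi> D\<phi>" and p: "0 < p"
  shows "H1pw p w B2 \<phi> D\<phi>"
proof -
  from s have m: "\<phi> \<in> borel_measurable N" "D\<phi> \<in> borel_measurable N"
    and i: "integrable N (\<lambda>x. \<bar>\<phi> x\<bar> powr p)" "integrable N (\<lambda>x. norm (D\<phi> x) powr p)"
    unfolding sobolev0_def by auto
  from s obtain v Dv where v: "\<And>k. C1_grad UNIV (v k) (Dv k)"
    "\<And>k x. x \<notin> ball x0 (5 / 4 * R) \<Longrightarrow> v k x = 0 \<and> Dv k x = 0"
    and lim: "(\<lambda>k. \<integral>x. \<bar>v k x - \<phi> x\<bar> powr p \<partial>N) \<longlonglongrightarrow> 0" "(\<lambda>k. \<integral>x. norm (Dv k x - D\<phi> x) powr p \<partial>N) \<longlonglongrightarrow> 0"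
    unfolding sobolev0_def by auto
  have c: "continuous_on UNIV (v k)" "continuous_on UNIV (Dv k)" for k
    using v(1)[of k] C1_grad_continuous_on[OF v(1)[of k]] unfolding C1_grad_def by auto
  note [measurable] = m continuous_measurable_N[OF c(1)] continuous_measurable_N[OF c(2)]
  have iv: "integrable N (\<lambda>x. norm (v k x) powr p)" "integrable N (\<lambda>x. norm (Dv k x) powr p)" for k
    by (rule integrable_powr_compact_support[OF c(1)[of k], where r = "5 / 4 * R"]; use v(2) p in simp)
      (rule integrable_powr_compact_support[OF c(2)[of k], where r = "5 / 4 * R"]; use v(2) p in simp)
  show ?thesis
    unfolding H1pw_def
  proof (intro conjI exI allI)
    show "Lsw p w B2 \<phi>" by (rule Lsw_of_integrable[OF m(1) i(1)])
    show "set_borel_measurable lebesgue B2 D\<phi>"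
      using m(2) unfolding set_borel_measurable_def borel_measurable_N_iff by measurable
    show "Lsw p w B2 (\<lambda>x. norm (D\<phi> x))" by (rule Lsw_of_integrable) (use i in auto)
    show "C1_grad B2 (v k) (Dv k)" for k
      using v(1)[of k] unfolding C1_grad_def by (auto intro: continuous_on_subset)
    show "Lsw p w B2 (v k)" for k by (rule Lsw_of_integrable) (use iv in auto)
    show "Lsw p w B2 (\<lambda>x. norm (Dv k x))" for k by (rule Lsw_of_integrable) (use iv in auto)
    have "(\<lambda>k. w_mass * (\<integral>x. \<bar>v k x - \<phi> x\<bar> powr p \<partial>N)) \<longlonglongrightarrow> w_mass * 0"
      by (intro tendsto_intros lim)
    then show "(\<lambda>k. LINT x:B2|lebesgue. \<bar>v k x - \<phi> x\<bar> powr p * w x) \<longlonglongrightarrow> 0"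
      by (subst N_integral_B2) auto
    have "(\<lambda>k. w_mass * (\<integral>x. norm (Dv k x - D\<phi> x) powr p \<partial>N)) \<longlonglongrightarrow> w_mass * 0"
      by (intro tendsto_intros lim)
    then show "(\<lambda>k. LINT x:B2|lebesgue. norm (Dv k x - D\<phi> x) powr p * w x) \<longlonglongrightarrow> 0"
      by (subst N_integral_B2) auto
  qed
qed

lemma Lsw_imp_integrable:
  assumes h: "Lsw p w E h" and E: "E \<subseteq> B2" "E \<in> sets lebesgue" and p: "0 < p"
  shows "(\<lambda>x. indicator E x * h x) \<in> borel_measurable N" "integrable N (\<lambda>x. \<bar>indicator E x * h x\<bar> powr p)"
proof -
  have [measurable]: "(\<lambda>x. indicator E x * h x) \<in> borel_measurable lebesgue"
    using h unfolding Lsw_def set_borel_measurable_def by simp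
  then show "(\<lambda>x. indicator E x * h x) \<in> borel_measurable N" by (simp add: borel_measurable_N_iff)
  have eq: "indicator E x * \<bar>h x\<bar> powr p = \<bar>indicator E x * h x\<bar> powr p" for x
    using p by (auto simp: indicator_def)
  have "set_integrable lebesgue E (\<lambda>x. \<bar>h x\<bar> powr p * w x)" using h unfolding Lsw_def by simp
  then have "integrable N (\<lambda>x. indicator E x * \<bar>h x\<bar> powr p)"
    by (subst (asm) N_conversion(2)) (use E in \<open>auto simp: eq\<close>)
  then show "integrable N (\<lambda>x. \<bar>indicator E x * h x\<bar> powr p)" by (simp add: eq)
qed

text \<open>Membership in \<open>H1pw\<close> says nothing outside \<open>V\<close>, so
  \<open>u\<close> and \<open>G\<close> are first extended by zero. The jump at the boundary of
  \<open>V\<close> is hidden by \<open>\<eta>\<close>, which vanishes off a ball whose closure lies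
  in \<open>V\<close>.\<close>

lemma H1pw_mult_compose:
  fixes F F' :: "real \<Rightarrow> real" and \<eta> :: "'n \<Rightarrow> real"
  assumes p: "1 < p" and V: "open V" "cball x0 (5 / 4 * R) \<subseteq> V" "V \<subseteq> B2"
    and H: "H1pw p w V u G"
    and F: "\<And>t. (F has_real_derivative F' t) (at t)" "continuous_on UNIV F'" "\<And>t. \<bar>F' t\<bar> \<le> 1" "F 0 = 0"
    and \<eta>: "C1_grad UNIV \<eta> D\<eta>" "\<And>x. \<bar>\<eta> x\<bar> \<le> 1" "\<And>x. norm (D\<eta> x) \<le> L"
      "\<And>x. x \<notin> ball x0 (5 / 4 * R) \<Longrightarrow> \<eta> x = 0 \<and> D\<eta> x = 0"
  shows "sobolev0 p (\<lambda>x. \<eta> x * F (indicator V x * u x))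
    (\<lambda>x. (\<eta> x * F' (indicator V x * u x)) *\<^sub>R (indicator V x *\<^sub>R G x) + F (indicator V x * u x) *\<^sub>R D\<eta> x)"
proof -
  have sV: "V \<in> sets lebesgue" using V by auto
  from H obtain v Dv where v: "\<And>k. C1_grad V (v k) (Dv k)" "\<And>k. Lsw p w V (v k)" "\<And>k. Lsw p w V (\<lambda>x. norm (Dv k x))"
    and lim: "(\<lambda>k. LINT x:V|lebesgue. \<bar>v k x - u x\<bar> powr p * w x) \<longlonglongrightarrow> 0"
      "(\<lambda>k. LINT x:V|lebesgue. norm (Dv k x - G x) powr p * w x) \<longlonglongrightarrow> 0"
    unfolding H1pw_def by auto
  have Lu: "Lsw p w V u" "Lsw p w V (\<lambda>x. norm (G x))" and mG0: "set_borel_measurable lebesgue V G"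
    using H unfolding H1pw_def by auto
  have p0: "0 < p" using p by simp
  note u1 = Lsw_imp_integrable[OF Lu(1) V(3) sV p0]
  note g1 = Lsw_imp_integrable[OF Lu(2) V(3) sV p0]
  note v1 = Lsw_imp_integrable[OF v(2) V(3) sV p0]
  note dv1 = Lsw_imp_integrable[OF v(3) V(3) sV p0]
  have mG: "(\<lambda>x. indicator V x *\<^sub>R G x) \<in> borel_measurable N"
    using mG0 unfolding set_borel_measurable_def by (simp add: borel_measurable_N_iff)
  have mDv: "(\<lambda>x. indicator V x *\<^sub>R Dv k x) \<in> borel_measurable N" for k
    using v(1)[of k] V(1) unfolding C1_grad_def
    by (intro borel_measurable_N borel_measurable_continuous_on_indicator) auto
  have iG: "integrable N (\<lambda>x. norm (indicator V x *\<^sub>R G x) powr p)"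
    using g1(2) by (simp add: abs_mult)
  have iDv: "integrable N (\<lambda>x. norm (indicator V x *\<^sub>R Dv k x) powr p)" for k
    using dv1(2)[of k] by (simp add: abs_mult)
  define uh where "uh x = indicator V x * u x" for x
  define Gh where "Gh x = indicator V x *\<^sub>R G x" for x
  have e1: "indicator V x * \<bar>v k x - uh x\<bar> powr p = norm (indicator V x * v k x - indicator V x * u x) powr p" for k x
    unfolding uh_def using p by (auto simp: indicator_def)
  have e2: "indicator V x * norm (Dv k x - Gh x) powr p = norm (indicator V x *\<^sub>R Dv k x - indicator V x *\<^sub>R G x) powr p" for k x
    unfolding Gh_def using p by (auto simp: indicator_def)
  have i1: "integrable N (\<lambda>x. indicator V x * \<bar>v k x - uh x\<bar> powr p)" for k
    unfolding e1 by (rule integrable_powr_diff[OF v1(1) u1(1) _ _ p0]) (use v1(2) u1(2) in auto)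
  have i2: "integrable N (\<lambda>x. indicator V x * norm (Dv k x - Gh x) powr p)" for k
    unfolding e2 by (rule integrable_powr_diff[OF mDv mG iDv iG p0])
  have c1: "(LINT x:V|lebesgue. \<bar>v k x - u x\<bar> powr p * w x) = w_mass * (\<integral>x. indicator V x * \<bar>v k x - uh x\<bar> powr p \<partial>N)" for k
  proof -
    have "(\<lambda>x. indicator V x * \<bar>v k x - u x\<bar> powr p) = (\<lambda>x. indicator V x * \<bar>v k x - uh x\<bar> powr p)"
      by (auto simp: uh_def indicator_def)
    moreover have "(\<lambda>x. indicator V x * \<bar>v k x - uh x\<bar> powr p) \<in> borel_measurable lebesgue"
      using borel_measurable_integrable[OF i1[of k]] by (simp add: borel_measurable_N_iff)
    ultimately show ?thesis using N_conversion(1)[OF _ V(3), of "\<lambda>x. \<bar>v k x - u x\<bar> powr p"] by simp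
  qed
  have c2: "(LINT x:V|lebesgue. norm (Dv k x - G x) powr p * w x) = w_mass * (\<integral>x. indicator V x * norm (Dv k x - Gh x) powr p \<partial>N)" for k
  proof -
    have "(\<lambda>x. indicator V x * norm (Dv k x - G x) powr p) = (\<lambda>x. indicator V x * norm (Dv k x - Gh x) powr p)"
      by (auto simp: Gh_def indicator_def)
    moreover have "(\<lambda>x. indicator V x * norm (Dv k x - Gh x) powr p) \<in> borel_measurable lebesgue"
      using borel_measurable_integrable[OF i2[of k]] by (simp add: borel_measurable_N_iff)
    ultimately show ?thesis using N_conversion(1)[OF _ V(3), of "\<lambda>x. norm (Dv k x - G x) powr p"] by simp
  qed
  have scale: "f \<longlonglongrightarrow> 0" if "(\<lambda>k. w_mass * f k) \<longlonglongrightarrow> 0" for f :: "nat \<Rightarrow> real"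
    using tendsto_mult_left[OF that, of "1 / w_mass"] w_mass_pos by simp
  have "sobolev0 p (\<lambda>x. \<eta> x * F (uh x)) (\<lambda>x. (\<eta> x * F' (uh x)) *\<^sub>R Gh x + F (uh x) *\<^sub>R D\<eta> x)"
  proof (rule sobolev0_mult_compose[OF p V(1,2) _ _ _ _ _ v(1) i1 i2 _ _ F \<eta>])
    show "uh \<in> borel_measurable N" "Gh \<in> borel_measurable N"
      using u1(1) mG by (simp_all add: uh_def[abs_def] Gh_def[abs_def])
    show "integrable N (\<lambda>x. \<bar>uh x\<bar> powr p)" "integrable N (\<lambda>x. norm (Gh x) powr p)"
      using u1(2) iG by (simp_all add: uh_def[abs_def] Gh_def[abs_def])
    show "uh x = 0" if "x \<notin> V" for x using that by (simp add: uh_def)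
    show "(\<lambda>k. \<integral>x. indicator V x * \<bar>v k x - uh x\<bar> powr p \<partial>N) \<longlonglongrightarrow> 0"
      using lim(1) unfolding c1 by (rule scale)
    show "(\<lambda>k. \<integral>x. indicator V x * norm (Dv k x - Gh x) powr p \<partial>N) \<longlonglongrightarrow> 0"
      using lim(2) unfolding c2 by (rule scale)
  qed
  then show ?thesis unfolding uh_def Gh_def .
qed

end

section \<open>The Caccioppoli inequality\<close>

context weighted_ball
begin

text \<open>A radius strictly between \<open>5 / 4 * R\<close>, where the cutoffs live, and
  \<open>2 * R\<close>: the closure of \<open>V\<close> is compact in \<open>B2\<close>, so the
  solution is a genuine Sobolev function there.\<close>

abbreviation "V \<equiv> ball x0 (3 / 2 * R)"

lemma V_subset: "cball x0 (5 / 4 * R) \<subseteq> V" "V \<subseteq> B2"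
  using radius_pos by (auto simp: subset_iff)

lemma coef_measurable:
  assumes s: "structure_conditions \<Omega> w p A B b c d e f g"
  shows "(\<lambda>x. indicator B2 x * coef p R K (b x) (c x) (d x) (e x) (f x) (g x)) \<in> borel_measurable N"
proof -
  have m: "(\<lambda>x. indicator B2 x * h x) \<in> borel_measurable N" if "h \<in> {b, c, d, e, f, g}" for h
  proof -
    have "set_borel_measurable lebesgue \<Omega> h" using s that unfolding structure_conditions_def by blast
    then have "(\<lambda>x. indicator B2 x *\<^sub>R (indicator \<Omega> x *\<^sub>R h x)) \<in> borel_measurable lebesgue"
      unfolding set_borel_measurable_def by measurable
    moreover have "(\<lambda>x. indicator B2 x *\<^sub>R (indicator \<Omega> x *\<^sub>R h x)) = (\<lambda>x. indicator B2 x * h x)"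
      using ball_subset by (auto simp: indicator_def fun_eq_iff)
    ultimately show ?thesis by (simp add: borel_measurable_N_iff)
  qed
  have [measurable]: "(\<lambda>x. indicator B2 x * b x) \<in> borel_measurable N" "(\<lambda>x. indicator B2 x * c x) \<in> borel_measurable N"
    "(\<lambda>x. indicator B2 x * d x) \<in> borel_measurable N" "(\<lambda>x. indicator B2 x * e x) \<in> borel_measurable N"
    "(\<lambda>x. indicator B2 x * f x) \<in> borel_measurable N" "(\<lambda>x. indicator B2 x * g x) \<in> borel_measurable N"
    by (auto intro: m)
  have "(\<lambda>x. indicator B2 x * coef p R K (indicator B2 x * b x) (indicator B2 x * c x) (indicator B2 x * d x)
      (indicator B2 x * e x) (indicator B2 x * f x) (indicator B2 x * g x)) \<in> borel_measurable N"
    unfolding coef_def by measurable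
  moreover have "indicator B2 x * coef p R K (indicator B2 x * b x) (indicator B2 x * c x) (indicator B2 x * d x)
      (indicator B2 x * e x) (indicator B2 x * f x) (indicator B2 x * g x)
      = indicator B2 x * coef p R K (b x) (c x) (d x) (e x) (f x) (g x)" for x
    by (auto simp: indicator_def)
  ultimately show ?thesis by simp
qed

text \<open>Where the cutoff vanishes or \<open>\<bar>t\<bar> \<le> k\<close>, the test function and
  its gradient are both zero. Elsewhere the structure conditions and Cauchy-Schwarz reduce the claim
  to \<open>energy_pointwise\<close>, multiplied by the weight.\<close>

lemma energy_integrand_bound:
  fixes A :: "'n \<Rightarrow> real \<Rightarrow> 'n \<Rightarrow> 'n" and B :: "'n \<Rightarrow> real \<Rightarrow> 'n \<Rightarrow> real"
  assumes p: "1 < p" and m: "2 \<le> m" "p < real m" and K: "0 < K" "K / 4 \<le> k" and \<delta>: "0 < \<delta>"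
    and r: "R \<le> r" and w: "0 < w x" and nn: "\<forall>h\<in>{b, c, d, e, f, g}. 0 \<le> h x"
    and A1: "A x t z \<bullet> z \<ge> w x * (norm z powr p - d x * \<bar>t\<bar> powr p - g x)"
    and A2: "norm (A x t z) \<le> w x * (norm z powr (p - 1) + b x * \<bar>t\<bar> powr (p - 1) + e x)"
    and B1: "\<bar>B x t z\<bar> \<le> w x * (c x * norm z powr (p - 1) + d x * \<bar>t\<bar> powr (p - 1) + f x)"
  shows "trunc' k \<delta> t * cutoff x0 r x ^ m * norm z powr p / 2 * w x \<le>
    (A x t z \<bullet> ((cutoff x0 r x ^ m * trunc' k \<delta> t) *\<^sub>R z + trunc k \<delta> t *\<^sub>R cutoff_grad x0 r m x)
      + B x t z * (cutoff x0 r x ^ m * trunc k \<delta> t))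
    + of_bool (k < \<bar>t\<bar>) * ((8 * real m) powr p * (cutoff x0 r x powr (real m - p) * \<bar>t\<bar> powr p
        * coef p R K (b x) (c x) (d x) (e x) (f x) (g x) / R powr p)) * w x"
proof -
  define \<eta> where "\<eta> = cutoff x0 r x"
  define F where "F = trunc k \<delta> t"
  define F' where "F' = trunc' k \<delta> t"
  define n where "n = norm z"
  define T where "T = \<bar>t\<bar>"
  define Q where "Q = coef p R K (b x) (c x) (d x) (e x) (f x) (g x)"
  have k: "0 \<le> k" using K by simp
  have nb: "0 \<le> b x" "0 \<le> c x" "0 \<le> d x" "0 \<le> e x" "0 \<le> f x" "0 \<le> g x" using nn by auto
  have Q0: "0 \<le> Q" unfolding Q_def coef_def using nb radius_pos K by (intro add_nonneg_nonneg mult_nonneg_nonneg divide_nonneg_nonneg) auto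
  have \<eta>: "0 \<le> \<eta>" "\<eta> \<le> 1" unfolding \<eta>_def by (rule cutoff_bounds)+
  have r0: "0 < r" using r radius_pos by linarith
  consider "\<eta> = 0" | "\<bar>t\<bar> \<le> k" | "0 < \<eta>" "k < \<bar>t\<bar>" using \<eta> by linarith
  then show ?thesis
  proof cases
    case 1
    then have "cutoff_grad x0 r m x = 0" unfolding cutoff_grad_def \<eta>_def using m by (simp add: zero_power)
    then show ?thesis using 1 m unfolding \<eta>_def by (simp add: zero_power)
  next
    case 2
    then show ?thesis using trunc_below[OF \<delta> 2] by simp
  next
    case 3
    have F'b: "0 \<le> F'" "F' \<le> 1" unfolding F'_def using trunc'_bounds[OF \<delta> k] by auto
    have Fle: "\<bar>F\<bar> \<le> F' * (T - k)" unfolding F_def F'_def T_def by (rule abs_trunc_le[OF \<delta> k 3(2)])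
    have "F' * \<eta> ^ m * n powr p / 2 \<le>
     F' * \<eta> ^ m * (n powr p - d x * T powr p - g x)
     - \<bar>F\<bar> * (real m * \<eta> ^ (m - 1) * (2 / R)) * (n powr (p - 1) + b x * T powr (p - 1) + e x)
     - \<eta> ^ m * \<bar>F\<bar> * (c x * n powr (p - 1) + d x * T powr (p - 1) + f x)
     + (8 * real m) powr p * (\<eta> powr (real m - p) * T powr p * Q / R powr p)"
      unfolding Q_def
      by (rule energy_pointwise[OF p]) (use m K 3 \<eta> F'b Fle nb radius_pos in \<open>auto simp: T_def n_def\<close>)
    then have le: "F' * \<eta> ^ m * n powr p / 2 * w x \<le>
     (F' * \<eta> ^ m * (n powr p - d x * T powr p - g x)
     - \<bar>F\<bar> * (real m * \<eta> ^ (m - 1) * (2 / R)) * (n powr (p - 1) + b x * T powr (p - 1) + e x)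
     - \<eta> ^ m * \<bar>F\<bar> * (c x * n powr (p - 1) + d x * T powr (p - 1) + f x)
     + (8 * real m) powr p * (\<eta> powr (real m - p) * T powr p * Q / R powr p)) * w x"
      using w by (intro mult_right_mono) auto
    have a1: "F' * \<eta> ^ m * (n powr p - d x * T powr p - g x) * w x \<le> \<eta> ^ m * F' * (A x t z \<bullet> z)"
    proof -
      have "(F' * \<eta> ^ m) * (w x * (n powr p - d x * T powr p - g x)) \<le> (F' * \<eta> ^ m) * (A x t z \<bullet> z)"
        using A1 F'b \<eta> unfolding n_def T_def by (intro mult_left_mono) auto
      then show ?thesis by (simp add: ac_simps)
    qed
    have a2: "- (\<bar>F\<bar> * (real m * \<eta> ^ (m - 1) * (2 / R)) * (n powr (p - 1) + b x * T powr (p - 1) + e x) * w x)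
        \<le> F * (A x t z \<bullet> cutoff_grad x0 r m x)"
    proof -
      have "norm (cutoff_grad x0 r m x) \<le> real m * \<eta> ^ (m - 1) * (2 / r)"
        unfolding \<eta>_def by (rule norm_cutoff_grad_le[OF m(1) r0])
      also have "\<dots> \<le> real m * \<eta> ^ (m - 1) * (2 / R)"
        using r radius_pos \<eta> by (intro mult_left_mono divide_left_mono) auto
      finally have cg: "norm (cutoff_grad x0 r m x) \<le> real m * \<eta> ^ (m - 1) * (2 / R)" .
      have "\<bar>F * (A x t z \<bullet> cutoff_grad x0 r m x)\<bar> \<le> \<bar>F\<bar> * (norm (A x t z) * norm (cutoff_grad x0 r m x))"
        unfolding abs_mult by (intro mult_left_mono Cauchy_Schwarz_ineq2) auto
      also have "\<dots> \<le> \<bar>F\<bar> * ((w x * (n powr (p - 1) + b x * T powr (p - 1) + e x)) * (real m * \<eta> ^ (m - 1) * (2 / R)))"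
      proof (rule mult_left_mono[OF mult_mono[OF _ cg]])
        show "norm (A x t z) \<le> w x * (n powr (p - 1) + b x * T powr (p - 1) + e x)"
          using A2 unfolding n_def T_def .
      qed (use w nb in \<open>auto intro!: mult_nonneg_nonneg\<close>)
      finally show ?thesis by (simp add: ac_simps abs_le_iff)
    qed
    have a3: "- (\<eta> ^ m * \<bar>F\<bar> * (c x * n powr (p - 1) + d x * T powr (p - 1) + f x) * w x) \<le> B x t z * (\<eta> ^ m * F)"
    proof -
      have "\<bar>B x t z * (\<eta> ^ m * F)\<bar> = \<bar>B x t z\<bar> * (\<eta> ^ m * \<bar>F\<bar>)" using \<eta> by (simp add: abs_mult)
      also have "\<dots> \<le> (w x * (c x * n powr (p - 1) + d x * T powr (p - 1) + f x)) * (\<eta> ^ m * \<bar>F\<bar>)"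
        using B1 \<eta> unfolding n_def T_def by (intro mult_right_mono) auto
      finally show ?thesis by (simp add: ac_simps abs_le_iff)
    qed
    have "A x t z \<bullet> ((\<eta> ^ m * F') *\<^sub>R z + F *\<^sub>R cutoff_grad x0 r m x) + B x t z * (\<eta> ^ m * F)
      = \<eta> ^ m * F' * (A x t z \<bullet> z) + F * (A x t z \<bullet> cutoff_grad x0 r m x) + B x t z * (\<eta> ^ m * F)"
      by (simp add: inner_add_right)
    moreover have "(a - b' - c' + d') * y = a * y - b' * y - c' * y + d' * y" for a b' c' d' y :: real
      by (simp add: algebra_simps)
    note le[unfolded this]
    ultimately have "F' * \<eta> ^ m * n powr p / 2 * w x \<le>
      (A x t z \<bullet> ((\<eta> ^ m * F') *\<^sub>R z + F *\<^sub>R cutoff_grad x0 r m x) + B x t z * (\<eta> ^ m * F))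
      + (8 * real m) powr p * (\<eta> powr (real m - p) * T powr p * Q / R powr p) * w x"
      using a1 a2 a3 by linarith
    then show ?thesis
      using 3 unfolding \<eta>_def[symmetric] F_def[symmetric] F'_def[symmetric] n_def[symmetric] T_def[symmetric] Q_def[symmetric]
      by simp
  qed
qed

lemma sobolev0_cutoff_trunc:
  assumes p: "1 < p" and H: "H1pw p w V u G" and n: "2 \<le> n" and r: "R \<le> r" "r \<le> 5 / 4 * R"
    and k: "0 \<le> k" "0 < \<delta>"
  shows "sobolev0 p (\<lambda>x. cutoff x0 r x ^ n * trunc k \<delta> (indicator V x * u x))
    (\<lambda>x. (cutoff x0 r x ^ n * trunc' k \<delta> (indicator V x * u x)) *\<^sub>R (indicator V x *\<^sub>R G x)
      + trunc k \<delta> (indicator V x * u x) *\<^sub>R cutoff_grad x0 r n x)"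
proof (rule H1pw_mult_compose[OF p open_ball V_subset H])
  have r0: "0 < r" using r radius_pos by linarith
  show "(trunc k \<delta> has_real_derivative trunc' k \<delta> t) (at t)" for t by (rule trunc_derivative[OF k(2)])
  show "continuous_on UNIV (trunc' k \<delta>)" by (rule trunc'_continuous[OF k(2)])
  show "\<bar>trunc' k \<delta> t\<bar> \<le> 1" for t using trunc'_bounds[OF k(2,1), of t] by simp
  show "trunc k \<delta> 0 = 0" using trunc_below[OF k(2), of 0 k] k by simp
  show "C1_grad UNIV (\<lambda>x. cutoff x0 r x ^ n) (cutoff_grad x0 r n)" by (rule C1_grad_cutoff[OF n r0])
  show "\<bar>cutoff x0 r x ^ n\<bar> \<le> 1" for x using cutoff_bounds[of x0 r x] by (simp add: power_le_one)
  show "norm (cutoff_grad x0 r n x) \<le> real n * 1 * (2 / r)" for x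
  proof (rule order_trans[OF norm_cutoff_grad_le[OF n r0]])
    have "cutoff x0 r x ^ (n - 1) \<le> 1" using cutoff_bounds[of x0 r x] by (simp add: power_le_one)
    then show "real n * cutoff x0 r x ^ (n - 1) * (2 / r) \<le> real n * 1 * (2 / r)"
      using r0 by (intro mult_right_mono mult_left_mono) auto
  qed
  show "cutoff x0 r x ^ n = 0 \<and> cutoff_grad x0 r n x = 0" if "x \<notin> ball x0 (5 / 4 * R)" for x
  proof -
    have "x \<notin> ball x0 r" using that r by auto
    then have "cutoff x0 r x = 0" by (rule cutoff_outside[OF r0])
    then show ?thesis using n by (simp add: cutoff_grad_def zero_power)
  qed
qed

text \<open>When the pointwise estimate is integrated, the terms with \<open>A\<close> and
  \<open>B\<close> form the weak equation for the test function and contribute zero. Integrability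
  of the right-hand side is assumed, since otherwise its Bochner integral would be zero by
  convention; \<open>level_energy\<close> supplies it through the Sobolev inequality.\<close>

theorem caccioppoli:
  fixes A :: "'n \<Rightarrow> real \<Rightarrow> 'n \<Rightarrow> 'n" and B :: "'n \<Rightarrow> real \<Rightarrow> 'n \<Rightarrow> real"
  assumes p: "1 < p" and m: "2 \<le> m" "p < real m" and K: "0 < K" "K / 4 \<le> k" and \<delta>: "0 < \<delta>"
    and r: "R \<le> r" "r \<le> 5 / 4 * R"
    and str: "structure_conditions \<Omega> w p A B b c d e f g"
    and H: "H1pw p w V u G"
    and weak: "\<And>\<phi> D\<phi> K. H1pw p w B2 \<phi> D\<phi> \<Longrightarrow> compact K \<Longrightarrow> K \<subseteq> B2 \<Longrightarrow> (\<And>x. x \<in> B2 - K \<Longrightarrow> \<phi> x = 0) \<Longrightarrow>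
       set_integrable lebesgue B2 (\<lambda>x. A x (u x) (G x) \<bullet> D\<phi> x + B x (u x) (G x) * \<phi> x) \<and>
       (LINT x:B2|lebesgue. A x (u x) (G x) \<bullet> D\<phi> x + B x (u x) (G x) * \<phi> x) = 0"
    and int: "integrable N (\<lambda>x. of_bool (k < \<bar>indicator V x * u x\<bar>) * (cutoff x0 r x powr (real m - p)
      * \<bar>indicator V x * u x\<bar> powr p * (indicator B2 x * coef p R K (b x) (c x) (d x) (e x) (f x) (g x))))"
  shows "R powr p * (\<integral>x. trunc' k \<delta> (indicator V x * u x) * cutoff x0 r x ^ m * norm (indicator V x *\<^sub>R G x) powr p \<partial>N)
    \<le> 2 * (8 * real m) powr p * (\<integral>x. of_bool (k < \<bar>indicator V x * u x\<bar>) * (cutoff x0 r x powr (real m - p)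
      * \<bar>indicator V x * u x\<bar> powr p * (indicator B2 x * coef p R K (b x) (c x) (d x) (e x) (f x) (g x))) \<partial>N)"
proof -
  define uh where "uh x = indicator V x * u x" for x
  define Gh where "Gh x = indicator V x *\<^sub>R G x" for x
  define h where "h x = of_bool (k < \<bar>uh x\<bar>) * (cutoff x0 r x powr (real m - p)
      * \<bar>uh x\<bar> powr p * (indicator B2 x * coef p R K (b x) (c x) (d x) (e x) (f x) (g x)))" for x
  define L where "L x = trunc' k \<delta> (uh x) * cutoff x0 r x ^ m * norm (Gh x) powr p" for x
  define \<phi> where "\<phi> x = cutoff x0 r x ^ m * trunc k \<delta> (uh x)" for x
  define D\<phi> where "D\<phi> x = (cutoff x0 r x ^ m * trunc' k \<delta> (uh x)) *\<^sub>R Gh x + trunc k \<delta> (uh x) *\<^sub>R cutoff_grad x0 r m x" for x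
  define I where "I x = A x (u x) (G x) \<bullet> D\<phi> x + B x (u x) (G x) * \<phi> x" for x
  have k: "0 \<le> k" using K by simp
  have r0: "0 < r" using r radius_pos by linarith
  have ih: "integrable N h" using int unfolding h_def uh_def .
  have s\<phi>: "sobolev0 p \<phi> D\<phi>"
    unfolding \<phi>_def[abs_def] D\<phi>_def[abs_def] uh_def Gh_def by (rule sobolev0_cutoff_trunc[OF p H m(1) r k \<delta>])
  have out: "cutoff x0 r x = 0" if "x \<notin> cball x0 (5 / 4 * R)" for x
    by (rule cutoff_outside[OF r0]) (use that r in auto)
  have "set_integrable lebesgue B2 (\<lambda>x. I x) \<and>
       (LINT x:B2|lebesgue. I x) = 0"
    unfolding I_def
  proof (rule weak)
    show "H1pw p w B2 \<phi> D\<phi>" by (rule sobolev0_H1pw[OF s\<phi>]) (use p in simp)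
    show "compact (cball x0 (5 / 4 * R))" by simp
    show "cball x0 (5 / 4 * R) \<subseteq> B2" using V_subset by blast
    show "\<phi> x = 0" if "x \<in> B2 - cball x0 (5 / 4 * R)" for x
      using out[of x] that m unfolding \<phi>_def by (simp add: zero_power)
  qed
  then have iI: "set_integrable lebesgue B2 (\<lambda>x. I x)"
    and I0: "(LINT x:B2|lebesgue. I x) = 0" by auto
  have p0: "0 < p" using p by simp
  have Lu: "Lsw p w V u" "Lsw p w V (\<lambda>x. norm (G x))" and mG0: "set_borel_measurable lebesgue V G"
    using H unfolding H1pw_def by auto
  have sV: "V \<in> sets lebesgue" by simp
  have muh [measurable]: "uh \<in> borel_measurable N"
    unfolding uh_def[abs_def] by (rule Lsw_imp_integrable[OF Lu(1) V_subset(2) sV p0])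
  have mGh [measurable]: "Gh \<in> borel_measurable N"
    using mG0 unfolding Gh_def[abs_def] set_borel_measurable_def by (simp add: borel_measurable_N_iff)
  have iGh: "integrable N (\<lambda>x. norm (Gh x) powr p)"
    using Lsw_imp_integrable(2)[OF Lu(2) V_subset(2) sV p0] by (simp add: Gh_def abs_mult)
  have [measurable]: "trunc' k \<delta> \<in> borel_measurable borel"
    by (intro borel_measurable_continuous_onI trunc'_continuous \<delta>)
  have [measurable]: "cutoff x0 r \<in> borel_measurable N"
    using r0 unfolding cutoff_def[abs_def] by (intro continuous_measurable_N continuous_intros) auto
  have L_le: "0 \<le> L x" "L x \<le> norm (Gh x) powr p" for x
  proof -
    have 1: "trunc' k \<delta> (uh x) * cutoff x0 r x ^ m \<le> 1 * 1"
      using trunc'_bounds[OF \<delta> k, of "uh x"] cutoff_bounds[of x0 r x] by (intro mult_mono power_le_one) auto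
    show "0 \<le> L x" unfolding L_def using trunc'_bounds[OF \<delta> k, of "uh x"] cutoff_bounds[of x0 r x] by auto
    show "L x \<le> norm (Gh x) powr p" unfolding L_def using mult_right_mono[OF 1, of "norm (Gh x) powr p"] by simp
  qed
  have mL [measurable]: "L \<in> borel_measurable N" unfolding L_def[abs_def] by measurable
  have iL: "integrable N L"
    by (rule Bochner_Integration.integrable_bound[OF iGh]) (use L_le in \<open>auto simp: abs_of_nonneg\<close>)
  define c0 where "c0 = (8 * real m) powr p / R powr p"
  have mh [measurable]: "h \<in> borel_measurable N" using ih by (rule borel_measurable_integrable)
  have conv_i: "set_integrable lebesgue B2 (\<lambda>x. q x * w x)" if q: "integrable N q" for q
  proof -
    have [measurable]: "q \<in> borel_measurable lebesgue"
      using borel_measurable_integrable[OF q] by (simp add: borel_measurable_N_iff)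
    show ?thesis
      using integrable_mult_indicator[OF _ q, of B2] by (subst N_conversion(2)) auto
  qed
  have iL2: "set_integrable lebesgue B2 (\<lambda>x. (L x / 2) * w x)" by (rule conv_i) (use iL in simp)
  have ih2: "set_integrable lebesgue B2 (\<lambda>x. (c0 * h x) * w x)" by (rule conv_i) (use ih in simp)
  have "AE x in lebesgue. x \<in> B2 \<longrightarrow> (\<forall>t z.
        A x t z \<bullet> z \<ge> w x * (norm z powr p - d x * \<bar>t\<bar> powr p - g x) \<and>
        norm (A x t z) \<le> w x * (norm z powr (p - 1) + b x * \<bar>t\<bar> powr (p - 1) + e x) \<and>
        \<bar>B x t z\<bar> \<le> w x * (c x * norm z powr (p - 1) + d x * \<bar>t\<bar> powr (p - 1) + f x))"
    (is "AE x in lebesgue. x \<in> B2 \<longrightarrow> ?str x")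
  proof -
    have "AE x in lebesgue. x \<in> \<Omega> \<longrightarrow> ?str x" using str unfolding structure_conditions_def by blast
    then show ?thesis by eventually_elim (use ball_subset in blast)
  qed
  then have ae: "AE x in lebesgue. x \<in> B2 \<longrightarrow>
     (L x / 2) * w x \<le> I x + (c0 * h x) * w x"
    using w_AE_pos
  proof eventually_elim
    case (elim x)
    show ?case
    proof
      assume xB: "x \<in> B2"
      then have wx: "0 < w x" and st: "?str x" using elim by auto
      have nn: "\<forall>h\<in>{b, c, d, e, f, g}. 0 \<le> h x"
        using str xB ball_subset unfolding structure_conditions_def by blast
      show "(L x / 2) * w x \<le> I x + (c0 * h x) * w x"
      proof (cases "x \<in> V")
        case True
        then have e: "uh x = u x" "Gh x = G x" by (auto simp: uh_def Gh_def)
        have "trunc' k \<delta> (u x) * cutoff x0 r x ^ m * norm (G x) powr p / 2 * w x \<le>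
          (A x (u x) (G x) \<bullet> ((cutoff x0 r x ^ m * trunc' k \<delta> (u x)) *\<^sub>R G x + trunc k \<delta> (u x) *\<^sub>R cutoff_grad x0 r m x)
            + B x (u x) (G x) * (cutoff x0 r x ^ m * trunc k \<delta> (u x)))
          + of_bool (k < \<bar>u x\<bar>) * ((8 * real m) powr p * (cutoff x0 r x powr (real m - p) * \<bar>u x\<bar> powr p
              * coef p R K (b x) (c x) (d x) (e x) (f x) (g x) / R powr p)) * w x"
          by (rule energy_integrand_bound[OF p m K \<delta> r(1) wx nn]) (use st in blast)+
        moreover have "c0 * h x = of_bool (k < \<bar>u x\<bar>) * ((8 * real m) powr p * (cutoff x0 r x powr (real m - p) * \<bar>u x\<bar> powr p
              * coef p R K (b x) (c x) (d x) (e x) (f x) (g x) / R powr p))"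
          using xB by (simp add: c0_def h_def e)
        ultimately show ?thesis unfolding L_def I_def \<phi>_def D\<phi>_def e by simp
      next
        case False
        then have "x \<notin> cball x0 (5 / 4 * R)" using V_subset by blast
        then have "cutoff x0 r x = 0" by (rule out)
        then have "L x = 0" "I x = 0" "h x = 0"
          unfolding L_def I_def \<phi>_def D\<phi>_def h_def cutoff_grad_def using m by (auto simp: zero_power)
        then show ?thesis by simp
      qed
    qed
  qed
  have "(LINT x:B2|lebesgue. (L x / 2) * w x) \<le>
    (LINT x:B2|lebesgue. I x + (c0 * h x) * w x)"
    unfolding set_lebesgue_integral_def
  proof (rule integral_mono_AE)
    show "integrable lebesgue (\<lambda>x. indicator B2 x *\<^sub>R ((L x / 2) * w x))"
      using iL2 unfolding set_integrable_def .
    show "integrable lebesgue (\<lambda>x. indicator B2 x *\<^sub>R (I x + (c0 * h x) * w x))"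
      using set_integral_add(1)[OF iI ih2] unfolding set_integrable_def .
    show "AE x in lebesgue. indicator B2 x *\<^sub>R ((L x / 2) * w x) \<le>
      indicator B2 x *\<^sub>R (I x + (c0 * h x) * w x)"
      using ae by eventually_elim (auto simp: indicator_def)
  qed
  also have "\<dots> = 0 + (LINT x:B2|lebesgue. (c0 * h x) * w x)"
    using set_integral_add(2)[OF iI ih2] I0 by simp
  also have "\<dots> = w_mass * (\<integral>x. c0 * h x \<partial>N)" by (subst N_integral_B2) auto
  also have "(LINT x:B2|lebesgue. (L x / 2) * w x) = w_mass * (\<integral>x. L x / 2 \<partial>N)" by (rule N_integral_B2) measurable
  finally have "(\<integral>x. L x / 2 \<partial>N) \<le> (\<integral>x. c0 * h x \<partial>N)" using w_mass_pos by simp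
  then have "(\<integral>x. L x \<partial>N) \<le> 2 * (c0 * (\<integral>x. h x \<partial>N))" by simp
  then have "R powr p * (\<integral>x. L x \<partial>N) \<le> R powr p * (2 * (c0 * (\<integral>x. h x \<partial>N)))"
    by (intro mult_left_mono) auto
  also have "\<dots> = 2 * (8 * real m) powr p * (\<integral>x. h x \<partial>N)"
    unfolding c0_def using radius_pos by simp
  finally show ?thesis unfolding L_def h_def uh_def Gh_def .
qed

end

section \<open>De Giorgi iteration\<close>

text \<open>As \<open>l < 1\<close>, weighted AM-GM absorbs the power of \<open>S\<close> into the
  left-hand side; moving \<open>c\<close> into the factor with exponent \<open>1 - l\<close>
  produces \<open>c powr (1 / (1 - l))\<close>.\<close>

lemma absorb_power:
  fixes S Y b c l :: real
  assumes "0 \<le> S" "0 \<le> Y" "0 \<le> c" "0 < l" "l < 1" and le: "S \<le> c * (S powr l * Y powr (1 - l) + b)"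
  shows "S \<le> c powr (1 / (1 - l)) * Y + c * b / (1 - l)"
proof -
  have "c * (S powr l * Y powr (1 - l)) = S powr l * (c powr (1 / (1 - l)) * Y) powr (1 - l)"
    using assms by (simp add: powr_mult powr_powr)
  also have "\<dots> \<le> l * S + (1 - l) * (c powr (1 / (1 - l)) * Y)"
    using assms by (intro weighted_amgm2) auto
  finally have "(1 - l) * S \<le> (1 - l) * (c powr (1 / (1 - l)) * Y) + c * b"
    using le by (simp add: algebra_simps)
  also have "\<dots> = (1 - l) * (c powr (1 / (1 - l)) * Y + c * b / (1 - l))"
    using assms by (simp add: distrib_left)
  finally show ?thesis using assms by simp
qed

lemma power_powr_le:
  fixes e p a :: real
  assumes "0 < e" "e \<le> 1" "a \<le> real n * p"
  shows "(e ^ n) powr p \<le> e powr a"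
proof -
  have "(e ^ n) powr p = e powr (real n * p)"
    using assms by (simp add: powr_realpow[symmetric] powr_powr)
  also have "\<dots> \<le> e powr a" using assms by (intro powr_mono') auto
  finally show ?thesis .
qed

text \<open>\<open>2 * (8 * m) powr p\<close> is the Caccioppoli constant,
  \<open>(2 * n) powr p\<close> stems from the gradient of the cutoff, \<open>2 powr p\<close> from
  splitting the sum of the two, and the final one accounts for the integral of
  \<open>X\<close>.\<close>

definition energy_const :: "real \<Rightarrow> nat \<Rightarrow> nat \<Rightarrow> real" where
  "energy_const p n m = 2 powr p * (2 * (8 * real m) powr p + (2 * real n) powr p) + 1"

text \<open>The product of the constants of the three inequalities that are chained at one level:
  Sobolev, energy, and Hoelder with the norm of the coefficient.\<close>

definition level_const :: "real \<Rightarrow> real \<Rightarrow> real \<Rightarrow> nat \<Rightarrow> nat \<Rightarrow> real \<Rightarrow> real \<Rightarrow> real" where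
  "level_const c0 p \<kappa> n m \<tau> M = c0 powr (1 / \<kappa>) * 2 powr p * energy_const p n m * (4 powr p * M powr (1 / \<tau>))"

section \<open>Energy at a single level\<close>

context weighted_ball
begin

context
  fixes p \<kappa> \<tau> l C1 \<rho> M K k \<delta> r :: real and n m :: nat and u :: "'n \<Rightarrow> real" and G :: "'n \<Rightarrow> 'n" and h :: "'n \<Rightarrow> real"
  assumes p: "1 < p" and \<kappa>: "1 < \<kappa>" "log 2 \<gamma> * (\<kappa> - 1) < p * \<kappa>"
    and \<tau>: "1 < \<tau>" and l: "0 < l" "l < 1" "1 / \<tau> + l / \<kappa> + (1 - l) = 1"
    and poin: "poincare_with \<Omega> w p C1 \<rho>"
    and nm: "2 \<le> n" "2 \<le> m" "real m \<le> real n * p" "real n * p * l + p \<le> real m"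
    and H: "H1pw p w V u G"
    and kK: "0 < K" "K / 4 \<le> k" "k + \<delta> \<le> K" and \<delta>: "0 < \<delta>" and r: "R \<le> r" "r \<le> 5 / 4 * R"
    and h: "h \<in> borel_measurable N" "\<And>x. 0 \<le> h x" "\<And>x. x \<in> B2 \<Longrightarrow> 1 \<le> h x"
      "integrable N (\<lambda>x. h x powr \<tau>)" "(\<integral>x. h x powr \<tau> \<partial>N) \<le> M"
    and energy: "integrable N (\<lambda>x. of_bool (k < \<bar>indicator V x * u x\<bar>) * (cutoff x0 r x powr (real m - p)
        * \<bar>indicator V x * u x\<bar> powr p * h x)) \<Longrightarrow>
      R powr p * (\<integral>x. trunc' k \<delta> (indicator V x * u x) * cutoff x0 r x ^ m * norm (indicator V x *\<^sub>R G x) powr p \<partial>N)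
      \<le> 2 * (8 * real m) powr p * (\<integral>x. of_bool (k < \<bar>indicator V x * u x\<bar>) * (cutoff x0 r x powr (real m - p)
        * \<bar>indicator V x * u x\<bar> powr p * h x) \<partial>N)"
begin

text \<open>\<open>j\<close> is the integrand on the right of the energy inequality; \<open>P1\<close> and \<open>P2\<close> are the Hoelder products that
  dominate it, obtained from \<open>|u| \<le> K + 2 F\<close>.\<close>

private definition "uh x = indicator V x * u x" for x :: 'n
private definition "Gh x = indicator V x *\<^sub>R G x" for x :: 'n
private definition "F x = \<bar>trunc k \<delta> (uh x)\<bar>" for x :: 'n
private definition "X x = (cutoff x0 r x ^ n * F x) powr p" for x :: 'n
private definition "W x = (cutoff x0 r x ^ n * trunc' k \<delta> (uh x)) *\<^sub>R Gh x + trunc k \<delta> (uh x) *\<^sub>R cutoff_grad x0 r n x" for x :: 'n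
private definition "A = {x. k < \<bar>uh x\<bar>} \<inter> ball x0 r"
private definition "Z x = indicator (ball x0 r) x * F x powr p" for x :: 'n
private definition "P1 x = (h x powr \<tau>) powr (1 / \<tau>) * (X x powr \<kappa>) powr (l / \<kappa>) * Z x powr (1 - l)" for x :: 'n
private definition "P2 x = (h x powr \<tau>) powr (1 / \<tau>) * indicator A x powr (1 - 1 / \<tau>)" for x :: 'n
private definition "j x = of_bool (k < \<bar>uh x\<bar>) * (cutoff x0 r x powr (real m - p) * \<bar>uh x\<bar> powr p * h x)" for x :: 'n

private lemma r0: "0 < r" using r radius_pos by linarith
private lemma pm: "p < real m"
proof -
  have "0 < real n * p * l" using nm p l by auto
  then show ?thesis using nm by linarith
qed
private lemma k0: "0 \<le> k" using kK by simp

private lemma meas [measurable]: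
  "uh \<in> borel_measurable N" "Gh \<in> borel_measurable N" "F \<in> borel_measurable N" "cutoff x0 r \<in> borel_measurable N"
  "X \<in> borel_measurable N" "A \<in> sets N" "h \<in> borel_measurable N"
proof -
  have Lu: "Lsw p w V u" and mG0: "set_borel_measurable lebesgue V G"
    using H unfolding H1pw_def by auto
  show 1 [measurable]: "uh \<in> borel_measurable N"
    unfolding uh_def[abs_def] by (rule Lsw_imp_integrable[OF Lu V_subset(2)]) (use p in auto)
  show "Gh \<in> borel_measurable N"
    using mG0 unfolding Gh_def[abs_def] set_borel_measurable_def by (simp add: borel_measurable_N_iff)
  have "continuous_on UNIV (trunc k \<delta>)"
    by (rule continuous_at_imp_continuous_on) (auto intro: DERIV_isCont trunc_derivative[OF \<delta>])
  then have [measurable]: "trunc k \<delta> \<in> borel_measurable borel" by (rule borel_measurable_continuous_onI)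
  show 2 [measurable]: "F \<in> borel_measurable N" unfolding F_def[abs_def] by measurable
  show 3 [measurable]: "cutoff x0 r \<in> borel_measurable N"
    using r0 unfolding cutoff_def[abs_def] by (intro continuous_measurable_N continuous_intros) auto
  show "X \<in> borel_measurable N" unfolding X_def[abs_def] by measurable
  have "{x \<in> space N. k < \<bar>uh x\<bar>} \<in> sets N" by measurable
  then show "A \<in> sets N" unfolding A_def by (intro sets.Int) auto
  show "h \<in> borel_measurable N" by (rule h(1))
qed

private lemma uh_int: "integrable N (\<lambda>x. \<bar>uh x\<bar> powr p)"
proof -
  have "Lsw p w V u" using H unfolding H1pw_def by auto
  then show ?thesis unfolding uh_def by (rule Lsw_imp_integrable(2)[OF _ V_subset(2)]) (use p in auto)
qed

private lemma Gh_int: "integrable N (\<lambda>x. norm (Gh x) powr p)"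
proof -
  have "Lsw p w V (\<lambda>x. norm (G x))" using H unfolding H1pw_def by auto
  then have "integrable N (\<lambda>x. \<bar>indicator V x * norm (G x)\<bar> powr p)"
    by (rule Lsw_imp_integrable(2)[OF _ V_subset(2)]) (use p in auto)
  then show ?thesis by (simp add: Gh_def abs_mult)
qed

private lemma F_bounds: "0 \<le> F x" "F x \<le> \<bar>uh x\<bar>" "\<bar>uh x\<bar> \<le> K + 2 * F x" "\<not> k < \<bar>uh x\<bar> \<Longrightarrow> F x = 0"
  unfolding F_def using abs_trunc_le_abs[OF \<delta> k0, of "uh x"] abs_le_trunc[OF \<delta> k0, of "uh x"] kK trunc_below[OF \<delta>, of "uh x" k]
  by auto

private lemma cutoff_pos: "cutoff x0 r x \<noteq> 0 \<Longrightarrow> 0 < cutoff x0 r x \<and> x \<in> ball x0 r"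
  using cutoff_outside[OF r0, of x x0] cutoff_bounds(1)[of x0 r x] by force

private lemma ball_r_B2: "ball x0 r \<subseteq> B2"
  using r radius_pos by (intro subset_ball) linarith

private lemma Z_int: "integrable N Z" and Z_nonneg: "0 \<le> Z x"
proof -
  show "0 \<le> Z x" unfolding Z_def by simp
  show "integrable N Z"
  proof (rule Bochner_Integration.integrable_bound[OF uh_int])
    have "Z x \<le> \<bar>uh x\<bar> powr p" for x
      unfolding Z_def using F_bounds[of x] p by (auto simp: indicator_def intro!: powr_mono2)
    then show "AE x in N. norm (Z x) \<le> norm (\<bar>uh x\<bar> powr p)"
      by (simp add: Z_def)
    show "Z \<in> borel_measurable N" unfolding Z_def[abs_def] by measurable
  qed
qed

private lemma sobolev_X:
  assumes "0 \<le> E" "R powr p * (\<integral>x. norm (W x) powr p \<partial>N)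
      + (\<integral>x. X x \<partial>N) \<le> E"
  shows "integrable N (\<lambda>x. X x powr \<kappa>)" "(\<integral>x. X x powr \<kappa> \<partial>N) powr (1 / \<kappa>) \<le> sob_const \<gamma> p C1 \<rho> \<kappa> powr (1 / \<kappa>) * 2 powr p * E"
proof -
  define \<phi> where "\<phi> x = cutoff x0 r x ^ n * trunc k \<delta> (uh x)" for x
  define c0 where "c0 = sob_const \<gamma> p C1 \<rho> \<kappa>"
  have c0: "0 \<le> c0" unfolding c0_def by (rule sob_const_nonneg[OF p \<kappa>])
  have C1\<rho>: "0 < C1" "1 \<le> \<rho>" using poin unfolding poincare_with_def by auto
  have s: "sobolev0 p \<phi> W"
    unfolding \<phi>_def[abs_def] W_def[abs_def] uh_def Gh_def by (rule sobolev0_cutoff_trunc[OF p H nm(1) r k0 \<delta>])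
  have a\<phi>: "\<bar>\<phi> x\<bar> = cutoff x0 r x ^ n * F x" for x
    unfolding \<phi>_def F_def using cutoff_bounds[of x0 r x] by (simp add: abs_mult)
  have X\<phi>: "\<bar>\<phi> x\<bar> powr p = X x" "\<bar>\<phi> x\<bar> powr (p * \<kappa>) = X x powr \<kappa>" for x
    unfolding X_def a\<phi> by (simp_all add: powr_powr)
  have p0: "0 < p" using p by simp
  have "(\<integral>\<^sup>+x. ennreal (\<bar>\<phi> x\<bar> powr (p * \<kappa>)) \<partial>N) \<le> ennreal (c0 * (2 powr p *
      (R powr p * (\<integral>x. norm (W x) powr p \<partial>N)
      + (\<integral>x. \<bar>\<phi> x\<bar> powr p \<partial>N))) powr \<kappa>)"
    unfolding c0_def by (rule sobolev0_inequality[OF p \<kappa> C1\<rho> _ s]) (rule poincare_N[OF poin p0])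
  also have "\<dots> \<le> ennreal (c0 * (2 powr p * E) powr \<kappa>)"
    unfolding X\<phi>
  proof (intro ennreal_leI mult_left_mono powr_mono2 assms(2) c0)
    show "0 \<le> 2 powr p * (R powr p * (\<integral>x. norm (W x) powr p \<partial>N) + (\<integral>x. X x \<partial>N))"
      by (intro mult_nonneg_nonneg add_nonneg_nonneg integral_nonneg_AE) (auto simp: X_def)
  qed (use \<kappa> in auto)
  finally have le: "(\<integral>\<^sup>+x. ennreal (X x powr \<kappa>) \<partial>N) \<le> ennreal (c0 * (2 powr p * E) powr \<kappa>)"
    unfolding X\<phi> .
  show i: "integrable N (\<lambda>x. X x powr \<kappa>)"
  proof (rule integrableI_bounded)
    show "(\<integral>\<^sup>+x. ennreal (norm (X x powr \<kappa>)) \<partial>N) < \<infinity>"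
      using le by (simp add: le_less_trans)
  qed measurable
  have "ennreal (\<integral>x. X x powr \<kappa> \<partial>N) \<le> ennreal (c0 * (2 powr p * E) powr \<kappa>)"
    using le nn_integral_eq_integral[OF i] by simp
  then have "(\<integral>x. X x powr \<kappa> \<partial>N) \<le> c0 * (2 powr p * E) powr \<kappa>" using c0 by (subst (asm) ennreal_le_iff) auto
  then have "(\<integral>x. X x powr \<kappa> \<partial>N) powr (1 / \<kappa>) \<le> (c0 * (2 powr p * E) powr \<kappa>) powr (1 / \<kappa>)"
    using \<kappa> by (intro powr_mono2 integral_nonneg_AE) auto
  also have "\<dots> = c0 powr (1 / \<kappa>) * 2 powr p * E"
    using c0 assms(1) \<kappa> by (simp add: powr_mult powr_powr)
  finally show "(\<integral>x. X x powr \<kappa> \<partial>N) powr (1 / \<kappa>) \<le> c0 powr (1 / \<kappa>) * 2 powr p * E" .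
qed

private lemma Dphi_int: "integrable N (\<lambda>x. norm (W x) powr p)"
  and X_int: "integrable N X"
proof -
  have s: "sobolev0 p (\<lambda>x. cutoff x0 r x ^ n * trunc k \<delta> (uh x))
    W"
    unfolding W_def[abs_def] uh_def Gh_def by (rule sobolev0_cutoff_trunc[OF p H nm(1) r k0 \<delta>])
  then show "integrable N (\<lambda>x. norm (W x) powr p)"
    unfolding sobolev0_def by blast
  have "\<bar>cutoff x0 r x ^ n * trunc k \<delta> (uh x)\<bar> powr p = X x" for x
    unfolding X_def F_def using cutoff_bounds[of x0 r x] by (simp add: abs_mult)
  then show "integrable N X" using s unfolding sobolev0_def by simp
qed

private lemma j_nonneg: "0 \<le> j x"
  unfolding j_def using h by simp

private lemma j_le: "j x \<le> 4 powr p * (P1 x + K powr p * P2 x)"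
proof (cases "cutoff x0 r x \<noteq> 0 \<and> k < \<bar>uh x\<bar>")
  case True
  define e where "e = cutoff x0 r x"
  have e: "0 < e" "e \<le> 1" "x \<in> ball x0 r" using cutoff_pos[of x] True cutoff_bounds(2)[of x0 r x] by (auto simp: e_def)
  have xA: "x \<in> A" using True e by (simp add: A_def)
  have hh: "(h x powr \<tau>) powr (1 / \<tau>) = h x" using h(2)[of x] \<tau> by (simp add: powr_powr)
  have "\<bar>uh x\<bar> powr p \<le> (K + 2 * F x) powr p" using F_bounds[of x] p by (intro powr_mono2) auto
  also have "\<dots> \<le> 2 powr p * (K powr p + (2 * F x) powr p)" using F_bounds[of x] kK p by (intro powr_add_le) auto
  also have "\<dots> = 2 powr p * K powr p + 4 powr p * F x powr p"
  proof -
    have "2 powr p * 2 powr p = 4 powr p" by (simp add: powr_mult[symmetric])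
    then show ?thesis using F_bounds[of x] by (simp add: powr_mult distrib_left mult.assoc[symmetric])
  qed
  also have "\<dots> \<le> 4 powr p * K powr p + 4 powr p * F x powr p"
    using p by (intro add_right_mono mult_right_mono powr_mono2) auto
  finally have 1: "\<bar>uh x\<bar> powr p \<le> 4 powr p * (F x powr p + K powr p)" by (simp add: algebra_simps)
  have 2: "(X x powr \<kappa>) powr (l / \<kappa>) * Z x powr (1 - l) = e powr (real n * p * l) * F x powr p"
  proof -
    have "(X x powr \<kappa>) powr (l / \<kappa>) = (e ^ n * F x) powr (p * l)"
      using \<kappa> by (simp add: X_def powr_powr e_def)
    also have "\<dots> = e powr (real n * p * l) * F x powr (p * l)"
      using e F_bounds[of x] by (simp add: powr_mult powr_realpow[symmetric] powr_powr mult.assoc)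
    finally have a: "(X x powr \<kappa>) powr (l / \<kappa>) = e powr (real n * p * l) * F x powr (p * l)" .
    have b: "Z x powr (1 - l) = F x powr (p * (1 - l))"
      using e by (simp add: Z_def powr_powr)
    have "F x powr (p * l) * F x powr (p * (1 - l)) = F x powr p"
      by (simp add: powr_add[symmetric] distrib_left[symmetric])
    then show ?thesis unfolding a b by simp
  qed
  \<comment> \<open>The role of \<open>n * p * l + p \<le> m\<close>: the cutoff power left by the
    energy estimate is small enough to provide the power that the Sobolev norm of
    \<open>cutoff ^ n * F\<close> brings into the Hoelder product.\<close>
  have 3: "e powr (real m - p) \<le> e powr (real n * p * l)" "e powr (real m - p) \<le> 1"
    using e nm(4) pm powr_mono'[of 0 "real m - p" e] by (auto intro!: powr_mono')
  have "j x = e powr (real m - p) * (\<bar>uh x\<bar> powr p * h x)" using True by (simp add: j_def e_def)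
  also have "\<dots> \<le> e powr (real m - p) * (4 powr p * (F x powr p + K powr p) * h x)"
    using 1 h(2)[of x] by (intro mult_left_mono mult_right_mono) auto
  also have "\<dots> = 4 powr p * (h x * (e powr (real m - p) * F x powr p) + K powr p * (h x * e powr (real m - p)))"
    by (simp add: algebra_simps)
  also have "\<dots> \<le> 4 powr p * (h x * (e powr (real n * p * l) * F x powr p) + K powr p * (h x * 1))"
    using 3 h(2)[of x] by (intro mult_left_mono add_mono mult_right_mono) auto
  finally show ?thesis unfolding P1_def P2_def hh using xA by (simp add: mult.assoc 2)
next
  case False
  then have "j x = 0" using pm by (auto simp: j_def)
  then show ?thesis by (simp add: P1_def P2_def)
qed

private lemma lower_order_bound:
  assumes iX: "integrable N (\<lambda>x. X x powr \<kappa>)"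
  shows "integrable N j"
    "(\<integral>x. j x \<partial>N) \<le> 4 powr p * M powr (1 / \<tau>) *
      (((\<integral>x. X x powr \<kappa> \<partial>N) powr (1 / \<kappa>)) powr l * (\<integral>x. Z x \<partial>N) powr (1 - l) + K powr p * measure N A powr (1 - 1 / \<tau>))"
proof -
  have Xn: "0 \<le> X x" for x unfolding X_def by simp
  have iA: "integrable N (indicator A :: 'n \<Rightarrow> real)" by (rule integrable_real_indicator) (auto simp: emeasure_eq_measure)
  have \<tau>': "0 < 1 / \<tau>" "0 < 1 - 1 / \<tau>" "1 / \<tau> + (1 - 1 / \<tau>) = 1" using \<tau> by auto
  have l': "0 < l / \<kappa>" "0 < 1 - l" using l \<kappa> by auto
  note H3 = holder3[OF h(4) _ iX _ Z_int Z_nonneg \<tau>'(1) l' l(3)]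
  note H2 = holder2[OF h(4) _ iA _ \<tau>']
  have i3: "integrable N (\<lambda>x. P1 x)"
    unfolding P1_def by (rule H3(1)) auto
  have i2: "integrable N (\<lambda>x. P2 x)"
    unfolding P2_def by (rule H2(1)) auto
  have ibound: "integrable N (\<lambda>x. 4 powr p * (P1 x + K powr p * P2 x))"
    by (intro integrable_mult_right Bochner_Integration.integrable_add i3 i2)
  show ij: "integrable N j"
  proof (rule Bochner_Integration.integrable_bound[OF ibound])
    show "j \<in> borel_measurable N" unfolding j_def[abs_def] by measurable
    show "AE x in N. norm (j x) \<le> norm (4 powr p * (P1 x + K powr p * P2 x))"
      using j_le j_nonneg unfolding real_norm_def by (intro AE_I2) (metis abs_ge_self abs_of_nonneg order_trans)
  qed
  have "(\<integral>x. j x \<partial>N) \<le> (\<integral>x. 4 powr p * (P1 x + K powr p * P2 x) \<partial>N)"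
    by (rule integral_mono[OF ij ibound j_le])
  also have "\<dots> = 4 powr p * ((\<integral>x. P1 x \<partial>N)
    + K powr p * (\<integral>x. P2 x \<partial>N))"
    using i3 i2 by simp
  also have "\<dots> \<le> 4 powr p * ((M powr (1 / \<tau>) * (\<integral>x. X x powr \<kappa> \<partial>N) powr (l / \<kappa>) * (\<integral>x. Z x \<partial>N) powr (1 - l))
    + K powr p * (M powr (1 / \<tau>) * measure N A powr (1 - 1 / \<tau>)))"
  proof (intro mult_left_mono add_mono)
    have hM: "(\<integral>x. h x powr \<tau> \<partial>N) powr (1 / \<tau>) \<le> M powr (1 / \<tau>)"
      using \<tau> h(5) by (intro powr_mono2 integral_nonneg_AE) auto
    have "(\<integral>x. P1 x \<partial>N)
      \<le> (\<integral>x. h x powr \<tau> \<partial>N) powr (1 / \<tau>) * (\<integral>x. X x powr \<kappa> \<partial>N) powr (l / \<kappa>) * (\<integral>x. Z x \<partial>N) powr (1 - l)"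
      unfolding P1_def by (rule H3(2)) auto
    also have "\<dots> \<le> M powr (1 / \<tau>) * (\<integral>x. X x powr \<kappa> \<partial>N) powr (l / \<kappa>) * (\<integral>x. Z x \<partial>N) powr (1 - l)"
      using hM by (intro mult_right_mono) auto
    finally show "(\<integral>x. P1 x \<partial>N)
      \<le> M powr (1 / \<tau>) * (\<integral>x. X x powr \<kappa> \<partial>N) powr (l / \<kappa>) * (\<integral>x. Z x \<partial>N) powr (1 - l)" .
    have "(\<integral>x. P2 x \<partial>N)
      \<le> (\<integral>x. h x powr \<tau> \<partial>N) powr (1 / \<tau>) * (\<integral>x. indicator A x \<partial>N) powr (1 - 1 / \<tau>)"
      unfolding P2_def by (rule H2(2)) auto
    also have "\<dots> \<le> M powr (1 / \<tau>) * measure N A powr (1 - 1 / \<tau>)"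
      using hM by (simp add: mult_right_mono)
    finally show "(\<integral>x. P2 x \<partial>N)
      \<le> M powr (1 / \<tau>) * measure N A powr (1 - 1 / \<tau>)" .
  qed auto
  also have "(\<integral>x. X x powr \<kappa> \<partial>N) powr (l / \<kappa>) = ((\<integral>x. X x powr \<kappa> \<partial>N) powr (1 / \<kappa>)) powr l"
    by (simp add: powr_powr)
  finally show "(\<integral>x. j x \<partial>N) \<le> 4 powr p * M powr (1 / \<tau>) *
      (((\<integral>x. X x powr \<kappa> \<partial>N) powr (1 / \<kappa>)) powr l * (\<integral>x. Z x \<partial>N) powr (1 - l) + K powr p * measure N A powr (1 - 1 / \<tau>))"
    by (simp add: algebra_simps)
qed

text \<open>The gradient \<open>W\<close> has a part with \<open>Gh\<close>, bounded by the energy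
  inequality, and a part from the cutoff. The latter and \<open>X\<close> are bounded by multiples
  of \<open>j\<close> because \<open>h \<ge> 1\<close> on \<open>B2\<close>, which is the reason for
  the summand one in \<open>coef\<close>.\<close>

private lemma energy_j:
  assumes ij: "integrable N j"
  shows "R powr p * (\<integral>x. norm (W x) powr p \<partial>N)
      + (\<integral>x. X x \<partial>N) \<le> energy_const p n m * (\<integral>x. j x \<partial>N)"
proof -
  define L where "L x = trunc' k \<delta> (uh x) * cutoff x0 r x ^ m * norm (Gh x) powr p" for x
  have [measurable]: "trunc' k \<delta> \<in> borel_measurable borel"
    by (intro borel_measurable_continuous_onI trunc'_continuous \<delta>)
  have L_le: "0 \<le> L x" "L x \<le> norm (Gh x) powr p" for x
  proof -
    have 1: "trunc' k \<delta> (uh x) * cutoff x0 r x ^ m \<le> 1 * 1"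
      using trunc'_bounds[OF \<delta> k0, of "uh x"] cutoff_bounds[of x0 r x] by (intro mult_mono power_le_one) auto
    show "0 \<le> L x" unfolding L_def using trunc'_bounds[OF \<delta> k0, of "uh x"] cutoff_bounds[of x0 r x] by auto
    show "L x \<le> norm (Gh x) powr p" unfolding L_def using mult_right_mono[OF 1, of "norm (Gh x) powr p"] by simp
  qed
  have [measurable]: "L \<in> borel_measurable N" unfolding L_def[abs_def] by measurable
  have iL: "integrable N L"
    by (rule Bochner_Integration.integrable_bound[OF Gh_int]) (use L_le in \<open>auto simp: abs_of_nonneg\<close>)
  have en: "R powr p * (\<integral>x. L x \<partial>N) \<le> 2 * (8 * real m) powr p * (\<integral>x. j x \<partial>N)"
    using energy ij unfolding L_def[abs_def] j_def[abs_def] uh_def Gh_def by blast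
  have X_le: "(cutoff x0 r x ^ N1 * F x) powr p \<le> j x" if N1: "real m - p \<le> real N1 * p" "1 \<le> N1" for x N1
  proof (cases "cutoff x0 r x \<noteq> 0 \<and> k < \<bar>uh x\<bar>")
    case True
    have e: "0 < cutoff x0 r x" "x \<in> ball x0 r" using cutoff_pos True by auto
    have "(cutoff x0 r x ^ N1 * F x) powr p = (cutoff x0 r x ^ N1) powr p * F x powr p"
      using e F_bounds[of x] by (simp add: powr_mult)
    also have "\<dots> \<le> cutoff x0 r x powr (real m - p) * \<bar>uh x\<bar> powr p"
      using e F_bounds[of x] p cutoff_bounds(2)[of x0 r x] N1
      by (intro mult_mono power_powr_le powr_mono2) auto
    also have "\<dots> = cutoff x0 r x powr (real m - p) * \<bar>uh x\<bar> powr p * 1" by simp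
    also have "\<dots> \<le> cutoff x0 r x powr (real m - p) * \<bar>uh x\<bar> powr p * h x"
      using h(3)[of x] e ball_r_B2 by (intro mult_left_mono) auto
    finally show ?thesis using True by (simp add: j_def)
  next
    case False
    then have "cutoff x0 r x ^ N1 * F x = 0" using F_bounds(4)[of x] N1 by (auto simp: zero_power)
    then have "(cutoff x0 r x ^ N1 * F x) powr p = 0" by simp
    then show ?thesis using j_nonneg[of x] by linarith
  qed
  have D_le: "norm (W x) powr p
      \<le> 2 powr p * (L x + (2 * real n / R) powr p * j x)" for x
  proof -
    define e where "e = cutoff x0 r x"
    define F' where "F' = trunc' k \<delta> (uh x)"
    have e: "0 \<le> e" "e \<le> 1" unfolding e_def by (rule cutoff_bounds)+
    have F': "0 \<le> F'" "F' \<le> 1" unfolding F'_def using trunc'_bounds[OF \<delta> k0] by auto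
    have "norm (cutoff_grad x0 r n x) \<le> real n * e ^ (n - 1) * (2 / r)"
      unfolding e_def by (rule norm_cutoff_grad_le[OF nm(1) r0])
    also have "\<dots> \<le> real n * e ^ (n - 1) * (2 / R)"
      using r radius_pos e by (intro mult_left_mono divide_left_mono) auto
    finally have cg: "norm (cutoff_grad x0 r n x) \<le> real n * e ^ (n - 1) * (2 / R)" .
    have "norm ((e ^ n * F') *\<^sub>R Gh x + trunc k \<delta> (uh x) *\<^sub>R cutoff_grad x0 r n x)
      \<le> e ^ n * F' * norm (Gh x) + F x * norm (cutoff_grad x0 r n x)"
      by (rule order_trans[OF norm_triangle_ineq]) (use e F' in \<open>simp add: F_def abs_mult\<close>)
    also have "\<dots> \<le> e ^ n * F' * norm (Gh x) + F x * (real n * e ^ (n - 1) * (2 / R))"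
      using F_bounds[of x] cg by (intro add_left_mono mult_left_mono) auto
    also have "\<dots> = e ^ n * F' * norm (Gh x) + (2 * real n / R) * (e ^ (n - 1) * F x)" by simp
    finally have "norm ((e ^ n * F') *\<^sub>R Gh x + trunc k \<delta> (uh x) *\<^sub>R cutoff_grad x0 r n x) powr p
      \<le> (e ^ n * F' * norm (Gh x) + (2 * real n / R) * (e ^ (n - 1) * F x)) powr p"
      using p by (intro powr_mono2) auto
    also have "\<dots> \<le> 2 powr p * ((e ^ n * F' * norm (Gh x)) powr p + ((2 * real n / R) * (e ^ (n - 1) * F x)) powr p)"
      using p e F' F_bounds[of x] radius_pos by (intro powr_add_le) auto
    also have "\<dots> \<le> 2 powr p * (L x + (2 * real n / R) powr p * j x)"
    proof (intro mult_left_mono add_mono)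
      show "(e ^ n * F' * norm (Gh x)) powr p \<le> L x"
      proof (cases "e = 0")
        case True
        then show ?thesis using nm L_le(1)[of x] p by (simp add: zero_power)
      next
        case False
        then have e0: "0 < e" using e by simp
        \<comment> \<open>The role of \<open>m \<le> n * p\<close>: together with
          \<open>F' powr p \<le> F'\<close> it brings the gradient part below the weight
          \<open>F' * e ^ m\<close> of the Caccioppoli inequality.\<close>
        have "(e ^ n) powr p \<le> e powr (real m)" using e0 e nm by (intro power_powr_le) auto
        then have 1: "(e ^ n) powr p \<le> e ^ m" using e0 by (simp add: powr_realpow)
        have 2: "F' powr p \<le> F'" using F' p powr_mono'[of 1 p F'] by (cases "F' = 0") auto
        have "(e ^ n * F' * norm (Gh x)) powr p = (e ^ n) powr p * F' powr p * norm (Gh x) powr p"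
          using e0 F' by (simp add: powr_mult)
        also have "\<dots> \<le> e ^ m * F' * norm (Gh x) powr p"
          using 1 2 e0 by (intro mult_right_mono mult_mono) auto
        finally show ?thesis by (simp add: L_def e_def F'_def ac_simps)
      qed
      have "((2 * real n / R) * (e ^ (n - 1) * F x)) powr p = (2 * real n / R) powr p * (e ^ (n - 1) * F x) powr p"
        using e F_bounds[of x] radius_pos by (subst powr_mult) auto
      also have "\<dots> \<le> (2 * real n / R) powr p * j x"
      proof (intro mult_left_mono)
        have "real m - p \<le> real (n - 1) * p" using nm by (simp add: of_nat_diff left_diff_distrib)
        then show "(e ^ (n - 1) * F x) powr p \<le> j x" unfolding e_def using nm by (intro X_le) auto
      qed simp
      finally show "((2 * real n / R) * (e ^ (n - 1) * F x)) powr p \<le> (2 * real n / R) powr p * j x" .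
    qed simp
    finally show ?thesis unfolding W_def e_def F'_def .
  qed
  have iR: "integrable N (\<lambda>x. 2 powr p * (L x + (2 * real n / R) powr p * j x))" using iL ij by auto
  have "(\<integral>x. norm (W x) powr p \<partial>N)
    \<le> (\<integral>x. 2 powr p * (L x + (2 * real n / R) powr p * j x) \<partial>N)"
    by (rule integral_mono[OF Dphi_int iR D_le])
  also have "\<dots> = 2 powr p * ((\<integral>x. L x \<partial>N) + (2 * real n / R) powr p * (\<integral>x. j x \<partial>N))"
    using iL ij by simp
  finally have "R powr p * (\<integral>x. norm (W x) powr p \<partial>N)
    \<le> R powr p * (2 powr p * ((\<integral>x. L x \<partial>N) + (2 * real n / R) powr p * (\<integral>x. j x \<partial>N)))"
    by (rule mult_left_mono) simp
  also have "\<dots> = 2 powr p * (R powr p * (\<integral>x. L x \<partial>N) + (2 * real n) powr p * (\<integral>x. j x \<partial>N))"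
    using radius_pos by (simp add: powr_divide distrib_left)
  also have "\<dots> \<le> 2 powr p * (2 * (8 * real m) powr p * (\<integral>x. j x \<partial>N) + (2 * real n) powr p * (\<integral>x. j x \<partial>N))"
    by (intro mult_left_mono add_right_mono en) simp
  finally have 1: "R powr p * (\<integral>x. norm (W x) powr p \<partial>N)
    \<le> 2 powr p * (2 * (8 * real m) powr p * (\<integral>x. j x \<partial>N) + (2 * real n) powr p * (\<integral>x. j x \<partial>N))" .
  have "real m - p \<le> real n * p" using nm p by linarith
  then have 2: "(\<integral>x. X x \<partial>N) \<le> (\<integral>x. j x \<partial>N)"
    using nm by (intro integral_mono X_int ij) (auto simp: X_def intro!: X_le)
  show ?thesis using 1 2 unfolding energy_const_def by (simp add: algebra_simps)
qed

text \<open>The Sobolev norm bounds itself: it is estimated by the energy, the energy by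
  \<open>j\<close>, and \<open>j\<close> through Hoelder by a power \<open>l < 1\<close> of the same
  norm, which \<open>absorb_power\<close> removes.\<close>

lemma level_energy:
  shows "integrable N (\<lambda>x. ((cutoff x0 r x ^ n * \<bar>trunc k \<delta> (indicator V x * u x)\<bar>) powr p) powr \<kappa>)"
    and "(\<integral>x. ((cutoff x0 r x ^ n * \<bar>trunc k \<delta> (indicator V x * u x)\<bar>) powr p) powr \<kappa> \<partial>N) powr (1 / \<kappa>)
      \<le> level_const (sob_const \<gamma> p C1 \<rho> \<kappa>) p \<kappa> n m \<tau> M powr (1 / (1 - l))
          * (\<integral>x. indicator (ball x0 r) x * \<bar>trunc k \<delta> (indicator V x * u x)\<bar> powr p \<partial>N)
        + level_const (sob_const \<gamma> p C1 \<rho> \<kappa>) p \<kappa> n m \<tau> M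
          * (K powr p * measure N ({x. k < \<bar>indicator V x * u x\<bar>} \<inter> ball x0 r) powr (1 - 1 / \<tau>)) / (1 - l)"
proof -
  \<comment> \<open>The energy is finite, though not yet controlled. It serves here only to make
    \<open>X powr \<kappa>\<close> integrable; then \<open>j\<close> is integrable, the energy
    inequality becomes available, and the Sobolev inequality is applied again with
    constants.\<close>
  define E0 where "E0 = R powr p * (\<integral>x. norm (W x) powr p \<partial>N)
      + (\<integral>x. X x \<partial>N)"
  have "0 \<le> E0" unfolding E0_def by (intro add_nonneg_nonneg mult_nonneg_nonneg integral_nonneg_AE) (auto simp: X_def)
  then have iX: "integrable N (\<lambda>x. X x powr \<kappa>)" by (rule sobolev_X(1)) (simp add: E0_def)
  note c = lower_order_bound[OF iX]
  define J where "J = (\<integral>x. j x \<partial>N)"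
  have J: "0 \<le> J" unfolding J_def using j_nonneg by simp
  define S where "S = (\<integral>x. X x powr \<kappa> \<partial>N) powr (1 / \<kappa>)"
  define c0 where "c0 = sob_const \<gamma> p C1 \<rho> \<kappa>"
  have ec: "0 \<le> energy_const p n m" unfolding energy_const_def by simp
  have S1: "S \<le> c0 powr (1 / \<kappa>) * 2 powr p * (energy_const p n m * J)"
    unfolding S_def c0_def J_def
    by (rule sobolev_X(2)[OF _ energy_j[OF c(1)]]) (use ec J in \<open>simp add: J_def\<close>)
  have "J \<le> 4 powr p * M powr (1 / \<tau>) * (S powr l * (\<integral>x. Z x \<partial>N) powr (1 - l) + K powr p * measure N A powr (1 - 1 / \<tau>))"
    using c(2) unfolding J_def S_def .
  then have "c0 powr (1 / \<kappa>) * 2 powr p * (energy_const p n m * J) \<le> c0 powr (1 / \<kappa>) * 2 powr p * (energy_const p n m *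
      (4 powr p * M powr (1 / \<tau>) * (S powr l * (\<integral>x. Z x \<partial>N) powr (1 - l) + K powr p * measure N A powr (1 - 1 / \<tau>))))"
    using ec by (intro mult_left_mono) auto
  with S1 have "S \<le> level_const c0 p \<kappa> n m \<tau> M * (S powr l * (\<integral>x. Z x \<partial>N) powr (1 - l) + K powr p * measure N A powr (1 - 1 / \<tau>))"
    unfolding level_const_def by (simp add: mult.assoc)
  then have "S \<le> level_const c0 p \<kappa> n m \<tau> M powr (1 / (1 - l)) * (\<integral>x. Z x \<partial>N)
      + level_const c0 p \<kappa> n m \<tau> M * (K powr p * measure N A powr (1 - 1 / \<tau>)) / (1 - l)"
    using l ec Z_nonneg by (intro absorb_power) (auto simp: S_def level_const_def)
  then show "(\<integral>x. ((cutoff x0 r x ^ n * \<bar>trunc k \<delta> (indicator V x * u x)\<bar>) powr p) powr \<kappa> \<partial>N) powr (1 / \<kappa>)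
      \<le> level_const (sob_const \<gamma> p C1 \<rho> \<kappa>) p \<kappa> n m \<tau> M powr (1 / (1 - l))
          * (\<integral>x. indicator (ball x0 r) x * \<bar>trunc k \<delta> (indicator V x * u x)\<bar> powr p \<partial>N)
        + level_const (sob_const \<gamma> p C1 \<rho> \<kappa>) p \<kappa> n m \<tau> M
          * (K powr p * measure N ({x. k < \<bar>indicator V x * u x\<bar>} \<inter> ball x0 r) powr (1 - 1 / \<tau>)) / (1 - l)"
    unfolding S_def X_def Z_def F_def uh_def A_def c0_def .
  show "integrable N (\<lambda>x. ((cutoff x0 r x ^ n * \<bar>trunc k \<delta> (indicator V x * u x)\<bar>) powr p) powr \<kappa>)"
    using iX unfolding X_def F_def uh_def .
qed

end

end

text \<open>The induction \<open>y j \<le> y 0 * q ^ j\<close> closes with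
  \<open>q = b powr (- (1 / \<theta>))\<close>: the factor \<open>(q ^ j) powr \<theta>\<close>
  cancels the growth \<open>b ^ j\<close>, and the starting bound gives
  \<open>C * y 0 powr \<theta> \<le> q\<close>. The recursion is required only while
  \<open>y j \<le> 1\<close>, a condition that the decay preserves.\<close>

lemma fast_geometric_convergence:
  fixes y :: "nat \<Rightarrow> real"
  assumes C: "1 \<le> C" and b: "1 < b" and \<theta>: "0 < \<theta>"
    and y0: "\<And>j. 0 \<le> y j" and start: "y 0 \<le> C powr (- (1 / \<theta>)) * b powr (- (1 / \<theta>\<^sup>2))"
    and step: "\<And>j. y j \<le> 1 \<Longrightarrow> y (Suc j) \<le> C * b ^ j * y j powr (1 + \<theta>)"
  shows "y \<longlonglongrightarrow> 0"
proof -
  define q where "q = b powr (- (1 / \<theta>))"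
  have q: "0 < q" "q < 1"
    unfolding q_def using b \<theta> powr_less_mono[of "- (1 / \<theta>)" 0 b] by auto
  have Cy: "C * y 0 powr \<theta> \<le> q"
  proof -
    have "y 0 powr \<theta> \<le> (C powr (- (1 / \<theta>)) * b powr (- (1 / \<theta>\<^sup>2))) powr \<theta>"
      using start y0 \<theta> by (intro powr_mono2) auto
    also have "\<dots> = C powr (- 1) * q"
      unfolding q_def using C b \<theta> by (simp add: powr_mult powr_powr power2_eq_square)
    finally have "C * y 0 powr \<theta> \<le> C * (C powr (- 1) * q)" using C by (intro mult_left_mono) auto
    also have "\<dots> = q" using C by (simp add: powr_minus)
    finally show ?thesis .
  qed
  have y01: "y 0 \<le> 1"
  proof -
    have "C powr (- (1 / \<theta>)) \<le> C powr 0" using C \<theta> by (intro powr_mono) auto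
    moreover have "b powr (- (1 / \<theta>\<^sup>2)) \<le> b powr 0" using b \<theta> by (intro powr_mono) auto
    ultimately have "C powr (- (1 / \<theta>)) * b powr (- (1 / \<theta>\<^sup>2)) \<le> 1 * 1"
      using C b by (intro mult_mono) auto
    then show ?thesis using start by linarith
  qed
  have decay: "y j \<le> y 0 * q ^ j" for j
  proof (induction j)
    case (Suc j)
    have "q ^ j \<le> 1" using q by (simp add: power_le_one)
    moreover have "0 \<le> q ^ j" using q by simp
    ultimately have "y 0 * q ^ j \<le> 1 * 1" using y01 y0[of 0] by (intro mult_mono) auto
    with Suc have "y j \<le> 1" by linarith
    then have "y (Suc j) \<le> C * b ^ j * y j powr (1 + \<theta>)" by (rule step)
    also have "\<dots> \<le> C * b ^ j * (y 0 * q ^ j) powr (1 + \<theta>)"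
      using Suc y0 C b \<theta> by (intro mult_left_mono powr_mono2) auto
    also have "(y 0 * q ^ j) powr (1 + \<theta>) = y 0 powr (1 + \<theta>) * (q ^ j) powr (1 + \<theta>)"
      using y0[of 0] q by (simp add: powr_mult)
    also have "y 0 powr (1 + \<theta>) = y 0 * y 0 powr \<theta>"
      using powr_mult_base[OF y0[of 0], of \<theta>] by (simp add: add.commute)
    also have "(q ^ j) powr (1 + \<theta>) = q ^ j * (1 / b ^ j)"
    proof -
      have "(q ^ j) powr \<theta> = b powr (- real j)"
        unfolding q_def using \<theta> b by (simp add: powr_realpow[symmetric] powr_powr)
      also have "\<dots> = 1 / b ^ j" using b by (simp add: powr_minus_divide powr_realpow)
      finally show ?thesis using q powr_mult_base[of "q ^ j" \<theta>] by (simp add: add.commute)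
    qed
    also have "C * b ^ j * (y 0 * y 0 powr \<theta> * (q ^ j * (1 / b ^ j))) = (C * y 0 powr \<theta>) * (y 0 * q ^ j)"
      using b by simp
    also have "\<dots> \<le> q * (y 0 * q ^ j)" using Cy y0 q by (intro mult_right_mono) auto
    finally show ?case by (simp add: ac_simps)
  qed simp
  have "(\<lambda>j. y 0 * q ^ j) \<longlonglongrightarrow> y 0 * 0" using q by (intro tendsto_intros LIMSEQ_power_zero) auto
  then have lim: "(\<lambda>j. y 0 * q ^ j) \<longlonglongrightarrow> 0" by simp
  show ?thesis
    by (rule tendsto_sandwich[OF _ _ tendsto_const lim]) (use decay y0 in auto)
qed

text \<open>What remains of one step after the growth in \<open>j\<close> is split off:
  \<open>2 powr (4 * (n * p) + 4 * p)\<close> gathers the parts independent of \<open>j\<close> of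
  the cutoff loss and of the two level-gap factors. The maximum provides the lower bound one that
  the recursion lemma asks for.\<close>

definition iter_const :: "real \<Rightarrow> real \<Rightarrow> nat \<Rightarrow> real \<Rightarrow> real" where
  "iter_const c p n l = max 1 (2 powr p * 2 powr (4 * (real n * p) + 4 * p) * (c powr (1 / (1 - l)) + c / (1 - l)))"

text \<open>The starting smallness of \<open>fast_geometric_convergence\<close> for growth base
  \<open>2 powr (n * p + 2 * p)\<close>.\<close>

definition threshold :: "real \<Rightarrow> real \<Rightarrow> nat \<Rightarrow> real \<Rightarrow> real \<Rightarrow> real" where
  "threshold c p n l \<theta> = iter_const c p n l powr (- (1 / \<theta>)) * (2 powr (real n * p + 2 * p)) powr (- (1 / \<theta>\<^sup>2))"

section \<open>Recursion over levels and radii\<close>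

context weighted_ball
begin

context
  fixes p \<kappa> \<tau> l C1 \<rho> M K :: real and n m :: nat and u :: "'n \<Rightarrow> real" and G :: "'n \<Rightarrow> 'n" and h :: "'n \<Rightarrow> real"
  assumes p: "1 < p" and \<kappa>: "1 < \<kappa>" "log 2 \<gamma> * (\<kappa> - 1) < p * \<kappa>"
    and \<tau>: "1 < \<tau>" and l: "0 < l" "l < 1" "1 / \<tau> + l / \<kappa> + (1 - l) = 1"
    and poin: "poincare_with \<Omega> w p C1 \<rho>"
    and nm: "2 \<le> n" "2 \<le> m" "real m \<le> real n * p" "real n * p * l + p \<le> real m"
    and H: "H1pw p w V u G"
    and K: "0 < K"
    and h: "h \<in> borel_measurable N" "\<And>x. 0 \<le> h x" "\<And>x. x \<in> B2 \<Longrightarrow> 1 \<le> h x"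
      "integrable N (\<lambda>x. h x powr \<tau>)" "(\<integral>x. h x powr \<tau> \<partial>N) \<le> M"
    and energy: "\<And>k \<delta> r. K / 4 \<le> k \<Longrightarrow> 0 < \<delta> \<Longrightarrow> R \<le> r \<Longrightarrow> r \<le> 5 / 4 * R \<Longrightarrow>
      integrable N (\<lambda>x. of_bool (k < \<bar>indicator V x * u x\<bar>) * (cutoff x0 r x powr (real m - p)
        * \<bar>indicator V x * u x\<bar> powr p * h x)) \<Longrightarrow>
      R powr p * (\<integral>x. trunc' k \<delta> (indicator V x * u x) * cutoff x0 r x ^ m * norm (indicator V x *\<^sub>R G x) powr p \<partial>N)
      \<le> 2 * (8 * real m) powr p * (\<integral>x. of_bool (k < \<bar>indicator V x * u x\<bar>) * (cutoff x0 r x powr (real m - p)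
        * \<bar>indicator V x * u x\<bar> powr p * h x) \<partial>N)"
begin

private definition "uV x = indicator V x * u x" for x :: 'n
private definition "ex s k x = indicator (ball x0 s) x * max 0 (\<bar>uV x\<bar> - k)" for s k :: real and x :: 'n
private definition "lev s k = (\<integral>x. ex s k x powr p \<partial>N)" for s k :: real
private definition "c8 = level_const (sob_const \<gamma> p C1 \<rho> \<kappa>) p \<kappa> n m \<tau> M"

text \<open>The right-hand side of \<open>level_energy\<close> in terms of one number
  \<open>y\<close>, the excess integral over a lower level: by Chebyshev, \<open>|u|\<close> exceeds
  that level by \<open>\<delta>\<close> on a set of measure at most
  \<open>y / \<delta> powr p\<close>.\<close>

private definition "energy_bound y \<delta> = c8 powr (1 / (1 - l)) * y + c8 * (K powr p * (y / \<delta> powr p) powr (1 - 1 / \<tau>)) / (1 - l)" for y \<delta> :: real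

private lemma uV_meas [measurable]: "uV \<in> borel_measurable N"
  and uV_int: "integrable N (\<lambda>x. \<bar>uV x\<bar> powr p)"
proof -
  have Lu: "Lsw p w V u" using H unfolding H1pw_def by auto
  show "uV \<in> borel_measurable N"
    unfolding uV_def[abs_def] by (rule Lsw_imp_integrable[OF Lu V_subset(2)]) (use p in auto)
  show "integrable N (\<lambda>x. \<bar>uV x\<bar> powr p)"
    unfolding uV_def by (rule Lsw_imp_integrable(2)[OF Lu V_subset(2)]) (use p in auto)
qed

private lemma ex_meas [measurable]: "ex s k \<in> borel_measurable N"
  unfolding ex_def[abs_def] by measurable

private lemma ex_nonneg: "0 \<le> ex s k x"
  unfolding ex_def by simp

private lemma ex_mono: "s \<le> s' \<Longrightarrow> k' \<le> k \<Longrightarrow> ex s k x \<le> ex s' k' x"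
  unfolding ex_def by (auto simp: indicator_def)

private lemma ex_le: "0 \<le> k \<Longrightarrow> ex s k x \<le> \<bar>uV x\<bar>"
  unfolding ex_def by (auto simp: indicator_def)

private lemma ex_int:
  assumes "0 \<le> k" shows "integrable N (\<lambda>x. ex s k x powr p)"
proof (rule Bochner_Integration.integrable_bound[OF uV_int])
  show "AE x in N. norm (ex s k x powr p) \<le> norm (\<bar>uV x\<bar> powr p)"
    using p ex_le[OF assms] ex_nonneg by (intro AE_I2) (auto intro!: powr_mono2)
qed measurable

private lemma lev_nonneg: "0 \<le> lev s k"
  unfolding lev_def by simp

private lemma lev_mono: "s \<le> s' \<Longrightarrow> 0 \<le> k' \<Longrightarrow> k' \<le> k \<Longrightarrow> lev s k \<le> lev s' k'"
  unfolding lev_def using p by (intro integral_mono ex_int powr_mono2 ex_mono ex_nonneg) auto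

private lemma c8_nonneg: "0 \<le> c8"
  unfolding c8_def level_const_def energy_const_def by simp

private lemma energy_bound_nonneg: "0 \<le> energy_bound (lev s k) \<delta>"
  unfolding energy_bound_def using l c8_nonneg lev_nonneg
  by (intro add_nonneg_nonneg mult_nonneg_nonneg divide_nonneg_nonneg) auto

text \<open>Three levels are used and the truncation sits at the middle one. The gap below it yields
  Chebyshev for the set \<open>A\<close>; the gap above it ensures that the smoothed truncation is
  at least half of the true excess. On the smaller ball the cutoff is at least
  \<open>(r - r') / r\<close>, and Hoelder with the indicator of \<open>A\<close> contributes the
  factor with exponent \<open>1 - 1 / \<kappa>\<close>.\<close>

private lemma level_step:
  assumes k0: "0 \<le> k0" and \<delta>: "0 < \<delta>" "K / 4 \<le> k0 + \<delta>" "k0 + 2 * \<delta> \<le> K"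
    and r: "R \<le> r'" "r' < r" "r \<le> 5 / 4 * R"
  shows "lev r' (k0 + 2 * \<delta>) \<le> 2 powr p * ((r / (r - r')) ^ n) powr p *
    energy_bound (lev r k0) \<delta>
    * (lev r k0 / \<delta> powr p) powr (1 - 1 / \<kappa>)"
proof -
  define k where "k = k0 + \<delta>"
  have k: "0 \<le> k" "K / 4 \<le> k" "k + \<delta> \<le> K" using k0 \<delta> by (auto simp: k_def)
  have r0: "0 < r" "R \<le> r" using r radius_pos by auto
  define F where "F x = \<bar>trunc k \<delta> (uV x)\<bar>" for x
  define X where "X x = (cutoff x0 r x ^ n * F x) powr p" for x
  define A where "A = {x. k < \<bar>uV x\<bar>} \<inter> ball x0 r"
  define S where "S = (\<integral>x. X x powr \<kappa> \<partial>N) powr (1 / \<kappa>)"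
  define Y where "Y = (\<integral>x. indicator (ball x0 r) x * F x powr p \<partial>N)"
  note LE = level_energy[OF p \<kappa> \<tau> l poin nm H K k(2,3) \<delta>(1) r0(2) r(3) h energy[OF k(2) \<delta>(1) r0(2) r(3)]]
  have iX: "integrable N (\<lambda>x. X x powr \<kappa>)" using LE(1) unfolding X_def F_def uV_def by blast
  have S: "S \<le> c8 powr (1 / (1 - l)) * Y + c8 * (K powr p * measure N A powr (1 - 1 / \<tau>)) / (1 - l)"
    using LE(2) unfolding S_def X_def F_def Y_def A_def c8_def uV_def by blast
  have "continuous_on UNIV (trunc k \<delta>)"
    by (rule continuous_at_imp_continuous_on) (auto intro: DERIV_isCont trunc_derivative[OF \<delta>(1)])
  then have [measurable]: "trunc k \<delta> \<in> borel_measurable borel" by (rule borel_measurable_continuous_onI)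
  have [measurable]: "F \<in> borel_measurable N" unfolding F_def[abs_def] by measurable
  have "{x \<in> space N. k < \<bar>uV x\<bar>} \<in> sets N" by measurable
  then have Am [measurable]: "A \<in> sets N" unfolding A_def by (intro sets.Int) auto
  have iA: "integrable N (indicator A :: 'n \<Rightarrow> real)" by (rule integrable_real_indicator) (auto simp: emeasure_eq_measure)
  have F_le: "indicator (ball x0 r) x * F x powr p \<le> ex r k0 x powr p" for x
  proof (cases "x \<in> ball x0 r \<and> k < \<bar>uV x\<bar>")
    case True
    have "F x \<le> \<bar>uV x\<bar> - k"
      unfolding F_def using trunc_above(1)[OF \<delta>(1) k(1), of "uV x"] ramp_le[OF \<delta>(1), of "\<bar>uV x\<bar> - k"] True by simp
    also have "\<dots> \<le> ex r k0 x" using True \<delta> by (simp add: ex_def k_def)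
    finally show ?thesis using True p by (auto simp: F_def intro!: powr_mono2)
  next
    case False
    then have "indicator (ball x0 r) x * F x powr p = 0"
      using trunc_below[OF \<delta>(1), of "uV x" k] by (auto simp: F_def)
    then show ?thesis using powr_ge_zero[of "ex r k0 x" p] by linarith
  qed
  have Yle: "Y \<le> lev r k0"
  proof -
    have "integrable N (\<lambda>x. indicator (ball x0 r) x * F x powr p)"
      by (rule Bochner_Integration.integrable_bound[OF ex_int[OF k0]]) (use F_le in \<open>auto simp: F_def\<close>)
    then show ?thesis unfolding Y_def lev_def by (intro integral_mono ex_int k0 F_le)
  qed
  have ale: "measure N A \<le> lev r k0 / \<delta> powr p"
  proof -
    have "\<delta> powr p * measure N A = (\<integral>x. \<delta> powr p * indicator A x \<partial>N)" by simp
    also have "\<dots> \<le> lev r k0"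
      unfolding lev_def
    proof (intro integral_mono ex_int k0)
      show "\<delta> powr p * indicator A x \<le> ex r k0 x powr p" for x
        using \<delta> p by (auto simp: A_def ex_def k_def indicator_def intro!: powr_mono2)
    qed (use iA in auto)
    finally show ?thesis using \<delta> by (simp add: field_simps)
  qed
  define q where "q = r / (r - r')"
  have q: "0 < q" unfolding q_def using r r0 by simp
  have pw: "ex r' (k0 + 2 * \<delta>) x powr p \<le> 2 powr p * (q ^ n) powr p * ((X x powr \<kappa>) powr (1 / \<kappa>) * indicator A x powr (1 - 1 / \<kappa>))" for x
  proof (cases "x \<in> ball x0 r' \<and> k0 + 2 * \<delta> < \<bar>uV x\<bar>")
    case True
    have xr: "x \<in> ball x0 r" using True r subset_ball[of r' r x0] by auto
    have xA: "x \<in> A" using True xr \<delta> by (simp add: A_def k_def)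
    have e: "(r - r') / r \<le> cutoff x0 r x"
      by (rule cutoff_ge) (use True r r0 in \<open>auto simp: dist_norm norm_minus_commute\<close>)
    have "1 = q * ((r - r') / r)" unfolding q_def using r r0 by simp
    also have "\<dots> \<le> q * cutoff x0 r x" using e q by (intro mult_left_mono) auto
    finally have "1 \<le> (q * cutoff x0 r x) ^ n" by (rule one_le_power)
    then have e1: "1 \<le> q ^ n * cutoff x0 r x ^ n" by (simp add: power_mult_distrib)
    have F: "(\<bar>uV x\<bar> - k) / 2 \<le> F x"
      unfolding F_def by (rule abs_trunc_ge[OF \<delta>(1) k(1)]) (use True in \<open>simp add: k_def\<close>)
    have F0: "0 \<le> F x" by (simp add: F_def)
    have "ex r' (k0 + 2 * \<delta>) x \<le> 2 * F x * 1" using True F \<delta> by (simp add: ex_def k_def)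
    also have "\<dots> \<le> 2 * F x * (q ^ n * cutoff x0 r x ^ n)" using e1 F0 by (intro mult_left_mono) auto
    also have "\<dots> = 2 * q ^ n * (cutoff x0 r x ^ n * F x)" by simp
    finally have "ex r' (k0 + 2 * \<delta>) x powr p \<le> (2 * q ^ n * (cutoff x0 r x ^ n * F x)) powr p"
      using p ex_nonneg by (intro powr_mono2) auto
    also have "\<dots> = 2 powr p * (q ^ n) powr p * X x"
      unfolding X_def using q F0 cutoff_bounds(1)[of x0 r x] by (subst powr_mult | simp)+
    also have "X x = (X x powr \<kappa>) powr (1 / \<kappa>)" using \<kappa> by (simp add: powr_powr X_def)
    finally show ?thesis using xA by simp
  next
    case False
    then have "ex r' (k0 + 2 * \<delta>) x = 0" by (auto simp: ex_def)
    then show ?thesis by simp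
  qed
  have \<kappa>': "0 < 1 / \<kappa>" "0 < 1 - 1 / \<kappa>" "1 / \<kappa> + (1 - 1 / \<kappa>) = 1" using \<kappa> by auto
  note H2 = holder2[OF iX _ iA _ \<kappa>']
  have i2: "integrable N (\<lambda>x. (X x powr \<kappa>) powr (1 / \<kappa>) * indicator A x powr (1 - 1 / \<kappa>))" by (rule H2(1)) auto
  have "lev r' (k0 + 2 * \<delta>) \<le> (\<integral>x. 2 powr p * (q ^ n) powr p * ((X x powr \<kappa>) powr (1 / \<kappa>) * indicator A x powr (1 - 1 / \<kappa>)) \<partial>N)"
    unfolding lev_def using k0 \<delta> by (intro integral_mono ex_int pw integrable_mult_right i2) auto
  also have "\<dots> = 2 powr p * (q ^ n) powr p * (\<integral>x. (X x powr \<kappa>) powr (1 / \<kappa>) * indicator A x powr (1 - 1 / \<kappa>) \<partial>N)"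
    by simp
  also have "\<dots> \<le> 2 powr p * (q ^ n) powr p * (S * measure N A powr (1 - 1 / \<kappa>))"
  proof (intro mult_left_mono)
    have "(\<integral>x. (X x powr \<kappa>) powr (1 / \<kappa>) * indicator A x powr (1 - 1 / \<kappa>) \<partial>N) \<le> S * (\<integral>x. indicator A x \<partial>N) powr (1 - 1 / \<kappa>)"
      unfolding S_def by (rule H2(2)) auto
    then show "(\<integral>x. (X x powr \<kappa>) powr (1 / \<kappa>) * indicator A x powr (1 - 1 / \<kappa>) \<partial>N) \<le> S * measure N A powr (1 - 1 / \<kappa>)"
      by simp
  qed simp
  also have "\<dots> \<le> 2 powr p * (q ^ n) powr p * (energy_bound (lev r k0) \<delta> * (lev r k0 / \<delta> powr p) powr (1 - 1 / \<kappa>))"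
  proof (intro mult_left_mono mult_mono)
    have "c8 powr (1 / (1 - l)) * Y \<le> c8 powr (1 / (1 - l)) * lev r k0" by (intro mult_left_mono Yle) simp
    moreover have "c8 * (K powr p * measure N A powr (1 - 1 / \<tau>)) / (1 - l)
        \<le> c8 * (K powr p * (lev r k0 / \<delta> powr p) powr (1 - 1 / \<tau>)) / (1 - l)"
      using l \<tau> ale c8_nonneg by (intro divide_right_mono mult_left_mono powr_mono2) auto
    ultimately show "S \<le> energy_bound (lev r k0) \<delta>"
      using S unfolding energy_bound_def by linarith
    show "measure N A powr (1 - 1 / \<kappa>) \<le> (lev r k0 / \<delta> powr p) powr (1 - 1 / \<kappa>)"
      using \<kappa> ale by (intro powr_mono2) auto
    show "0 \<le> energy_bound (lev r k0) \<delta>" by (rule energy_bound_nonneg)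
  qed simp_all
  finally show ?thesis unfolding q_def by (simp add: mult.assoc)
qed

theorem sup_bound:
  assumes \<theta>: "0 < 1 - 1 / \<tau> - 1 / \<kappa>"
    and small: "(\<integral>x. \<bar>indicator V x * u x\<bar> powr p \<partial>N)
      \<le> K powr p * threshold (level_const (sob_const \<gamma> p C1 \<rho> \<kappa>) p \<kappa> n m \<tau> M) p n l (1 - 1 / \<tau> - 1 / \<kappa>)"
  shows "AE x in lebesgue. x \<in> ball x0 R \<longrightarrow> \<bar>u x\<bar> \<le> K"
proof -
  define th where "th = 1 - 1 / \<tau> - 1 / \<kappa>"
  define C where "C = iter_const c8 p n l"
  define b where "b = 2 powr (real n * p + 2 * p)"
  define r where "r j = R * (1 + 1 / (4 * 2 ^ j))" for j :: nat
  define k where "k j = K * (1 - 1 / 2 ^ j)" for j :: nat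
  define y where "y j = lev (r j) (k j) / K powr p" for j :: nat
  have Kp: "0 < K powr p" using K by simp
  have lim: "y \<longlonglongrightarrow> 0"
  proof (rule fast_geometric_convergence[of C b th])
    show "1 \<le> C" unfolding C_def iter_const_def by simp
    show "1 < b" unfolding b_def using p nm by (intro gr_one_powr) (auto intro: add_nonneg_pos)
    show "0 < th" using \<theta> unfolding th_def .
    show "0 \<le> y j" for j unfolding y_def using lev_nonneg by simp
    show "y 0 \<le> C powr (- (1 / th)) * b powr (- (1 / th\<^sup>2))"
    proof -
      have "lev (r 0) (k 0) \<le> (\<integral>x. \<bar>uV x\<bar> powr p \<partial>N)"
        unfolding lev_def k_def using p ex_le[of 0] ex_nonneg
        by (intro integral_mono ex_int uV_int powr_mono2) auto
      also have "\<dots> \<le> K powr p * threshold c8 p n l th"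
        using small unfolding uV_def c8_def th_def .
      finally show ?thesis
        unfolding y_def threshold_def C_def b_def using Kp by (simp add: pos_divide_le_eq mult.commute)
    qed
    fix j assume y1: "y j \<le> 1"
    \<comment> \<open>Half of the gap between consecutive levels, as \<open>level_step\<close>
      climbs \<open>2 * \<delta>\<close>. For \<open>j = 0\<close> the middle level is exactly
      \<open>K / 4\<close>, the lower bound for truncation levels on which the energy estimate
      relies.\<close>
    define \<delta> where "\<delta> = K / 2 ^ (j + 2)"
    define a where "a = (2 ^ (j + 2) :: real)"
    have a: "1 \<le> a" unfolding a_def by (rule one_le_power) simp
    have \<delta>: "0 < \<delta>" unfolding \<delta>_def using K by simp
    have k0: "0 \<le> k j" unfolding k_def using K by (simp add: one_le_power)
    have k1: "k j + 2 * \<delta> = k (Suc j)" unfolding k_def \<delta>_def by (simp add: field_simps)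
    have kK: "k (Suc j) \<le> K" unfolding k_def using K by (simp add: mult_left_le)
    have k4: "K / 4 \<le> k j + \<delta>"
    proof (cases j)
      case (Suc i)
      have "(2::real) \<le> 2 ^ j" using power_increasing[of 1 j "2::real"] Suc by simp
      then have "1 / 2 ^ j \<le> (1 / 2 :: real)" by (intro divide_left_mono) auto
      then have "K * (1 / 2) \<le> k j" unfolding k_def using K by (intro mult_left_mono) auto
      then show ?thesis using \<delta> K by linarith
    qed (simp add: k_def \<delta>_def)
    have rj: "R \<le> r (Suc j)" "r (Suc j) < r j" "r j \<le> 5 / 4 * R"
    proof -
      show "R \<le> r (Suc j)" unfolding r_def using radius_pos by simp
      show "r (Suc j) < r j" unfolding r_def using radius_pos by (intro mult_strict_left_mono add_strict_left_mono divide_strict_left_mono) auto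
      have "1 / (4 * 2 ^ j) \<le> (1 / 4 :: real)" by (intro divide_left_mono) auto
      then have "R * (1 + 1 / (4 * 2 ^ j)) \<le> R * (1 + 1 / 4)" using radius_pos by (intro mult_left_mono) auto
      then show "r j \<le> 5 / 4 * R" unfolding r_def by simp
    qed
    define q where "q = r j / (r j - r (Suc j))"
    have q: "0 \<le> q" "q \<le> 4 * a"
    proof -
      have d: "r j - r (Suc j) = R / (8 * 2 ^ j)" unfolding r_def by (simp add: field_simps)
      show "0 \<le> q" unfolding q_def using rj radius_pos by auto
      have "q \<le> (5 / 4 * R) / (R / (8 * 2 ^ j))"
        unfolding q_def d using rj radius_pos by (intro divide_right_mono) auto
      also have "\<dots> = 10 * 2 ^ j" using radius_pos by simp
      also have "\<dots> \<le> 4 * a" unfolding a_def by simp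
      finally show "q \<le> 4 * a" .
    qed
    have st: "lev (r (Suc j)) (k (Suc j)) \<le> 2 powr p * (q ^ n) powr p *
      energy_bound (lev (r j) (k j)) \<delta>
      * (lev (r j) (k j) / \<delta> powr p) powr (1 - 1 / \<kappa>)"
      using level_step[OF k0 \<delta> k4 _ rj] kK unfolding k1 q_def by simp
    have lv: "lev (r j) (k j) = K powr p * y j" unfolding y_def using Kp by simp
    have yn: "0 \<le> y j" unfolding y_def using lev_nonneg by simp
    have ld: "lev (r j) (k j) / \<delta> powr p = a powr p * y j"
      unfolding lv \<delta>_def a_def using K by (simp add: powr_divide)
    define B where "B = a powr p"
    have B: "1 \<le> B" unfolding B_def using a p by (simp add: ge_one_powr_ge_zero)
    have e\<tau>: "0 < 1 - 1 / \<tau>" "1 - 1 / \<tau> \<le> 1" and e\<kappa>: "0 < 1 - 1 / \<kappa>" "1 - 1 / \<kappa> \<le> 1" using \<tau> \<kappa> by auto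
    have B1: "B powr (1 - 1 / \<tau>) \<le> B" "B powr (1 - 1 / \<kappa>) \<le> B"
      using powr_mono[OF e\<tau>(2) B] powr_mono[OF e\<kappa>(2) B] B by auto
    \<comment> \<open>This is where \<open>y j \<le> 1\<close> is used: the linear term of
      \<open>energy_bound\<close> is raised to the smaller exponent of the other term.\<close>
    have yt: "y j \<le> y j powr (1 - 1 / \<tau>)"
      using powr_mono'[OF e\<tau>(2) yn y1] yn by simp
    have y\<tau>: "y j \<le> B * y j powr (1 - 1 / \<tau>)"
      using yt B mult_right_mono[OF B, of "y j powr (1 - 1 / \<tau>)"] by simp
    define c9 where "c9 = c8 powr (1 / (1 - l)) + c8 / (1 - l)"
    have c9: "0 \<le> c9" unfolding c9_def using c8_nonneg l by auto
    have "energy_bound (lev (r j) (k j)) \<delta>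
      = K powr p * (c8 powr (1 / (1 - l)) * y j + c8 / (1 - l) * (B powr (1 - 1 / \<tau>) * y j powr (1 - 1 / \<tau>)))"
      unfolding energy_bound_def ld unfolding lv B_def using yn by (simp add: powr_mult distrib_left ac_simps)
    also have "\<dots> \<le> K powr p * (c8 powr (1 / (1 - l)) * (B * y j powr (1 - 1 / \<tau>)) + c8 / (1 - l) * (B * y j powr (1 - 1 / \<tau>)))"
      using y\<tau> B1 c8_nonneg l by (intro mult_left_mono add_mono mult_right_mono) auto
    also have "\<dots> = K powr p * (c9 * B * y j powr (1 - 1 / \<tau>))" unfolding c9_def by (simp add: algebra_simps)
    finally have i1: "energy_bound (lev (r j) (k j)) \<delta>
      \<le> K powr p * (c9 * B * y j powr (1 - 1 / \<tau>))" .
    have i2: "(lev (r j) (k j) / \<delta> powr p) powr (1 - 1 / \<kappa>) \<le> B * y j powr (1 - 1 / \<kappa>)"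
      unfolding ld B_def[symmetric] using B B1 yn by (simp add: powr_mult mult_right_mono)
    have i3: "(q ^ n) powr p \<le> ((4 * a) ^ n) powr p"
      using q p by (intro powr_mono2 power_mono) auto
    have "lev (r (Suc j)) (k (Suc j)) \<le> 2 powr p * ((4 * a) ^ n) powr p * (K powr p * (c9 * B * y j powr (1 - 1 / \<tau>))) * (B * y j powr (1 - 1 / \<kappa>))"
    proof (rule order_trans[OF st])
      have "2 powr p * (q ^ n) powr p * energy_bound (lev (r j) (k j)) \<delta>
        \<le> 2 powr p * ((4 * a) ^ n) powr p * (K powr p * (c9 * B * y j powr (1 - 1 / \<tau>)))"
      proof (rule mult_mono[OF _ i1])
        show "2 powr p * (q ^ n) powr p \<le> 2 powr p * ((4 * a) ^ n) powr p" using i3 by (rule mult_left_mono) simp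
        show "0 \<le> energy_bound (lev (r j) (k j)) \<delta>" by (rule energy_bound_nonneg)
      qed simp
      then show "2 powr p * (q ^ n) powr p * energy_bound (lev (r j) (k j)) \<delta>
         * (lev (r j) (k j) / \<delta> powr p) powr (1 - 1 / \<kappa>)
        \<le> 2 powr p * ((4 * a) ^ n) powr p * (K powr p * (c9 * B * y j powr (1 - 1 / \<tau>))) * (B * y j powr (1 - 1 / \<kappa>))"
        by (rule mult_mono[OF _ i2]) (use c9 B in auto)
    qed
    also have "\<dots> = K powr p * (2 powr p * (((4 * a) ^ n) powr p * B * B) * c9 * (y j powr (1 - 1 / \<tau>) * y j powr (1 - 1 / \<kappa>)))"
      by (simp add: ac_simps)
    \<comment> \<open>The superlinear exponent: the power from the energy bound and the one from
      Hoelder add up to \<open>2 - 1 / \<tau> - 1 / \<kappa> = 1 + th\<close>.\<close>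
    also have "y j powr (1 - 1 / \<tau>) * y j powr (1 - 1 / \<kappa>) = y j powr (1 + th)"
      unfolding th_def by (simp add: powr_add[symmetric])
    also have "((4 * a) ^ n) powr p * B * B = 2 powr (4 * (real n * p) + 4 * p) * b ^ j"
    proof -
      have a2: "a = 2 powr (real j + 2)" unfolding a_def by (simp add: powr_add powr_realpow)
      have "4 * a = 2 powr (real j + 4)" unfolding a2 by (simp add: powr_add)
      then have 1: "((4 * a) ^ n) powr p = 2 powr ((real j + 4) * real n * p)"
        by (simp add: powr_realpow[symmetric] powr_powr)
      have 2: "B = 2 powr ((real j + 2) * p)" unfolding B_def a2 by (simp add: powr_powr)
      have 3: "b ^ j = 2 powr ((real n * p + 2 * p) * real j)"
        unfolding b_def by (simp add: powr_realpow[symmetric] powr_powr)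
      have e: "(real j + 4) * real n * p + (real j + 2) * p + (real j + 2) * p
          = 4 * (real n * p) + 4 * p + (real n * p + 2 * p) * real j"
        by (simp add: algebra_simps)
      have "((4 * a) ^ n) powr p * B * B = 2 powr ((real j + 4) * real n * p + (real j + 2) * p + (real j + 2) * p)"
        unfolding 1 2 by (simp only: powr_add)
      also have "\<dots> = 2 powr (4 * (real n * p) + 4 * p) * b ^ j" unfolding e 3 by (simp only: powr_add)
      finally show ?thesis .
    qed
    finally have "y (Suc j) \<le> (2 powr p * 2 powr (4 * (real n * p) + 4 * p) * c9) * b ^ j * y j powr (1 + th)"
      unfolding y_def[of "Suc j"] using Kp by (simp add: pos_divide_le_eq ac_simps)
    also have "\<dots> \<le> C * b ^ j * y j powr (1 + th)"
    proof (intro mult_right_mono)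
      show "2 powr p * 2 powr (4 * (real n * p) + 4 * p) * c9 \<le> C"
        unfolding C_def iter_const_def c9_def by simp
    qed (auto simp: b_def)
    finally show "y (Suc j) \<le> C * b ^ j * y j powr (1 + th)" .
  qed
  have "lev R K \<le> K powr p * y j" for j
  proof -
    have "lev R K \<le> lev (r j) (k j)"
      using K radius_pos by (intro lev_mono) (auto simp: r_def k_def one_le_power mult_left_le)
    then show ?thesis unfolding y_def using Kp by simp
  qed
  moreover have "(\<lambda>j. K powr p * y j) \<longlonglongrightarrow> K powr p * 0" by (intro tendsto_intros lim)
  ultimately have "lev R K \<le> K powr p * 0" by (intro LIMSEQ_le_const) auto
  then have "lev R K = 0" using lev_nonneg[of R K] by simp
  then have "AE x in N. ex R K x powr p = 0"
    using integral_nonneg_eq_0_iff_AE[OF ex_int[of K R]] K unfolding lev_def by simp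
  then have "AE x in lebesgue. x \<in> B2 \<longrightarrow> ex R K x powr p = 0" by (simp add: AE_N_iff)
  then show ?thesis
  proof eventually_elim
    case (elim x)
    show ?case
    proof
      assume x: "x \<in> ball x0 R"
      have "x \<in> V" "x \<in> B2" using x radius_pos by auto
      then have "ex R K x = 0" "uV x = u x" using elim by (auto simp: uV_def)
      then show "\<bar>u x\<bar> \<le> K" using x by (simp add: ex_def)
    qed
  qed
qed

end

end

section \<open>Local boundedness\<close>

text \<open>For a fixed ball the inequality reads \<open>b \<le> \<gamma> * a\<close> with finite
  masses and is closed in \<open>\<gamma>\<close>, so it survives the infimum. The least constant is
  itself a doubling constant, and its logarithm is usable as the dimension.\<close>

lemma doubling_with_gamma_w:
  assumes w: "is_weight \<Omega> w" and ex: "\<exists>\<gamma>>0. doubling_with \<Omega> w \<gamma>"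
  shows "doubling_with \<Omega> w (gamma_w \<Omega> w)" "0 \<le> gamma_w \<Omega> w"
proof -
  define S where "S = {\<gamma>. 0 < \<gamma> \<and> doubling_with \<Omega> w \<gamma>}"
  have S: "S \<noteq> {}" using ex unfolding S_def by auto
  have g: "gamma_w \<Omega> w = Inf S" unfolding gamma_w_def S_def ..
  show "0 \<le> gamma_w \<Omega> w" unfolding g by (rule cInf_greatest[OF S]) (auto simp: S_def)
  show "doubling_with \<Omega> w (gamma_w \<Omega> w)"
    unfolding doubling_with_def
  proof (intro allI impI)
    fix x r assume r: "0 < r \<and> ball x (2 * r) \<subseteq> \<Omega>"
    have "cball x r \<subseteq> ball x (2 * r)" using r by (auto simp: subset_iff)
    then have i: "set_integrable lebesgue (cball x r) w" using w r unfolding is_weight_def by auto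
    have "wmeas w (ball x r) \<le> (\<integral>\<^sup>+y. ennreal (norm (indicator (cball x r) y *\<^sub>R w y)) \<partial>lebesgue)"
      unfolding wmeas_def by (intro nn_integral_mono ennreal_leI) (auto simp: indicator_def)
    also have "\<dots> < \<infinity>" using i unfolding set_integrable_def integrable_iff_bounded by simp
    finally obtain a where a: "wmeas w (ball x r) = ennreal a" "0 \<le> a" by (cases "wmeas w (ball x r)") auto
    have dS: "wmeas w (ball x (2 * r)) \<le> ennreal (\<gamma> * a)" if "\<gamma> \<in> S" for \<gamma>
    proof -
      have "wmeas w (ball x (2 * r)) \<le> ennreal \<gamma> * wmeas w (ball x r)"
        using that r unfolding S_def doubling_with_def by blast
      then show ?thesis unfolding a(1) using that a(2) by (simp add: S_def ennreal_mult)
    qed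
    obtain \<gamma>0 where "\<gamma>0 \<in> S" using S by auto
    from dS[OF this] have "wmeas w (ball x (2 * r)) < \<infinity>" by (simp add: le_less_trans)
    then obtain b where b: "wmeas w (ball x (2 * r)) = ennreal b" "0 \<le> b" by (cases "wmeas w (ball x (2 * r))") auto
    have le: "b \<le> \<gamma> * a" if "\<gamma> \<in> S" for \<gamma>
    proof -
      have "0 \<le> \<gamma> * a" using that a by (simp add: S_def)
      then show ?thesis using dS[OF that] unfolding b(1) by (simp add: ennreal_le_iff)
    qed
    have "b \<le> gamma_w \<Omega> w * a"
    proof (cases "a = 0")
      case True
      then show ?thesis using le[OF \<open>\<gamma>0 \<in> S\<close>] by simp
    next
      case False
      then have "0 < a" using a by simp
      then have "b / a \<le> Inf S" using le by (intro cInf_greatest[OF S]) (simp add: pos_divide_le_eq)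
      then show ?thesis using \<open>0 < a\<close> unfolding g by (simp add: pos_divide_le_eq)
    qed
    then show "wmeas w (ball x (2 * r)) \<le> ennreal (gamma_w \<Omega> w) * wmeas w (ball x r)"
      unfolding a(1) b(1) using \<open>0 \<le> gamma_w \<Omega> w\<close> a(2) by (simp add: ennreal_mult[symmetric] ennreal_leI)
  qed
qed

lemma powr_sum7_le:
  fixes a1 a2 a3 a4 a5 a6 a7 t :: real
  assumes "0 \<le> a1" "0 \<le> a2" "0 \<le> a3" "0 \<le> a4" "0 \<le> a5" "0 \<le> a6" "0 \<le> a7" and t: "0 \<le> t"
  shows "(a1 + a2 + a3 + a4 + a5 + a6 + a7) powr t
    \<le> 7 powr t * (a1 powr t + a2 powr t + a3 powr t + a4 powr t + a5 powr t + a6 powr t + a7 powr t)"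
proof -
  define mx where "mx = Max {a1, a2, a3, a4, a5, a6, a7}"
  have le: "a1 \<le> mx" "a2 \<le> mx" "a3 \<le> mx" "a4 \<le> mx" "a5 \<le> mx" "a6 \<le> mx" "a7 \<le> mx"
    unfolding mx_def by (rule Max_ge; simp)+
  have mem: "mx \<in> {a1, a2, a3, a4, a5, a6, a7}" unfolding mx_def by (rule Max_in) auto
  have "(a1 + a2 + a3 + a4 + a5 + a6 + a7) powr t \<le> (7 * mx) powr t"
    using assms le by (intro powr_mono2) auto
  also have "\<dots> = 7 powr t * mx powr t" using assms le by (simp add: powr_mult)
  also have "\<dots> \<le> 7 powr t * (a1 powr t + a2 powr t + a3 powr t + a4 powr t + a5 powr t + a6 powr t + a7 powr t)"
    using mem by (intro mult_left_mono) auto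
  finally show ?thesis .
qed

text \<open>Lowers an exponent at the cost of a constant, harmless for mass one; it brings
  \<open>b\<close>, \<open>c\<close> and \<open>e\<close> to the common exponent
  \<open>\<tau>\<close>.\<close>

lemma powr_le_one_plus_powr:
  fixes x s t :: real
  assumes "0 \<le> x" "0 \<le> t" "t \<le> s"
  shows "x powr t \<le> 1 + x powr s"
proof (cases "x \<le> 1")
  case True
  then have "x powr t \<le> 1" using assms by (intro powr_le1) auto
  then show ?thesis using powr_ge_zero[of x s] by linarith
next
  case False
  then have "x powr t \<le> x powr s" using assms by (intro powr_mono) auto
  then show ?thesis by linarith
qed

context weighted_ball
begin

lemma Lsw_Omega_imp_integrable:
  assumes L: "Lsw s w \<Omega> q"
  shows "integrable N (\<lambda>x. indicator B2 x * \<bar>q x\<bar> powr s)"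
    and "wavg w B2 (\<lambda>x. \<bar>q x\<bar> powr s) = (\<integral>x. indicator B2 x * \<bar>q x\<bar> powr s \<partial>N)"
    and "0 \<le> wavg w B2 (\<lambda>x. \<bar>q x\<bar> powr s)"
proof -
  have "(\<lambda>x. indicator \<Omega> x *\<^sub>R q x) \<in> borel_measurable lebesgue"
    using L unfolding Lsw_def set_borel_measurable_def by simp
  then have "(\<lambda>x. indicator B2 x * \<bar>indicator \<Omega> x *\<^sub>R q x\<bar> powr s) \<in> borel_measurable lebesgue"
    by measurable
  moreover have "(\<lambda>x. indicator B2 x * \<bar>indicator \<Omega> x *\<^sub>R q x\<bar> powr s) = (\<lambda>x. indicator B2 x * \<bar>q x\<bar> powr s)"
  proof (rule ext)
    show "indicator B2 x * \<bar>indicator \<Omega> x *\<^sub>R q x\<bar> powr s = indicator B2 x * \<bar>q x\<bar> powr s" for x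
    proof (cases "x \<in> B2")
      case True
      then have "x \<in> \<Omega>" using ball_subset by blast
      then show ?thesis by simp
    qed simp
  qed
  ultimately have m: "(\<lambda>x. indicator B2 x * \<bar>q x\<bar> powr s) \<in> borel_measurable lebesgue" by (simp only:)
  have "set_integrable lebesgue \<Omega> (\<lambda>x. \<bar>q x\<bar> powr s * w x)" using L unfolding Lsw_def by simp
  then have "set_integrable lebesgue B2 (\<lambda>x. \<bar>q x\<bar> powr s * w x)"
    by (rule set_integrable_subset) (use ball_subset in auto)
  then show "integrable N (\<lambda>x. indicator B2 x * \<bar>q x\<bar> powr s)" by (subst (asm) N_conversion(2)[OF m]) auto
  show w: "wavg w B2 (\<lambda>x. \<bar>q x\<bar> powr s) = (\<integral>x. indicator B2 x * \<bar>q x\<bar> powr s \<partial>N)" by (rule wavg_B2[OF m])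
  show "0 \<le> wavg w B2 (\<lambda>x. \<bar>q x\<bar> powr s)" unfolding w by (intro integral_nonneg_AE) auto
qed

text \<open>The hypotheses \<open>eR\<close>, \<open>fR\<close>, \<open>gR\<close> hold as soon as
  \<open>K\<close> dominates the data term of the claim, and they make the contributions of
  \<open>e\<close>, \<open>f\<close>, \<open>g\<close> at most one each. The resulting bound is free
  of \<open>K\<close>, which is essential because \<open>K\<close> is later chosen in terms of the
  solution.\<close>

lemma coef_norm:
  assumes p: "1 < p" and K: "0 < K" and \<tau>: "1 < \<tau>" "\<tau> \<le> s1" "p * \<tau> \<le> s2"
    and str: "structure_conditions \<Omega> w p A B b c d e f g"
    and L: "Lsw s1 w \<Omega> b" "Lsw s2 w \<Omega> c" "Lsw \<tau> w \<Omega> d" "Lsw s1 w \<Omega> e" "Lsw \<tau> w \<Omega> f" "Lsw \<tau> w \<Omega> g"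
    and eR: "R powr (p - 1) * wavg w B2 (\<lambda>x. \<bar>e x\<bar> powr s1) powr (1 / s1) \<le> K powr (p - 1)"
    and fR: "R powr p * wavg w B2 (\<lambda>x. \<bar>f x\<bar> powr \<tau>) powr (1 / \<tau>) \<le> K powr (p - 1)"
    and gR: "R powr p * wavg w B2 (\<lambda>x. \<bar>g x\<bar> powr \<tau>) powr (1 / \<tau>) \<le> K powr p"
  shows "integrable N (\<lambda>x. (indicator B2 x * coef p R K (b x) (c x) (d x) (e x) (f x) (g x)) powr \<tau>)" (is ?int)
    and "(\<integral>x. (indicator B2 x * coef p R K (b x) (c x) (d x) (e x) (f x) (g x)) powr \<tau> \<partial>N) \<le>
      7 powr \<tau> * (7 + (R powr (p - 1) * wavg w B2 (\<lambda>x. \<bar>b x\<bar> powr s1) powr (1 / s1)) powr s1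
        + (R * wavg w B2 (\<lambda>x. \<bar>c x\<bar> powr s2) powr (1 / s2)) powr s2
        + (R powr p * wavg w B2 (\<lambda>x. \<bar>d x\<bar> powr \<tau>) powr (1 / \<tau>)) powr \<tau>)"
proof -
  define H where "H x = indicator B2 x * coef p R K (b x) (c x) (d x) (e x) (f x) (g x)" for x
  note mH [measurable] = coef_measurable[OF str, of K, folded H_def]
  define q where "q h s x = indicator B2 x * \<bar>h x\<bar> powr s" for h :: "'n \<Rightarrow> real" and s :: real and x
  define I where "I h s = wavg w B2 (\<lambda>x. \<bar>h x\<bar> powr s)" for h s
  note int = Lsw_Omega_imp_integrable(1)[folded q_def]
  note wav = Lsw_Omega_imp_integrable(2)[folded q_def I_def]
  note I0 = Lsw_Omega_imp_integrable(3)[folded I_def]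
  have s: "0 < s1" "0 < s2" "0 < \<tau>" using \<tau> p by (auto intro: less_le_trans[of 0 "p * \<tau>" s2])
  define cb where "cb = (R powr (p - 1)) powr s1"
  define cc where "cc = R powr s2"
  define cd where "cd = (R powr p) powr \<tau>"
  define ce where "ce = (R powr (p - 1) / K powr (p - 1)) powr s1"
  define cf where "cf = (R powr p / K powr (p - 1)) powr \<tau>"
  define cg where "cg = (R powr p / K powr p) powr \<tau>"
  \<comment> \<open>The factor \<open>4\<close> counts the constant summand of \<open>coef\<close>
    and the three lowered exponents, for \<open>b\<close>, \<open>c\<close> and \<open>e\<close>.
    Three further ones, from the normalised \<open>e\<close>, \<open>f\<close>, \<open>g\<close>,
    give the \<open>7\<close> in the claim.\<close>
  define bd where "bd x = 7 powr \<tau> * (4 * indicator B2 x + cb * q b s1 x + cc * q c s2 x + cd * q d \<tau> x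
      + ce * q e s1 x + cf * q f \<tau> x + cg * q g \<tau> x)" for x
  have ibd: "integrable N bd"
  proof -
    have "integrable N (indicator B2 :: 'n \<Rightarrow> real)" by (rule integrable_real_indicator) (auto simp: emeasure_eq_measure)
    then show ?thesis unfolding bd_def[abs_def]
      by (intro integrable_mult_right Bochner_Integration.integrable_add int L)
  qed
  have H_le: "H x powr \<tau> \<le> bd x" for x
  proof (cases "x \<in> B2")
    case True
    have "\<forall>h\<in>{b, c, d, e, f, g}. 0 \<le> h x" using str True ball_subset unfolding structure_conditions_def by blast
    then have nn: "0 \<le> b x" "0 \<le> c x" "0 \<le> d x" "0 \<le> e x" "0 \<le> f x" "0 \<le> g x" by auto
    have a2: "(R powr (p - 1) * b x) powr \<tau> \<le> 1 + cb * q b s1 x"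
      using powr_le_one_plus_powr[of "R powr (p - 1) * b x" \<tau> s1] nn \<tau> True
      by (simp add: cb_def q_def powr_mult)
    have a3: "((R * c x) powr p) powr \<tau> \<le> 1 + cc * q c s2 x"
      using powr_le_one_plus_powr[of "R * c x" "p * \<tau>" s2] nn \<tau> True radius_pos p
      by (simp add: cc_def q_def powr_mult powr_powr)
    have a4: "(R powr p * d x) powr \<tau> = cd * q d \<tau> x" using nn True by (simp add: cd_def q_def powr_mult)
    have e5: "R powr (p - 1) * e x / K powr (p - 1) = (R powr (p - 1) / K powr (p - 1)) * e x" by simp
    have a5: "(R powr (p - 1) * e x / K powr (p - 1)) powr \<tau> \<le> 1 + ce * q e s1 x"
      unfolding e5 ce_def q_def
      using powr_le_one_plus_powr[of "(R powr (p - 1) / K powr (p - 1)) * e x" \<tau> s1] nn \<tau> True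
        powr_mult[of "R powr (p - 1) / K powr (p - 1)" "e x" s1] by simp
    have e6: "R powr p * f x / K powr (p - 1) = (R powr p / K powr (p - 1)) * f x" by simp
    have a6: "(R powr p * f x / K powr (p - 1)) powr \<tau> = cf * q f \<tau> x"
      unfolding e6 cf_def q_def using nn True powr_mult[of "R powr p / K powr (p - 1)" "f x" \<tau>] by simp
    have e7: "R powr p * g x / K powr p = (R powr p / K powr p) * g x" by simp
    have a7: "(R powr p * g x / K powr p) powr \<tau> = cg * q g \<tau> x"
      unfolding e7 cg_def q_def using nn True powr_mult[of "R powr p / K powr p" "g x" \<tau>] by simp
    have "H x powr \<tau> \<le> 7 powr \<tau> * (1 powr \<tau> + (R powr (p - 1) * b x) powr \<tau> + ((R * c x) powr p) powr \<tau> + (R powr p * d x) powr \<tau>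
      + (R powr (p - 1) * e x / K powr (p - 1)) powr \<tau> + (R powr p * f x / K powr (p - 1)) powr \<tau> + (R powr p * g x / K powr p) powr \<tau>)"
      unfolding H_def coef_def using nn True s by (simp only: indicator_simps mult_1_left) (intro powr_sum7_le; simp)
    also have "\<dots> \<le> bd x"
      unfolding bd_def a4 a6 a7
    proof (rule mult_left_mono)
      show "1 powr \<tau> + (R powr (p - 1) * b x) powr \<tau> + ((R * c x) powr p) powr \<tau> + cd * q d \<tau> x
          + (R powr (p - 1) * e x / K powr (p - 1)) powr \<tau> + cf * q f \<tau> x + cg * q g \<tau> x
        \<le> 4 * indicator B2 x + cb * q b s1 x + cc * q c s2 x + cd * q d \<tau> x + ce * q e s1 x + cf * q f \<tau> x + cg * q g \<tau> x"
        using a2 a3 a5 True by simp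
    qed simp
    finally show ?thesis .
  next
    case False
    then show ?thesis by (simp add: H_def bd_def q_def)
  qed
  have iH: "integrable N (\<lambda>x. H x powr \<tau>)"
  proof (rule Bochner_Integration.integrable_bound[OF ibd])
    show "AE x in N. norm (H x powr \<tau>) \<le> norm (bd x)"
      using H_le by (intro AE_I2) (metis abs_ge_self abs_of_nonneg order_trans powr_ge_zero real_norm_def)
  qed measurable
  then show ?int unfolding H_def .
  have sc: "a powr s * I h s = (a * I h s powr (1 / s)) powr s" if "0 \<le> a" "0 < s" "0 \<le> I h s" for a s h
    using that by (simp add: powr_mult powr_powr)
  have "(\<integral>x. H x powr \<tau> \<partial>N) \<le> (\<integral>x. bd x \<partial>N)" by (rule integral_mono[OF iH ibd H_le])
  also have "\<dots> = 7 powr \<tau> * (4 * measure N B2 + cb * I b s1 + cc * I c s2 + cd * I d \<tau> + ce * I e s1 + cf * I f \<tau> + cg * I g \<tau>)"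
    unfolding bd_def[abs_def] using int[OF L(1)] int[OF L(2)] int[OF L(3)] int[OF L(4)] int[OF L(5)] int[OF L(6)]
      wav[OF L(1)] wav[OF L(2)] wav[OF L(3)] wav[OF L(4)] wav[OF L(5)] wav[OF L(6)]
    by (simp add: emeasure_eq_measure)
  also have "\<dots> \<le> 7 powr \<tau> * (7 + (R powr (p - 1) * I b s1 powr (1 / s1)) powr s1
        + (R * I c s2 powr (1 / s2)) powr s2 + (R powr p * I d \<tau> powr (1 / \<tau>)) powr \<tau>)"
  proof (rule mult_left_mono)
    have 1: "cb * I b s1 = (R powr (p - 1) * I b s1 powr (1 / s1)) powr s1"
      unfolding cb_def by (rule sc) (use s I0 L in auto)
    have 2: "cc * I c s2 = (R * I c s2 powr (1 / s2)) powr s2"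
      unfolding cc_def by (rule sc) (use s I0 L radius_pos in auto)
    have 3: "cd * I d \<tau> = (R powr p * I d \<tau> powr (1 / \<tau>)) powr \<tau>"
      unfolding cd_def by (rule sc) (use s I0 L in auto)
    have 4: "ce * I e s1 \<le> 1"
    proof -
      have "ce * I e s1 = ((R powr (p - 1) / K powr (p - 1)) * I e s1 powr (1 / s1)) powr s1"
        unfolding ce_def by (rule sc) (use s I0 L in auto)
      also have "\<dots> \<le> 1" using eR K s unfolding I_def[symmetric] by (intro powr_le1) auto
      finally show ?thesis .
    qed
    have 5: "cf * I f \<tau> \<le> 1"
    proof -
      have "cf * I f \<tau> = ((R powr p / K powr (p - 1)) * I f \<tau> powr (1 / \<tau>)) powr \<tau>"
        unfolding cf_def by (rule sc) (use s I0 L in auto)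
      also have "\<dots> \<le> 1" using fR K s unfolding I_def[symmetric] by (intro powr_le1) auto
      finally show ?thesis .
    qed
    have 6: "cg * I g \<tau> \<le> 1"
    proof -
      have "cg * I g \<tau> = ((R powr p / K powr p) * I g \<tau> powr (1 / \<tau>)) powr \<tau>"
        unfolding cg_def by (rule sc) (use s I0 L in auto)
      also have "\<dots> \<le> 1" using gR K s unfolding I_def[symmetric] by (intro powr_le1) auto
      finally show ?thesis .
    qed
    show "4 * measure N B2 + cb * I b s1 + cc * I c s2 + cd * I d \<tau> + ce * I e s1 + cf * I f \<tau> + cg * I g \<tau>
      \<le> 7 + (R powr (p - 1) * I b s1 powr (1 / s1)) powr s1
        + (R * I c s2 powr (1 / s2)) powr s2 + (R powr p * I d \<tau> powr (1 / \<tau>)) powr \<tau>"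
      using 1 2 3 4 5 6 mass_one by linarith
  qed simp
  finally show "(\<integral>x. (indicator B2 x * coef p R K (b x) (c x) (d x) (e x) (f x) (g x)) powr \<tau> \<partial>N) \<le>
      7 powr \<tau> * (7 + (R powr (p - 1) * wavg w B2 (\<lambda>x. \<bar>b x\<bar> powr s1) powr (1 / s1)) powr s1
        + (R * wavg w B2 (\<lambda>x. \<bar>c x\<bar> powr s2) powr (1 / s2)) powr s2
        + (R powr p * wavg w B2 (\<lambda>x. \<bar>d x\<bar> powr \<tau>) powr (1 / \<tau>)) powr \<tau>)"
    unfolding H_def I_def .
qed

lemma H1pw_loc_measurable:
  assumes "H1pw_loc p w B2 u G"
  shows "set_borel_measurable lebesgue B2 u"
proof (rule set_borel_measurable_ball_exhaust[OF radius_pos])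
  fix s assume s: "s < 2 * R"
  define t where "t = (max s 0 + 2 * R) / 2"
  have t: "s < t" "0 < t" "t < 2 * R" unfolding t_def using s radius_pos by (auto simp: max_def)
  have "cpt_sub (ball x0 t) B2" unfolding cpt_sub_def using t by (auto simp: subset_iff)
  then have "H1pw p w (ball x0 t) u G" using assms unfolding H1pw_loc_def by simp
  then have "(\<lambda>x. indicator (ball x0 t) x *\<^sub>R u x) \<in> borel_measurable lebesgue"
    unfolding H1pw_def Lsw_def set_borel_measurable_def by blast
  then have "(\<lambda>x. indicator (cball x0 s) x *\<^sub>R (indicator (ball x0 t) x *\<^sub>R u x)) \<in> borel_measurable lebesgue"
    by - (rule borel_measurable_scaleR[OF borel_measurable_indicator], auto)
  moreover have "(\<lambda>x. indicator (cball x0 s) x *\<^sub>R (indicator (ball x0 t) x *\<^sub>R u x)) = (\<lambda>x. indicator (cball x0 s) x *\<^sub>R u x)"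
    using t by (auto simp: fun_eq_iff indicator_def)
  ultimately show "set_borel_measurable lebesgue (cball x0 s) u" unfolding set_borel_measurable_def by (simp only:)
qed

text \<open>Finiteness is assumed because the average is a Bochner integral, which has value zero
  when the function is not integrable; the comparison would then be false in general.\<close>

lemma energy_avg:
  assumes p: "1 < p" and H: "H1pw_loc p w B2 u G"
    and fin: "(\<integral>\<^sup>+ x. ennreal (indicator B2 x * (\<bar>u x\<bar> powr p * w x)) \<partial>lebesgue) < \<infinity>"
  shows "(\<integral>x. \<bar>indicator V x * u x\<bar> powr p \<partial>N) \<le> wavg w B2 (\<lambda>y. \<bar>u y\<bar> powr p)"
proof -
  have mu [measurable]: "(\<lambda>x. indicator B2 x * u x) \<in> borel_measurable lebesgue"
    using H1pw_loc_measurable[OF H] unfolding set_borel_measurable_def by simp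
  have e: "\<bar>indicator B2 x * u x\<bar> powr p = indicator B2 x * \<bar>u x\<bar> powr p" for x
    using p by (auto simp: indicator_def)
  have "(\<lambda>x. \<bar>indicator B2 x * u x\<bar> powr p) \<in> borel_measurable lebesgue" by measurable
  then have m: "(\<lambda>x. indicator B2 x * \<bar>u x\<bar> powr p) \<in> borel_measurable lebesgue" unfolding e .
  have "(\<lambda>x. \<bar>indicator B2 x * u x\<bar> powr p * (indicator B2 x * w x)) \<in> borel_measurable lebesgue"
    by measurable
  moreover have "\<bar>indicator B2 x * u x\<bar> powr p * (indicator B2 x * w x) = indicator B2 x *\<^sub>R (\<bar>u x\<bar> powr p * w x)" for x
    by (simp add: indicator_def)
  ultimately have m2: "(\<lambda>x. indicator B2 x *\<^sub>R (\<bar>u x\<bar> powr p * w x)) \<in> borel_measurable lebesgue" by simp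
  have "set_integrable lebesgue B2 (\<lambda>x. \<bar>u x\<bar> powr p * w x)"
    unfolding set_integrable_def
  proof (rule integrableI_bounded[OF m2])
    have "(\<integral>\<^sup>+x. ennreal (norm (indicator B2 x *\<^sub>R (\<bar>u x\<bar> powr p * w x))) \<partial>lebesgue)
      = (\<integral>\<^sup>+ x. ennreal (indicator B2 x * (\<bar>u x\<bar> powr p * w x)) \<partial>lebesgue)"
      by (rule nn_integral_cong_AE) (use w_AE_pos in eventually_elim, auto simp: indicator_def abs_mult)
    then show "(\<integral>\<^sup>+x. ennreal (norm (indicator B2 x *\<^sub>R (\<bar>u x\<bar> powr p * w x))) \<partial>lebesgue) < \<infinity>" using fin by simp
  qed
  then have i: "integrable N (\<lambda>x. indicator B2 x * \<bar>u x\<bar> powr p)" by (subst (asm) N_conversion(2)[OF m]) auto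
  have "cpt_sub V B2" unfolding cpt_sub_def using radius_pos by (auto simp: subset_iff)
  then have "H1pw p w V u G" using H unfolding H1pw_loc_def by simp
  then have "integrable N (\<lambda>x. \<bar>indicator V x * u x\<bar> powr p)"
    unfolding H1pw_def by (intro Lsw_imp_integrable(2)[OF _ V_subset(2)]) (use p in auto)
  then have "(\<integral>x. \<bar>indicator V x * u x\<bar> powr p \<partial>N) \<le> (\<integral>x. indicator B2 x * \<bar>u x\<bar> powr p \<partial>N)"
    using V_subset(2) by (intro integral_mono i) (auto simp: indicator_def)
  then show ?thesis unfolding wavg_B2[OF m] .
qed

end

text \<open>\<open>l\<close> is the Hoelder weight of the Sobolev norm, \<open>1 / \<tau> + l / \<kappa> + (1 - l) = 1\<close>. The cutoff powers \<open>n\<close>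
  (Sobolev) and \<open>m\<close> (test function) are chosen such that \<open>n p l + p \<le> m \<le> n p\<close>.\<close>

definition sup_const :: "real \<Rightarrow> real \<Rightarrow> real \<Rightarrow> real \<Rightarrow> real \<Rightarrow> real \<Rightarrow> real \<Rightarrow> real \<Rightarrow> real" where
  "sup_const \<epsilon> p \<gamma> C1 \<rho> bR cR dR =
    (let D = log 2 \<gamma>; \<tau> = D / (p - \<epsilon>); \<kappa> = D / (D - p + \<epsilon> / 2); l = (p - \<epsilon>) / (p - \<epsilon> / 2);
         n = nat \<lceil>(p + 1) / (p * (1 - l))\<rceil> + 2; m = nat \<lfloor>real n * p\<rfloor>;
         M = 7 powr \<tau> * (7 + bR powr (D / (p - 1)) + cR powr (D / (1 - \<epsilon>)) + dR powr \<tau>)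
     in max 1 (threshold (level_const (sob_const \<gamma> p C1 \<rho> \<kappa>) p \<kappa> n m \<tau> M) p n l (1 - 1 / \<tau> - 1 / \<kappa>) powr (- (1 / p))))"

lemma sup_const_pos: "1 \<le> sup_const \<epsilon> p \<gamma> C1 \<rho> bR cR dR"
  unfolding sup_const_def Let_def by simp

lemma threshold_pos: "0 < threshold c p n l \<theta>"
proof -
  have "0 < iter_const c p n l" unfolding iter_const_def by simp
  then show ?thesis unfolding threshold_def by simp
qed

lemma weighted_local_boundedness:
  fixes \<Omega> :: "'n::euclidean_space set"
  assumes \<Omega>: "open \<Omega>" and w: "is_weight \<Omega> w" "doubling_with \<Omega> w \<gamma>" and poin: "poincare_with \<Omega> w p C1 \<rho>"
    and p: "1 < p" "p < log 2 \<gamma>" and \<gamma>: "0 < \<gamma>" and \<epsilon>: "0 < \<epsilon>" "\<epsilon> < 1"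
    and str: "structure_conditions \<Omega> w p A B b c d e f g"
    and L: "Lsw (log 2 \<gamma> / (p - 1)) w \<Omega> b" "Lsw (log 2 \<gamma> / (p - 1)) w \<Omega> e" "Lsw (log 2 \<gamma> / (1 - \<epsilon>)) w \<Omega> c"
      "Lsw (log 2 \<gamma> / (p - \<epsilon>)) w \<Omega> d" "Lsw (log 2 \<gamma> / (p - \<epsilon>)) w \<Omega> f" "Lsw (log 2 \<gamma> / (p - \<epsilon>)) w \<Omega> g"
    and R: "0 < R" "ball x0 (2 * R) \<subseteq> \<Omega>"
    and sol: "local_weak_solution p w A B (ball x0 (2 * R)) u"
    and fin: "(\<integral>\<^sup>+ x. ennreal (indicator (ball x0 (2 * R)) x * (\<bar>u x\<bar> powr p * w x)) \<partial>lebesgue) < \<infinity>"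
  defines "D \<equiv> log 2 \<gamma>" and "B2 \<equiv> ball x0 (2 * R)"
  defines "bR \<equiv> R powr (p - 1) * (wavg w B2 (\<lambda>x. \<bar>b x\<bar> powr (D / (p - 1)))) powr ((p - 1) / D)"
    and "cR \<equiv> R * (wavg w B2 (\<lambda>x. \<bar>c x\<bar> powr (D / (1 - \<epsilon>)))) powr ((1 - \<epsilon>) / D)"
    and "dR \<equiv> R powr p * (wavg w B2 (\<lambda>x. \<bar>d x\<bar> powr (D / (p - \<epsilon>)))) powr ((p - \<epsilon>) / D)"
    and "eR \<equiv> R powr (p - 1) * (wavg w B2 (\<lambda>x. \<bar>e x\<bar> powr (D / (p - 1)))) powr ((p - 1) / D)"
    and "fR \<equiv> R powr p * (wavg w B2 (\<lambda>x. \<bar>f x\<bar> powr (D / (p - \<epsilon>)))) powr ((p - \<epsilon>) / D)"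
    and "gR \<equiv> R powr p * (wavg w B2 (\<lambda>x. \<bar>g x\<bar> powr (D / (p - \<epsilon>)))) powr ((p - \<epsilon>) / D)"
  shows "AE x in lebesgue. x \<in> ball x0 R \<longrightarrow> \<bar>u x\<bar> \<le> sup_const \<epsilon> p \<gamma> C1 \<rho> bR cR dR
    * ((wavg w B2 (\<lambda>y. \<bar>u y\<bar> powr p)) powr (1 / p) + ((eR + fR) powr (1 / (p - 1)) + gR powr (1 / p)))"
proof -
  interpret W: weighted_ball \<Omega> w \<gamma> x0 R
    by unfold_locales (use \<Omega> w \<gamma> R in auto)
  define \<tau> where "\<tau> = D / (p - \<epsilon>)"
  define \<kappa> where "\<kappa> = D / (D - p + \<epsilon> / 2)"
  define l where "l = (p - \<epsilon>) / (p - \<epsilon> / 2)"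
  define n where "n = nat \<lceil>(p + 1) / (p * (1 - l))\<rceil> + 2"
  define m where "m = nat \<lfloor>real n * p\<rfloor>"
  define M where "M = 7 powr \<tau> * (7 + bR powr (D / (p - 1)) + cR powr (D / (1 - \<epsilon>)) + dR powr \<tau>)"
  define thr where "thr = threshold (level_const (sob_const \<gamma> p C1 \<rho> \<kappa>) p \<kappa> n m \<tau> M) p n l (1 - 1 / \<tau> - 1 / \<kappa>)"
  define C where "C = sup_const \<epsilon> p \<gamma> C1 \<rho> bR cR dR"
  define avg where "avg = wavg w B2 (\<lambda>y. \<bar>u y\<bar> powr p)"
  define kR where "kR = (eR + fR) powr (1 / (p - 1)) + gR powr (1 / p)"
  have C: "C = max 1 (thr powr (- (1 / p)))"
    unfolding C_def sup_const_def Let_def thr_def M_def m_def n_def l_def \<kappa>_def \<tau>_def D_def[symmetric] ..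
  have D: "p < D" "0 < D" "0 < D - p + \<epsilon> / 2" "0 < p - \<epsilon>" "0 < p - \<epsilon> / 2" using p \<epsilon> unfolding D_def by auto
  have \<tau>1: "1 < \<tau>" unfolding \<tau>_def using D \<epsilon> by simp
  have \<kappa>1: "1 < \<kappa>" unfolding \<kappa>_def using D by simp
  have inv: "1 / \<tau> = (p - \<epsilon>) / D" "1 / \<kappa> = (D - p + \<epsilon> / 2) / D" unfolding \<tau>_def \<kappa>_def by auto
  have \<kappa>2: "D * (\<kappa> - 1) < p * \<kappa>"
  proof -
    have "\<kappa> * (D - p + \<epsilon> / 2) = D" unfolding \<kappa>_def using D by simp
    then have "p * \<kappa> - D * (\<kappa> - 1) = \<kappa> * (\<epsilon> / 2)" by (simp add: algebra_simps)
    moreover have "0 < \<kappa> * (\<epsilon> / 2)" using \<kappa>1 \<epsilon> by simp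
    ultimately show ?thesis by linarith
  qed
  have l1: "0 < l" "l < 1" unfolding l_def using D \<epsilon> by auto
  \<comment> \<open>The choice of \<open>l\<close> amounts to
    \<open>l * (1 - 1 / \<kappa>) = 1 / \<tau>\<close>: the surplus integrability of the Sobolev
    norm, used with weight \<open>l\<close>, pays for a coefficient that is only in
    \<open>L^\<tau>\<close>.\<close>
  have l3: "1 / \<tau> + l / \<kappa> + (1 - l) = 1"
  proof -
    have "l * (1 - 1 / \<kappa>) = l * ((p - \<epsilon> / 2) / D)" unfolding inv using D by (simp add: field_simps)
    also have "\<dots> = 1 / \<tau>" unfolding inv l_def using D by simp
    finally show ?thesis by (simp add: algebra_simps)
  qed
  have \<theta>: "0 < 1 - 1 / \<tau> - 1 / \<kappa>" unfolding inv using D \<epsilon> by (simp add: field_simps)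
  have n2: "2 \<le> n" unfolding n_def by simp
  \<comment> \<open>The extra one covers the rounding in \<open>m\<close>, so that
    \<open>n * p * l + p \<le> n * p - 1 \<le> m\<close>.\<close>
  have nl: "p + 1 \<le> real n * (p * (1 - l))"
  proof -
    have "(p + 1) / (p * (1 - l)) \<le> real n" unfolding n_def by linarith
    then show ?thesis using p l1 by (simp add: pos_divide_le_eq)
  qed
  have np: "2 \<le> real n * p" using mult_mono[of 2 "real n" 1 p] n2 p by simp
  have m: "2 \<le> m" "real m \<le> real n * p" "real n * p * l + p \<le> real m"
  proof -
    have f2: "2 \<le> \<lfloor>real n * p\<rfloor>" using np by linarith
    show "2 \<le> m" unfolding m_def using f2 by linarith
    show "real m \<le> real n * p" unfolding m_def using f2 by linarith
    have "real n * p - 1 \<le> real m" unfolding m_def using f2 by linarith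
    moreover have "real n * p * l + p \<le> real n * p - 1" using nl by (simp add: algebra_simps)
    ultimately show "real n * p * l + p \<le> real m" by linarith
  qed
  have pm: "p < real m"
  proof -
    have "0 < real n * p * l" using np l1 by simp
    then show ?thesis using m by linarith
  qed
  \<comment> \<open>All coefficients fit the single exponent \<open>\<tau>\<close>. The coefficient
    \<open>c\<close> enters \<open>coef\<close> with power \<open>p\<close>, hence the comparison
    \<open>p * (1 - \<epsilon>) \<le> p - \<epsilon>\<close>.\<close>
  have s: "\<tau> \<le> D / (p - 1)" "p * \<tau> \<le> D / (1 - \<epsilon>)"
  proof -
    show "\<tau> \<le> D / (p - 1)" unfolding \<tau>_def using D p \<epsilon> by (intro divide_left_mono) auto
    have "D / ((p - \<epsilon>) / p) \<le> D / (1 - \<epsilon>)"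
    proof (intro divide_left_mono)
      have "p * (1 - \<epsilon>) \<le> p - \<epsilon>" using p \<epsilon> by (simp add: algebra_simps)
      then show "1 - \<epsilon> \<le> (p - \<epsilon>) / p" using p by (simp add: pos_le_divide_eq mult.commute)
    qed (use D p \<epsilon> in auto)
    then show "p * \<tau> \<le> D / (1 - \<epsilon>)" unfolding \<tau>_def by (simp add: mult.commute)
  qed
  have thr: "0 < thr" unfolding thr_def by (rule threshold_pos)
  from sol obtain G where Hloc: "H1pw_loc p w B2 u G"
    and weak: "\<And>\<phi> D\<phi> K. H1pw p w B2 \<phi> D\<phi> \<Longrightarrow> compact K \<Longrightarrow> K \<subseteq> B2 \<Longrightarrow> (\<And>x. x \<in> B2 - K \<Longrightarrow> \<phi> x = 0) \<Longrightarrow>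
       set_integrable lebesgue B2 (\<lambda>x. A x (u x) (G x) \<bullet> D\<phi> x + B x (u x) (G x) * \<phi> x) \<and>
       (LINT x:B2|lebesgue. A x (u x) (G x) \<bullet> D\<phi> x + B x (u x) (G x) * \<phi> x) = 0"
    unfolding local_weak_solution_def B2_def by blast
  have "cpt_sub W.V B2" unfolding cpt_sub_def B2_def using R by (auto simp: subset_iff)
  then have H: "H1pw p w W.V u G" using Hloc unfolding H1pw_loc_def by simp
  have avg_le: "(\<integral>x. \<bar>indicator W.V x * u x\<bar> powr p \<partial>W.N) \<le> avg"
    unfolding avg_def B2_def by (rule W.energy_avg[OF p(1) Hloc[unfolded B2_def] fin])
  have avg0: "0 \<le> avg" using avg_le by (rule order_trans[rotated]) simp
  have nonneg: "0 \<le> eR" "0 \<le> fR" "0 \<le> gR" unfolding eR_def fR_def gR_def using R by auto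
  have kR0: "0 \<le> kR" unfolding kR_def by simp
  \<comment> \<open>The slack \<open>\<sigma>\<close> keeps the top level positive when \<open>u\<close> and the data vanish.\<close>
  have main: "AE x in lebesgue. x \<in> ball x0 R \<longrightarrow> \<bar>u x\<bar> \<le> C * (avg powr (1 / p) + kR + \<sigma>)" if \<sigma>: "0 < \<sigma>" for \<sigma>
  proof -
    define K where "K = C * (avg powr (1 / p) + kR + \<sigma>)"
    have C1: "1 \<le> C" unfolding C by simp
    have base: "0 < avg powr (1 / p) + kR + \<sigma>" using kR0 \<sigma> powr_ge_zero[of avg "1 / p"] by linarith
    have KR: "kR \<le> K"
    proof -
      have "kR \<le> 1 * (avg powr (1 / p) + kR + \<sigma>)" using \<sigma> powr_ge_zero[of avg "1 / p"] by simp
      also have "\<dots> \<le> K" unfolding K_def using C1 base by (intro mult_right_mono) auto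
      finally show ?thesis .
    qed
    have K: "0 < K" unfolding K_def using C1 base by simp
    have ef: "eR + fR \<le> K powr (p - 1)"
    proof -
      have "eR + fR = ((eR + fR) powr (1 / (p - 1))) powr (p - 1)" using nonneg p by (simp add: powr_powr)
      also have "\<dots> \<le> K powr (p - 1)"
      proof (rule powr_mono2)
        show "(eR + fR) powr (1 / (p - 1)) \<le> K" using KR powr_ge_zero[of gR "1 / p"] unfolding kR_def by linarith
      qed (use p in auto)
      finally show ?thesis .
    qed
    have g: "gR \<le> K powr p"
    proof -
      have "gR = (gR powr (1 / p)) powr p" using nonneg p by (simp add: powr_powr)
      also have "\<dots> \<le> K powr p"
      proof (rule powr_mono2)
        show "gR powr (1 / p) \<le> K" using KR powr_ge_zero[of "eR + fR" "1 / (p - 1)"] unfolding kR_def by linarith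
      qed (use p in auto)
      finally show ?thesis .
    qed
    have exps: "(p - 1) / D = 1 / (D / (p - 1))" "(1 - \<epsilon>) / D = 1 / (D / (1 - \<epsilon>))" "(p - \<epsilon>) / D = 1 / \<tau>"
      unfolding \<tau>_def by auto
    define h where "h x = indicator B2 x * coef p R K (b x) (c x) (d x) (e x) (f x) (g x)" for x
    note cn = W.coef_norm[OF p(1) K \<tau>1 s str L(1)[folded D_def] L(3)[folded D_def] L(4)[folded D_def, folded \<tau>_def]
        L(2)[folded D_def] L(5)[folded D_def, folded \<tau>_def] L(6)[folded D_def, folded \<tau>_def], folded B2_def, folded exps,
        folded \<tau>_def]
    have c1: "R powr (p - 1) * wavg w B2 (\<lambda>x. \<bar>e x\<bar> powr (D / (p - 1))) powr ((p - 1) / D) \<le> K powr (p - 1)"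
      using ef nonneg unfolding eR_def by linarith
    have c2: "R powr p * wavg w B2 (\<lambda>x. \<bar>f x\<bar> powr \<tau>) powr ((p - \<epsilon>) / D) \<le> K powr (p - 1)"
      using ef nonneg unfolding fR_def \<tau>_def by linarith
    have c3: "R powr p * wavg w B2 (\<lambda>x. \<bar>g x\<bar> powr \<tau>) powr ((p - \<epsilon>) / D) \<le> K powr p"
      using g unfolding gR_def \<tau>_def .
    note cn' = cn[OF c1 c2 c3, folded h_def]
    have hM: "(\<integral>x. h x powr \<tau> \<partial>W.N) \<le> M"
      using cn'(2) unfolding M_def bR_def cR_def dR_def \<tau>_def .
    have h1: "1 \<le> h x" if "x \<in> B2" for x
    proof -
      have "\<forall>h\<in>{b, c, d, e, f, g}. 0 \<le> h x" using str that R unfolding structure_conditions_def B2_def by blast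
      then have "0 \<le> b x" "0 \<le> c x" "0 \<le> d x" "0 \<le> e x" "0 \<le> f x" "0 \<le> g x" by auto
      then have "1 \<le> coef p R K (b x) (c x) (d x) (e x) (f x) (g x)"
        unfolding coef_def using R K by (simp add: add_nonneg_nonneg)
      then show ?thesis using that by (simp add: h_def)
    qed
    have h0: "0 \<le> h x" for x using h1[of x] by (cases "x \<in> B2") (auto simp: h_def)
    \<comment> \<open>The factor \<open>C\<close> in \<open>K\<close> is at least
      \<open>thr powr (- (1 / p))\<close>, which is what turns the average of
      \<open>|u| powr p\<close> into an admissible starting value for the iteration.\<close>
    have "avg \<le> K powr p * thr"
    proof -
      have "thr powr (- (1 / p)) * avg powr (1 / p) \<le> C * (avg powr (1 / p) + kR + \<sigma>)"
        using C1 kR0 \<sigma> by (intro mult_mono) (auto simp: C)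
      then have "(thr powr (- (1 / p)) * avg powr (1 / p)) powr p \<le> K powr p"
        unfolding K_def using p by (intro powr_mono2) auto
      moreover have "(thr powr (- (1 / p)) * avg powr (1 / p)) powr p = avg / thr"
        using p thr avg0 by (simp add: powr_mult powr_divide powr_powr powr_minus_divide)
      ultimately show ?thesis using thr by (simp add: pos_divide_le_eq)
    qed
    then have small: "(\<integral>x. \<bar>indicator W.V x * u x\<bar> powr p \<partial>W.N) \<le> K powr p * thr" using avg_le by linarith
    show ?thesis
      unfolding K_def[symmetric]
    proof (rule W.sup_bound[OF p(1) \<kappa>1 _ \<tau>1 l1 l3 poin n2 m H K _ h0 _ _ hM])
      show "log 2 \<gamma> * (\<kappa> - 1) < p * \<kappa>" using \<kappa>2 unfolding D_def .
      show "h \<in> borel_measurable W.N" unfolding h_def[abs_def] B2_def by (rule W.coef_measurable[OF str])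
      show "1 \<le> h x" if "x \<in> ball x0 (2 * R)" for x using h1 that unfolding B2_def by simp
      show "integrable W.N (\<lambda>x. h x powr \<tau>)" by (rule cn'(1))
      show "0 < 1 - 1 / \<tau> - 1 / \<kappa>" by (rule \<theta>)
      show "(\<integral>x. \<bar>indicator W.V x * u x\<bar> powr p \<partial>W.N) \<le> K powr p *
          threshold (level_const (sob_const \<gamma> p C1 \<rho> \<kappa>) p \<kappa> n m \<tau> M) p n l (1 - 1 / \<tau> - 1 / \<kappa>)"
        using small unfolding thr_def .
      show "R powr p * (\<integral>x. trunc' k \<delta> (indicator W.V x * u x) * cutoff x0 r x ^ m * norm (indicator W.V x *\<^sub>R G x) powr p \<partial>W.N)
        \<le> 2 * (8 * real m) powr p * (\<integral>x. of_bool (k < \<bar>indicator W.V x * u x\<bar>) * (cutoff x0 r x powr (real m - p)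
          * \<bar>indicator W.V x * u x\<bar> powr p * h x) \<partial>W.N)"
        if "K / 4 \<le> k" "0 < \<delta>" "R \<le> r" "r \<le> 5 / 4 * R"
          "integrable W.N (\<lambda>x. of_bool (k < \<bar>indicator W.V x * u x\<bar>) * (cutoff x0 r x powr (real m - p)
            * \<bar>indicator W.V x * u x\<bar> powr p * h x))" for k \<delta> r
        unfolding h_def B2_def
        by (rule W.caccioppoli[OF p(1) m(1) pm K that(1-4) str H weak[unfolded B2_def] that(5)[unfolded h_def B2_def]])
    qed
  qed
  have "AE x in lebesgue. \<forall>i. x \<in> ball x0 R \<longrightarrow> \<bar>u x\<bar> \<le> C * (avg powr (1 / p) + kR + inverse (real (Suc i)))"
    unfolding AE_all_countable by (intro allI main) simp
  then have "AE x in lebesgue. x \<in> ball x0 R \<longrightarrow> \<bar>u x\<bar> \<le> C * (avg powr (1 / p) + kR)"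
  proof eventually_elim
    case (elim x)
    show ?case
    proof
      assume x: "x \<in> ball x0 R"
      have "(\<lambda>i. C * (avg powr (1 / p) + kR + inverse (real (Suc i)))) \<longlonglongrightarrow> C * (avg powr (1 / p) + kR + 0)"
        by (intro tendsto_intros LIMSEQ_inverse_real_of_nat)
      then have "\<bar>u x\<bar> \<le> C * (avg powr (1 / p) + kR + 0)"
        by (rule LIMSEQ_le_const) (use elim x in blast)
      then show "\<bar>u x\<bar> \<le> C * (avg powr (1 / p) + kR)" by simp
    qed
  qed
  then show ?thesis unfolding C_def avg_def kR_def .
qed

text \<open>\<open>CR\<close> is chosen before all data, so its arguments are its only possible
  dependence; the dimension of the space is fixed by the type, and \<open>D_w\<close> is a function
  of \<open>gamma_w\<close>. If the integral of \<open>|u| powr p\<close> is infinite, the intended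
  inequality is void while the Bochner average would be zero; hence the bound is stated under
  finiteness.\<close>

theorem theorem1p1:
  shows "\<exists>CR :: real \<Rightarrow> real \<Rightarrow> real \<Rightarrow> real \<Rightarrow> real \<Rightarrow> real \<Rightarrow> real \<Rightarrow> real
                \<Rightarrow> real \<Rightarrow> real \<Rightarrow> real \<Rightarrow> real.
    \<forall>(\<Omega> :: 'n::euclidean_space set) w p \<epsilon> C1 \<rho> A B b c d e f g u x0 R.
      open \<Omega> \<and> is_weight \<Omega> w \<and> (\<exists>\<gamma>>0. doubling_with \<Omega> w \<gamma>) \<and> poincare_with \<Omega> w p C1 \<rho> \<and>
      1 < p \<and> p < dim_w \<Omega> w \<and> 0 < \<epsilon> \<and> \<epsilon> < 1 \<and>
      structure_conditions \<Omega> w p A B b c d e f g \<and>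
      Lsw (dim_w \<Omega> w / (p - 1)) w \<Omega> b \<and> Lsw (dim_w \<Omega> w / (p - 1)) w \<Omega> e \<and>
      Lsw (dim_w \<Omega> w / (1 - \<epsilon>)) w \<Omega> c \<and>
      Lsw (dim_w \<Omega> w / (p - \<epsilon>)) w \<Omega> d \<and> Lsw (dim_w \<Omega> w / (p - \<epsilon>)) w \<Omega> f \<and>
      Lsw (dim_w \<Omega> w / (p - \<epsilon>)) w \<Omega> g \<and>
      x0 \<in> \<Omega> \<and> 0 < R \<and> ball x0 (2 * R) \<subseteq> \<Omega> \<and>
      local_weak_solution p w A B (ball x0 (2 * R)) u
      \<longrightarrow>
      (let D = dim_w \<Omega> w; B2 = ball x0 (2 * R);
           bR = R powr (p - 1) * (wavg w B2 (\<lambda>x. \<bar>b x\<bar> powr (D / (p - 1)))) powr ((p - 1) / D);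
           cR = R * (wavg w B2 (\<lambda>x. \<bar>c x\<bar> powr (D / (1 - \<epsilon>)))) powr ((1 - \<epsilon>) / D);
           dR = R powr p * (wavg w B2 (\<lambda>x. \<bar>d x\<bar> powr (D / (p - \<epsilon>)))) powr ((p - \<epsilon>) / D);
           eR = R powr (p - 1) * (wavg w B2 (\<lambda>x. \<bar>e x\<bar> powr (D / (p - 1)))) powr ((p - 1) / D);
           fR = R powr p * (wavg w B2 (\<lambda>x. \<bar>f x\<bar> powr (D / (p - \<epsilon>)))) powr ((p - \<epsilon>) / D);
           gR = R powr p * (wavg w B2 (\<lambda>x. \<bar>g x\<bar> powr (D / (p - \<epsilon>)))) powr ((p - \<epsilon>) / D);
           kR = (eR + fR) powr (1 / (p - 1)) + gR powr (1 / p);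
           C = CR \<epsilon> p (gamma_w \<Omega> w) C1 \<rho> bR cR dR eR fR gR
       in 0 < C \<and>
          ((\<integral>\<^sup>+ x. ennreal (indicator B2 x * (\<bar>u x\<bar> powr p * w x)) \<partial>lebesgue) < \<infinity> \<longrightarrow>
           (AE x in lebesgue. x \<in> ball x0 R \<longrightarrow>
              \<bar>u x\<bar> \<le> C * ((wavg w B2 (\<lambda>y. \<bar>u y\<bar> powr p)) powr (1 / p) + kR))))"
proof (rule exI[of _ "\<lambda>\<epsilon> p \<gamma> C1 \<rho> bR cR dR eR fR gR. sup_const \<epsilon> p \<gamma> C1 \<rho> bR cR dR"], intro allI impI, elim conjE)
  fix \<Omega> :: "'n set" and w p \<epsilon> C1 \<rho> A B b c d e f g u x0 R
  assume as: "open \<Omega>" "is_weight \<Omega> w" "\<exists>\<gamma>>0. doubling_with \<Omega> w \<gamma>" "poincare_with \<Omega> w p C1 \<rho>"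
    "1 < p" "p < dim_w \<Omega> w" "0 < \<epsilon>" "\<epsilon> < 1" "structure_conditions \<Omega> w p A B b c d e f g"
    "Lsw (dim_w \<Omega> w / (p - 1)) w \<Omega> b" "Lsw (dim_w \<Omega> w / (p - 1)) w \<Omega> e"
    "Lsw (dim_w \<Omega> w / (1 - \<epsilon>)) w \<Omega> c"
    "Lsw (dim_w \<Omega> w / (p - \<epsilon>)) w \<Omega> d" "Lsw (dim_w \<Omega> w / (p - \<epsilon>)) w \<Omega> f" "Lsw (dim_w \<Omega> w / (p - \<epsilon>)) w \<Omega> g"
    "x0 \<in> \<Omega>" "0 < R" "ball x0 (2 * R) \<subseteq> \<Omega>" "local_weak_solution p w A B (ball x0 (2 * R)) u"
  note dg = doubling_with_gamma_w[OF as(2,3)]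
  have \<gamma>: "0 < gamma_w \<Omega> w"
  proof (rule ccontr)
    assume "\<not> 0 < gamma_w \<Omega> w"
    then have "gamma_w \<Omega> w = 0" using dg(2) by simp
    \<comment> \<open>By the convention \<open>ln 0 = 0\<close>, a vanishing doubling constant would
      have dimension zero, contrary to \<open>1 < p < dim_w \<Omega> w\<close>.\<close>
    then have "dim_w \<Omega> w = 0" by (simp add: dim_w_def log_def)
    then show False using as(5,6) by simp
  qed
  note bound = weighted_local_boundedness[OF as(1,2) dg(1) as(4,5) as(6)[unfolded dim_w_def] \<gamma> as(7,8,9)
      as(10-15)[unfolded dim_w_def] as(17-19)]
  show "let D = dim_w \<Omega> w; B2 = ball x0 (2 * R);
           bR = R powr (p - 1) * (wavg w B2 (\<lambda>x. \<bar>b x\<bar> powr (D / (p - 1)))) powr ((p - 1) / D);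
           cR = R * (wavg w B2 (\<lambda>x. \<bar>c x\<bar> powr (D / (1 - \<epsilon>)))) powr ((1 - \<epsilon>) / D);
           dR = R powr p * (wavg w B2 (\<lambda>x. \<bar>d x\<bar> powr (D / (p - \<epsilon>)))) powr ((p - \<epsilon>) / D);
           eR = R powr (p - 1) * (wavg w B2 (\<lambda>x. \<bar>e x\<bar> powr (D / (p - 1)))) powr ((p - 1) / D);
           fR = R powr p * (wavg w B2 (\<lambda>x. \<bar>f x\<bar> powr (D / (p - \<epsilon>)))) powr ((p - \<epsilon>) / D);
           gR = R powr p * (wavg w B2 (\<lambda>x. \<bar>g x\<bar> powr (D / (p - \<epsilon>)))) powr ((p - \<epsilon>) / D);
           kR = (eR + fR) powr (1 / (p - 1)) + gR powr (1 / p);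
           C = sup_const \<epsilon> p (gamma_w \<Omega> w) C1 \<rho> bR cR dR
       in 0 < C \<and>
          ((\<integral>\<^sup>+ x. ennreal (indicator B2 x * (\<bar>u x\<bar> powr p * w x)) \<partial>lebesgue) < \<infinity> \<longrightarrow>
           (AE x in lebesgue. x \<in> ball x0 R \<longrightarrow>
              \<bar>u x\<bar> \<le> C * ((wavg w B2 (\<lambda>y. \<bar>u y\<bar> powr p)) powr (1 / p) + kR)))"
    unfolding Let_def dim_w_def
    using bound sup_const_pos[THEN less_le_trans[OF zero_less_one]] by blast
qed

end
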